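(* Let $(R,\mathfrak m)$ be a $d$-dimensional regular local ring with $d\ge 2$, let $V$ be a zero-dimensional real valuation domain birationally dominating $R$ with corresponding valuation $v$, let $R=R_0\subset R_1\subset R_2\subset\cdots\subset V$ be the infinite sequence of local quadratic transforms $(R_n,\mathfrak m_n)$ of $R$ along $V$, and let $s=\sum_{i=0}^\infty v(\mathfrak m_i)\in(0,\infty]$. Then: (1) If $V$ is a DVR, then $s=\infty$ and $\bigcup_{n\ge0}R_n=V$. (2) If $s=\infty$, then the sequence $\{R_n\}_{n\ge0}$ switches strongly infinitely often. (3) If $V$ has rational rank $r\ge2$, then $s<\infty$. Thus if $s=\infty$, then $V$ has rational rank $r=1$. (4) If $V$ has rational rank $1$ and $V$ is not a DVR, then both $s=\infty$ and $s<\infty$ are possible; that is, there exist such $R$ and $V$, with $V$ of rational rank $1$ and not a DVR, for which $s=\infty$, and there exist such $R$ and $V$, with $V$ of rational rank $1$ and not a DVR, for which $s<\infty$.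
   Context: A valuation domain $(V,\mathfrak m_V)$ birationally dominates a local domain $(R,\mathfrak m)$ if $R\subset V\subset\operatorname{Frac}(R)$ and $\mathfrak m_V\cap R=\mathfrak m$; it is zero-dimensional over $R$ if $V/\mathfrak m_V$ is algebraic over $R/\mathfrak m$; it is real if it has rank (Krull dimension) one, with $v$ taking values in $\mathbb R$. The rational rank of $V$ is $\dim_{\mathbb Q}(\Gamma_v\otimes_{\mathbb Z}\mathbb Q)$, $\Gamma_v$ the value group. For an ideal $I$ of $R_i$, $v(I)=\min\{v(a):a\in I\}$. The sequence of local quadratic transforms of $R$ along $V$: $R_0=R$ and, given $R_n$ with maximal ideal $\mathfrak m_n$, choose $a\in\mathfrak m_n$ with $aV=\mathfrak m_nV$; then $R_{n+1}=R_n[\mathfrak m_n/a]_Q$, where $Q=\mathfrak m_V\cap R_n[\mathfrak m_n/a]$ (this is independent of the choice of $a$). The sequence switches strongly infinitely often if there do not exist an integer $j\ge0$ and a height one prime ideal $\mathfrak p_j$ of $R_j$ with $\bigcup_{n\ge0}R_n\subset(R_j)_{\mathfrak p_j}$. *)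

theory Defs
  imports
    "HOL-Algebra.Algebra"
    "HOL-Computational_Algebra.Polynomial"
    "HOL-Computational_Algebra.Fraction_Field"
    "HOL-Library.Extended_Nat"
    "HOL-Library.Extended_Real"
begin

text \<open>
  All rings are subrings of one ambient field \<open>K\<close>, given by their carrier sets.
  Notions for abstract rings are applied to \<open>subring_of K A\<close>.
\<close>

abbreviation subring_of :: "('a, 'b) ring_scheme \<Rightarrow> 'a set \<Rightarrow> ('a, 'b) ring_scheme"
  where "subring_of K A \<equiv> K\<lparr>carrier := A\<rparr>"

subsection \<open>Local rings, dimension, regularity\<close>

definition max_ideal :: "('a, 'b) ring_scheme \<Rightarrow> 'a set"
  where "max_ideal A = (THE M. maximalideal M A)"

definition local_ring :: "('a, 'b) ring_scheme \<Rightarrow> bool"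
  where "local_ring A \<longleftrightarrow> cring A \<and> (\<exists>!M. maximalideal M A)"

definition prime_chain :: "('a, 'b) ring_scheme \<Rightarrow> nat \<Rightarrow> (nat \<Rightarrow> 'a set) \<Rightarrow> bool"
  where "prime_chain A n p \<longleftrightarrow>
    (\<forall>i\<le>n. primeideal (p i) A) \<and> (\<forall>i<n. p i \<subset> p (Suc i))"

definition krull_dim :: "('a, 'b) ring_scheme \<Rightarrow> enat"
  where "krull_dim A = Sup {enat n | n. \<exists>p. prime_chain A n p}"

definition height :: "('a, 'b) ring_scheme \<Rightarrow> 'a set \<Rightarrow> enat"
  where "height A P = Sup {enat n | n. \<exists>p. prime_chain A n p \<and> p n = P}"

definition regular_local_ring :: "('a, 'b) ring_scheme \<Rightarrow> nat \<Rightarrow> bool"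
  where "regular_local_ring A d \<longleftrightarrow>
    noetherian_ring A \<and> local_ring A \<and> krull_dim A = enat d \<and>
    (\<exists>S\<subseteq>carrier A. finite S \<and> card S = d \<and> max_ideal A = Idl\<^bsub>A\<^esub> S)"

definition is_DVR :: "('a, 'b) ring_scheme \<Rightarrow> bool"
  where "is_DVR A \<longleftrightarrow> principal_domain A \<and> local_ring A \<and> \<not> field A"

subsection \<open>Localizations inside the ambient field\<close>

definition localize_at :: "('a, 'b) ring_scheme \<Rightarrow> 'a set \<Rightarrow> 'a set \<Rightarrow> 'a set"
  where "localize_at K A P = {x \<otimes>\<^bsub>K\<^esub> inv\<^bsub>K\<^esub> y | x y. x \<in> A \<and> y \<in> A - P}"

definition fraction_field :: "('a, 'b) ring_scheme \<Rightarrow> 'a set \<Rightarrow> 'a set"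
  where "fraction_field K A = localize_at K A {\<zero>\<^bsub>K\<^esub>}"

subsection \<open>Valuation domains\<close>

text \<open>
  Here \<open>K\<close> is the fraction field of \<open>V\<close>: the defining condition forces every element of \<open>K\<close>
  to be a quotient of elements of \<open>V\<close>.
\<close>

definition valuation_domain :: "('a, 'b) ring_scheme \<Rightarrow> 'a set \<Rightarrow> bool"
  where "valuation_domain K V \<longleftrightarrow> field K \<and> subring V K \<and>
    (\<forall>x\<in>carrier K - {\<zero>\<^bsub>K\<^esub>}. x \<in> V \<or> inv\<^bsub>K\<^esub> x \<in> V)"

text \<open>
  \<open>v\<close> takes finite real values except for \<open>v \<zero> = \<infinity>\<close>. For \<open>V\<close> of rank one, \<open>v\<close> is
  determined by \<open>V\<close> up to a positive real factor.
\<close>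

definition real_valuation :: "('a, 'b) ring_scheme \<Rightarrow> 'a set \<Rightarrow> ('a \<Rightarrow> ereal) \<Rightarrow> bool"
  where "real_valuation K V v \<longleftrightarrow>
    (\<forall>x\<in>carrier K. v x \<noteq> -\<infinity> \<and> (v x = \<infinity> \<longleftrightarrow> x = \<zero>\<^bsub>K\<^esub>)) \<and>
    (\<forall>x\<in>carrier K. \<forall>y\<in>carrier K. v (x \<otimes>\<^bsub>K\<^esub> y) = v x + v y) \<and>
    (\<forall>x\<in>carrier K. \<forall>y\<in>carrier K. min (v x) (v y) \<le> v (x \<oplus>\<^bsub>K\<^esub> y)) \<and>
    V = {x \<in> carrier K. 0 \<le> v x}"

definition real_valuation_domain ::
    "('a, 'b) ring_scheme \<Rightarrow> 'a set \<Rightarrow> ('a \<Rightarrow> ereal) \<Rightarrow> bool"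
  where "real_valuation_domain K V v \<longleftrightarrow>
    valuation_domain K V \<and> krull_dim (subring_of K V) = 1 \<and> real_valuation K V v"

definition birationally_dominates :: "('a, 'b) ring_scheme \<Rightarrow> 'a set \<Rightarrow> 'a set \<Rightarrow> bool"
  where "birationally_dominates K V R \<longleftrightarrow>
    R \<subseteq> V \<and> V \<subseteq> fraction_field K R \<and>
    max_ideal (subring_of K V) \<inter> R = max_ideal (subring_of K R)"

text \<open>
  When \<open>V\<close> dominates \<open>R\<close>, the residue field of \<open>R\<close> is identified with its (injective) image
  in the residue field of \<open>V\<close>, i.e. with the set of cosets of elements of \<open>R\<close>.
\<close>

definition zero_dimensional_over :: "('a, 'b) ring_scheme \<Rightarrow> 'a set \<Rightarrow> 'a set \<Rightarrow> bool"
  where "zero_dimensional_over K V R \<longleftrightarrow>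
    (let A = subring_of K V; M = max_ideal A; L = A Quot M; k = (\<lambda>r. M +>\<^bsub>A\<^esub> r) ` R
     in \<forall>x\<in>carrier L. ring.algebraic L k x)"

definition value_group :: "('a, 'b) ring_scheme \<Rightarrow> ('a \<Rightarrow> ereal) \<Rightarrow> real set"
  where "value_group K v = {\<gamma>. \<exists>x\<in>carrier K - {\<zero>\<^bsub>K\<^esub>}. v x = ereal \<gamma>}"

definition rat_scale :: "rat \<Rightarrow> real \<Rightarrow> real"
  where "rat_scale q x = of_rat q * x"

text \<open>
  As \<open>\<Gamma> \<subseteq> \<real>\<close> is torsion-free and \<open>\<rat>\<close> is flat over \<open>\<int>\<close>, multiplication identifies
  \<open>\<Gamma> \<otimes> \<rat>\<close> with the rational span of \<open>\<Gamma>\<close> in \<open>\<real>\<close>. The library's \<open>dim\<close> is \<open>0\<close> for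
  infinite-dimensional spaces, so that case is separated.
\<close>

definition rational_rank :: "('a, 'b) ring_scheme \<Rightarrow> ('a \<Rightarrow> ereal) \<Rightarrow> enat"
  where "rational_rank K v =
    (let T = module.span rat_scale (value_group K v)
     in if \<exists>B. finite B \<and> T = module.span rat_scale B
        then enat (vector_space.dim rat_scale T) else \<infinity>)"

text \<open>
  The infimum is a minimum for the nonzero ideals it is used for, as those have principal
  extension to \<open>V\<close>.
\<close>

definition ideal_value :: "('a \<Rightarrow> ereal) \<Rightarrow> 'a set \<Rightarrow> ereal"
  where "ideal_value v I = (INF a\<in>I. v a)"

subsection \<open>Local quadratic transforms\<close>

definition local_quadratic_transform ::
    "('a, 'b) ring_scheme \<Rightarrow> 'a set \<Rightarrow> 'a set \<Rightarrow> 'a set \<Rightarrow> bool"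
  where "local_quadratic_transform K V A A' \<longleftrightarrow>
    (let M = max_ideal (subring_of K A) in
     \<exists>a\<in>M. PIdl\<^bsub>subring_of K V\<^esub> a = Idl\<^bsub>subring_of K V\<^esub> M \<and>
       (let B = generate_ring K (A \<union> {x \<otimes>\<^bsub>K\<^esub> inv\<^bsub>K\<^esub> a | x. x \<in> M})
        in A' = localize_at K B (max_ideal (subring_of K V) \<inter> B)))"

definition lqt_sequence ::
    "('a, 'b) ring_scheme \<Rightarrow> 'a set \<Rightarrow> 'a set \<Rightarrow> (nat \<Rightarrow> 'a set) \<Rightarrow> bool"
  where "lqt_sequence K V R Rs \<longleftrightarrow>
    Rs 0 = R \<and> (\<forall>n. local_quadratic_transform K V (Rs n) (Rs (Suc n)))"

definition value_sum ::
    "('a, 'b) ring_scheme \<Rightarrow> ('a \<Rightarrow> ereal) \<Rightarrow> (nat \<Rightarrow> 'a set) \<Rightarrow> ereal"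
  where "value_sum K v Rs = suminf (\<lambda>i. ideal_value v (max_ideal (subring_of K (Rs i))))"

definition switches_strongly_infinitely_often ::
    "('a, 'b) ring_scheme \<Rightarrow> (nat \<Rightarrow> 'a set) \<Rightarrow> bool"
  where "switches_strongly_infinitely_often K Rs \<longleftrightarrow>
    \<not> (\<exists>j p. primeideal p (subring_of K (Rs j)) \<and> height (subring_of K (Rs j)) p = 1 \<and>
        (\<Union>n. Rs n) \<subseteq> localize_at K (Rs j) p)"

definition lqt_setting ::
    "('a, 'b) ring_scheme \<Rightarrow> nat \<Rightarrow> 'a set \<Rightarrow> 'a set \<Rightarrow> ('a \<Rightarrow> ereal) \<Rightarrow> (nat \<Rightarrow> 'a set) \<Rightarrow> bool"
  where "lqt_setting K d R V v Rs \<longleftrightarrow>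
    field K \<and> subring R K \<and> 2 \<le> d \<and> regular_local_ring (subring_of K R) d \<and>
    real_valuation_domain K V v \<and> birationally_dominates K V R \<and>
    zero_dimensional_over K V R \<and> lqt_sequence K V R Rs"

end

theory Submission
  imports Defs
begin

text \<open>
  Every \<open>f\<close> in the maximal ideal \<open>m\<^sub>n\<close> of \<open>R\<^sub>n\<close> is \<open>t\<^sub>n f'\<close> with \<open>f' \<in> R\<^bsub>n + 1\<^esub>\<close>, where \<open>t\<^sub>n \<in> m\<^sub>n\<close> has
  least value. Hence the denominator of an element of \<open>V\<close> outside the union of the \<open>R\<^sub>n\<close> has value at
  least \<open>s\<close>, so that \<open>s = \<infinity>\<close> implies that the union is \<open>V\<close>. As \<open>V\<close> has rank one, a prime of \<open>R\<^sub>j\<close>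
  whose localization contains \<open>V\<close> is maximal, and it remains to see that the dimension does not drop
  to one. For this a quadratic transform is decomposed into steps \<open>A \<mapsto> A[y / x]\<^sub>Q\<close>, with \<open>x, y\<close> part of a
  regular system of parameters. The primes of \<open>A\<close> generated by \<open>x, y\<close> and some of the other parameters
  extend to \<open>A[y / x]\<close>, and \<open>Q\<close> contains a further element because the residue field of \<open>V\<close> is
  algebraic; so each step preserves both the number of parameters and the length of a chain of primes.

  If the values of \<open>a, b \<in> m\<^sub>n\<close> are rationally independent, so are those of \<open>a / t\<^sub>n, t\<^sub>n\<close> or those of
  \<open>b / t\<^sub>n, t\<^sub>n\<close>, and the sum of the two values drops by at least \<open>v t\<^sub>n\<close>. Hence \<open>s \<le> v a + v b\<close>.

  For the examples, let \<open>v (x\<^sub>k) = 1 / 2\<^sup>k\<close> and \<open>v (y\<^sub>k) = (N\<^sub>k + 1 / 2) / 2\<^sup>k\<close> with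
  \<open>x\<^bsub>k + 1\<^esub> = x\<^sub>k\<^bsup>N + 1\<^esup> / y\<^sub>k\<close> and \<open>y\<^bsub>k + 1\<^esub> = y\<^sub>k\<^sup>2 / x\<^sub>k\<^bsup>2 N + 1\<^esup> - 1\<close>, where \<open>N = N\<^sub>k\<close>. It takes \<open>N\<^sub>k + 2\<close>
  transforms from \<open>x\<^sub>k, y\<^sub>k\<close> to \<open>x\<^bsub>k + 1\<^esub>, y\<^bsub>k + 1\<^esub>\<close>, which contribute \<open>(N\<^sub>k + 1) / 2\<^sup>k\<close> to \<open>s\<close>: the sum is
  infinite for \<open>N\<^sub>k = 2\<^sup>k\<close> and finite for \<open>N\<^sub>k = 0\<close>.
\<close>

section \<open>Chains of primes in noetherian local rings\<close>

text \<open>If some transform had dimension one, it would be a DVR, hence equal to \<open>V\<close>,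
  and the sequence would not switch. What keeps the dimension up is zero-dimensionality: a step
  divides away one parameter, and the minimal polynomial of the residue of the quotient supplies a
  new one. Regularity is carried along as two data of equal length, generators of the maximal ideal
  and a chain of primes. The number of generators bounds the length of chains, and equality forces
  the ideals generated by some of the parameters to be prime, which is what the next step uses. The
  valuation of the examples has no closed formula. The substitution inverse to a block of transforms
  at least halves the order in \<open>y\<close> of the initial coefficient, so finitely many of them
  turn a polynomial into a power of \<open>x\<close> times a unit, where its value is visible. The
  summand \<open>1 / 2\<close> in the value of \<open>y_k\<close> has two effects:
  \<open>v x_k\<close> is halved by each block, so that \<open>V\<close> is not discrete, and
  \<open>y_k^2\<close> has the value of a power of \<open>x_k\<close>, so that a residue can be
  prescribed, here \<open>1\<close>. The values of \<open>x_k\<close> do not depend on the integers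
  \<open>N_k\<close>, which remain free to decide the size of \<open>s\<close>.\<close>

lemma (in cring) ideal_intro:
  assumes "I \<subseteq> carrier R" "\<zero> \<in> I" "\<And>a b. a \<in> I \<Longrightarrow> b \<in> I \<Longrightarrow> a \<oplus> b \<in> I"
    "\<And>a r. a \<in> I \<Longrightarrow> r \<in> carrier R \<Longrightarrow> r \<otimes> a \<in> I"
  shows "ideal I R"
proof (rule idealI)
  have neg: "\<ominus> a \<in> I" if "a \<in> I" for a
  proof -
    have "\<ominus> a = (\<ominus> \<one>) \<otimes> a" using that assms(1) by (auto simp: l_minus)
    then show ?thesis using assms(4)[OF that, of "\<ominus> \<one>"] by simp
  qed
  show "subgroup I (add_monoid R)"
    by unfold_locales (use assms neg in \<open>auto simp: a_inv_def[symmetric]\<close>)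
  show "ring R" by (rule ring_axioms)
  show "a \<otimes> x \<in> I" if "a \<in> I" "x \<in> carrier R" for a x
    using assms(1,4) that m_comm by (metis subsetD)
qed (use assms in auto)

lemma (in cring)
  assumes "ideal I R"
  shows ideal_add: "a \<in> I \<Longrightarrow> b \<in> I \<Longrightarrow> a \<oplus> b \<in> I"
    and ideal_minus: "a \<in> I \<Longrightarrow> b \<in> I \<Longrightarrow> a \<ominus> b \<in> I"
    and ideal_mult: "a \<in> I \<Longrightarrow> r \<in> carrier R \<Longrightarrow> r \<otimes> a \<in> I"
    and ideal_zero: "\<zero> \<in> I"
    and ideal_sub: "I \<subseteq> carrier R"
proof -
  interpret ideal I R by fact
  show "a \<in> I \<Longrightarrow> b \<in> I \<Longrightarrow> a \<oplus> b \<in> I" by (simp add: add.m_closed)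
  show "a \<in> I \<Longrightarrow> b \<in> I \<Longrightarrow> a \<ominus> b \<in> I"
    by (simp add: a_minus_def)
  show "a \<in> I \<Longrightarrow> r \<in> carrier R \<Longrightarrow> r \<otimes> a \<in> I" by (rule I_l_closed)
  show "\<zero> \<in> I" by simp
  show "I \<subseteq> carrier R" by (rule a_subset)
qed

lemma (in cring)
  assumes "primeideal P R"
  shows prime_ideal: "ideal P R"
    and prime_one: "\<one> \<notin> P"
    and prime_mult: "a \<in> carrier R \<Longrightarrow> b \<in> carrier R \<Longrightarrow> a \<otimes> b \<in> P \<Longrightarrow> a \<in> P \<or> b \<in> P"
proof -
  interpret primeideal P R by fact
  show "ideal P R" by (rule is_ideal)
  show "\<one> \<notin> P" using one_imp_carrier I_notcarr by auto
  show "a \<in> carrier R \<Longrightarrow> b \<in> carrier R \<Longrightarrow> a \<otimes> b \<in> P \<Longrightarrow> a \<in> P \<or> b \<in> P" by (rule I_prime)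
qed

lemma (in cring) prime_intro:
  assumes "ideal P R" "\<one> \<notin> P"
    "\<And>a b. a \<in> carrier R \<Longrightarrow> b \<in> carrier R \<Longrightarrow> a \<otimes> b \<in> P \<Longrightarrow> a \<in> P \<or> b \<in> P"
  shows "primeideal P R"
  by (rule primeidealI) (use assms is_cring in auto)

text \<open>The contraction to \<open>R\<close> of the ideal that \<open>I\<close> generates in the
  local ring at \<open>P\<close>. Ideals of that local ring are represented throughout by the
  saturated ideals of \<open>R\<close>, so the localization itself is never constructed.\<close>

definition (in ring) saturation :: "'a set \<Rightarrow> 'a set \<Rightarrow> 'a set"
  where "saturation P I = {b \<in> carrier R. \<exists>s\<in>carrier R - P. s \<otimes> b \<in> I}"

definition (in ring) saturated :: "'a set \<Rightarrow> 'a set \<Rightarrow> bool"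
  where "saturated P I \<longleftrightarrow> ideal I R \<and> (\<forall>s\<in>carrier R - P. \<forall>b\<in>carrier R. s \<otimes> b \<in> I \<longrightarrow> b \<in> I)"

definition (in ring) adjoin :: "'a set \<Rightarrow> 'a \<Rightarrow> 'a set"
  where "adjoin I x = {i \<oplus> r \<otimes> x | i r. i \<in> I \<and> r \<in> carrier R}"

context cring
begin

lemma adj_ideal:
  assumes I: "ideal I R" and x: "x \<in> carrier R" shows "ideal (adjoin I x) R"
proof (rule ideal_intro)
  note sub = subsetD[OF ideal_sub[OF I]]
  show "adjoin I x \<subseteq> carrier R" unfolding adjoin_def using sub x by auto
  have "\<zero> = \<zero> \<oplus> \<zero> \<otimes> x" using x by simp
  then show "\<zero> \<in> adjoin I x" unfolding adjoin_def using ideal_zero[OF I] by blast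
  show "a \<oplus> b \<in> adjoin I x" if ab: "a \<in> adjoin I x" "b \<in> adjoin I x" for a b
  proof -
    obtain i r j s where *: "a = i \<oplus> r \<otimes> x" "b = j \<oplus> s \<otimes> x" "i \<in> I" "j \<in> I" "r \<in> carrier R" "s \<in> carrier R"
      using ab unfolding adjoin_def by blast
    have c: "i \<in> carrier R" "j \<in> carrier R" using sub * by auto
    have "a \<oplus> b = (i \<oplus> j) \<oplus> (r \<oplus> s) \<otimes> x" unfolding * using c *(5,6) x by algebra
    then show ?thesis unfolding adjoin_def using ideal_add[OF I *(3,4)] *(5,6) by blast
  qed
  show "t \<otimes> a \<in> adjoin I x" if a: "a \<in> adjoin I x" and t: "t \<in> carrier R" for a t
  proof -
    obtain i r where *: "a = i \<oplus> r \<otimes> x" "i \<in> I" "r \<in> carrier R"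
      using a unfolding adjoin_def by blast
    have c: "i \<in> carrier R" using sub * by auto
    have "t \<otimes> a = t \<otimes> i \<oplus> (t \<otimes> r) \<otimes> x" unfolding * using c *(3) x t by algebra
    then show ?thesis unfolding adjoin_def using ideal_mult[OF I *(2) t] *(3) t by blast
  qed
qed

lemma adj_supset: assumes "ideal I R" "x \<in> carrier R" shows "I \<subseteq> adjoin I x"
proof
  fix i assume i: "i \<in> I"
  then have "i = i \<oplus> \<zero> \<otimes> x" using assms(2) ideal_sub[OF assms(1)] by auto
  then show "i \<in> adjoin I x" unfolding adjoin_def using i by blast
qed

lemma adj_mem: assumes "ideal I R" "x \<in> carrier R" shows "x \<in> adjoin I x"
proof -
  have "x = \<zero> \<oplus> \<one> \<otimes> x" using assms(2) by auto
  then show "x \<in> adjoin I x" unfolding adjoin_def using ideal_zero[OF assms(1)] by blast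
qed

lemma adj_minimal: assumes "ideal J R" "I \<subseteq> J" "x \<in> J" shows "adjoin I x \<subseteq> J"
  unfolding adjoin_def using assms ideal_add[OF assms(1)] ideal_mult[OF assms(1)] by auto

lemma adjE:
  assumes "a \<in> adjoin I x" obtains i r where "i \<in> I" "r \<in> carrier R" "a = i \<oplus> r \<otimes> x"
  using assms unfolding adjoin_def by blast

lemma prime_compl_mult:
  assumes "primeideal P R" "s \<in> carrier R - P" "t \<in> carrier R - P" shows "s \<otimes> t \<in> carrier R - P"
  using prime_mult[OF assms(1)] assms(2,3) by auto

lemma sat_ideal:
  assumes P: "primeideal P R" and I: "ideal I R" shows "ideal (saturation P I) R"
proof (rule ideal_intro)
  show "saturation P I \<subseteq> carrier R" unfolding saturation_def by auto
  show "\<zero> \<in> saturation P I" unfolding saturation_def using prime_one[OF P] ideal_zero[OF I]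
    by (auto intro!: bexI[of _ \<one>])
  show "a \<oplus> b \<in> saturation P I" if ab: "a \<in> saturation P I" "b \<in> saturation P I" for a b
  proof -
    obtain s t where *: "a \<in> carrier R" "b \<in> carrier R" "s \<in> carrier R - P" "t \<in> carrier R - P" "s \<otimes> a \<in> I" "t \<otimes> b \<in> I"
      using ab unfolding saturation_def by blast
    then have st: "s \<in> carrier R" "t \<in> carrier R" by auto
    have "(s \<otimes> t) \<otimes> (a \<oplus> b) = t \<otimes> (s \<otimes> a) \<oplus> s \<otimes> (t \<otimes> b)" using *(1,2) st by algebra
    moreover have "\<dots> \<in> I" using ideal_add[OF I] ideal_mult[OF I] * st by auto
    ultimately have "(s \<otimes> t) \<otimes> (a \<oplus> b) \<in> I" by (simp only:)
    then show ?thesis unfolding saturation_def using prime_compl_mult[OF P *(3,4)] *(1,2)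
      by (intro CollectI conjI bexI[of _ "s \<otimes> t"] a_closed)
  qed
  show "r \<otimes> a \<in> saturation P I" if a: "a \<in> saturation P I" and r: "r \<in> carrier R" for a r
  proof -
    obtain s where *: "a \<in> carrier R" "s \<in> carrier R - P" "s \<otimes> a \<in> I"
      using a unfolding saturation_def by blast
    then have s: "s \<in> carrier R" by auto
    have "s \<otimes> (r \<otimes> a) = r \<otimes> (s \<otimes> a)" using *(1) s r by algebra
    then have "s \<otimes> (r \<otimes> a) \<in> I" using ideal_mult[OF I *(3) r] by (simp only:)
    then show ?thesis unfolding saturation_def using * r by (intro CollectI conjI bexI[of _ s] m_closed)
  qed
qed

lemma sat_supset: assumes P: "primeideal P R" and I: "ideal I R" shows "I \<subseteq> saturation P I"
  unfolding saturation_def using ideal_sub[OF I] prime_one[OF P] by (auto intro!: bexI[of _ \<one>])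

lemma sat_saturated: assumes P: "primeideal P R" and I: "ideal I R" shows "saturated P (saturation P I)"
  unfolding saturated_def
proof (intro conjI ballI impI sat_ideal[OF P I])
  fix s b assume s: "s \<in> carrier R - P" and b: "b \<in> carrier R" and sb: "s \<otimes> b \<in> saturation P I"
  then obtain t where t: "t \<in> carrier R - P" "t \<otimes> (s \<otimes> b) \<in> I" unfolding saturation_def by blast
  have "t \<otimes> (s \<otimes> b) = (t \<otimes> s) \<otimes> b" using s t b m_assoc by auto
  with t(2) have "(t \<otimes> s) \<otimes> b \<in> I" by (simp only:)
  then show "b \<in> saturation P I" unfolding saturation_def using b prime_compl_mult[OF P t(1) s]
    by (intro CollectI conjI bexI[of _ "t \<otimes> s"])
qed

lemma saturated_ideal: "saturated P I \<Longrightarrow> ideal I R" unfolding saturated_def by auto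

lemma saturatedD:
  "saturated P I \<Longrightarrow> s \<in> carrier R \<Longrightarrow> s \<notin> P \<Longrightarrow> b \<in> carrier R \<Longrightarrow> s \<otimes> b \<in> I \<Longrightarrow> b \<in> I"
  unfolding saturated_def by auto

lemma sat_minimal: "saturated P J \<Longrightarrow> I \<subseteq> J \<Longrightarrow> saturation P I \<subseteq> J"
  unfolding saturation_def using saturatedD by auto

lemma satE:
  assumes "a \<in> saturation P I" obtains s where "s \<in> carrier R" "s \<notin> P" "s \<otimes> a \<in> I"
  using assms unfolding saturation_def by blast

end

locale noetherian_cring = noetherian_ring + cring

lemma (in noetherian_ring) noetherian_maximal:
  assumes "A \<in> S" and S: "\<And>I. I \<in> S \<Longrightarrow> ideal I R"
  obtains M where "M \<in> S" "\<And>I. I \<in> S \<Longrightarrow> M \<subseteq> I \<Longrightarrow> I = M"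
proof -
  have "\<exists>M\<in>S. \<forall>I\<in>S. M \<subseteq> I \<longrightarrow> I = M"
  proof (rule subset_Zorn_nonempty)
    show "S \<noteq> {}" using assms(1) by auto
    fix C assume C: "C \<noteq> {}" "subset.chain S C"
    then have "subset.chain {I. ideal I R} C" using S unfolding pred_on.chain_def by auto
    then have "\<Union>C \<in> C" by (rule ideal_chain_is_trivial[OF C(1)])
    then show "\<Union>C \<in> S" using C(2) unfolding pred_on.chain_def by auto
  qed
  then show thesis using that by blast
qed

section \<open>Finite length and the principal ideal theorem\<close>

context noetherian_cring
begin

text \<open>Among the annihilators modulo \<open>L\<close> of elements \<open>h\<close> outside
  \<open>L\<close> a maximal one is prime. It contains \<open>J\<close> because \<open>L\<close>
  does, and it lies in \<open>P\<close> because \<open>L\<close> is saturated; hence it is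
  \<open>P\<close>. So \<open>h\<close> spans a copy of the residue field at \<open>P\<close> modulo
  \<open>L\<close>.\<close>

lemma associated_prime:
  assumes P: "primeideal P R" and L: "saturated P L" and Ln: "L \<noteq> carrier R" and JL: "J \<subseteq> L"
    and only: "\<And>p. primeideal p R \<Longrightarrow> J \<subseteq> p \<Longrightarrow> p \<subseteq> P \<Longrightarrow> p = P"
  shows "\<exists>h\<in>carrier R - L. \<forall>a\<in>P. a \<otimes> h \<in> L"
proof -
  have Li: "ideal L R" using L saturated_ideal by auto
  define ann where "ann h = {a \<in> carrier R. a \<otimes> h \<in> L}" for h
  have ann_ideal: "ideal (ann h) R" if h: "h \<in> carrier R" for h
  proof (rule ideal_intro)
    show "\<zero> \<in> ann h" unfolding ann_def using h ideal_zero[OF Li] by simp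
    show "a \<oplus> b \<in> ann h" if "a \<in> ann h" "b \<in> ann h" for a b
      using that h ideal_add[OF Li] unfolding ann_def by (auto simp: l_distr)
    show "r \<otimes> a \<in> ann h" if "a \<in> ann h" "r \<in> carrier R" for a r
      using that h ideal_mult[OF Li] unfolding ann_def by (auto simp: m_assoc)
  qed (auto simp: ann_def)
  let ?S = "ann ` (carrier R - L)"
  obtain h0 where "h0 \<in> carrier R - L" using Ln ideal_sub[OF Li] by auto
  then have "ann h0 \<in> ?S" by (rule imageI)
  then obtain M where "M \<in> ?S" and Mm: "\<And>I. I \<in> ?S \<Longrightarrow> M \<subseteq> I \<Longrightarrow> I = M"
    by (rule noetherian_maximal) (use ann_ideal in auto)
  then obtain h where h: "h \<in> carrier R" "h \<notin> L" and M: "M = ann h" by auto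
  have "primeideal M R"
  proof (rule prime_intro)
    show "ideal M R" using ann_ideal h M by auto
    show "\<one> \<notin> M" unfolding M ann_def using h by simp
    fix a b assume a: "a \<in> carrier R" and b: "b \<in> carrier R" and ab: "a \<otimes> b \<in> M"
    show "a \<in> M \<or> b \<in> M"
    proof (rule disjCI)
      assume "b \<notin> M"
      then have bh: "b \<otimes> h \<in> carrier R - L" using b h unfolding M ann_def by auto
      have "M \<subseteq> ann (b \<otimes> h)"
      proof
        fix c assume c: "c \<in> M"
        then have cc: "c \<in> carrier R" "c \<otimes> h \<in> L" unfolding M ann_def by auto
        have "c \<otimes> (b \<otimes> h) = b \<otimes> (c \<otimes> h)" using cc(1) b h(1) by algebra
        then show "c \<in> ann (b \<otimes> h)" unfolding ann_def using cc ideal_mult[OF Li cc(2) b] by auto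
      qed
      then have "ann (b \<otimes> h) = M" using Mm bh by auto
      moreover have "a \<in> ann (b \<otimes> h)" using ab a b h unfolding M ann_def by (auto simp: m_assoc)
      ultimately show "a \<in> M" by auto
    qed
  qed
  moreover have "J \<subseteq> M"
  proof
    fix c assume "c \<in> J"
    then have "c \<in> L" "c \<in> carrier R" using JL ideal_sub[OF Li] by auto
    then show "c \<in> M" unfolding M ann_def using ideal_mult[OF Li \<open>c \<in> L\<close> h(1)] m_comm h(1) by auto
  qed
  moreover have "M \<subseteq> P"
  proof
    fix c assume "c \<in> M"
    then have "c \<in> carrier R" "c \<otimes> h \<in> L" unfolding M ann_def by auto
    then show "c \<in> P" using saturatedD[OF L, of c h] h by auto
  qed
  ultimately have "M = P" by (rule only)
  then show ?thesis using h unfolding M ann_def by auto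
qed

text \<open>The local ring at \<open>P\<close> modulo \<open>J\<close> has finite length, hence satisfies the descending
  chain condition.\<close>

lemma saturated_dcc:
  fixes E :: "nat \<Rightarrow> 'a set"
  assumes P: "primeideal P R" and J: "ideal J R"
    and only: "\<And>p. primeideal p R \<Longrightarrow> J \<subseteq> p \<Longrightarrow> p \<subseteq> P \<Longrightarrow> p = P"
    and E: "\<And>n. saturated P (E n)" "\<And>n. J \<subseteq> E n" "\<And>n. E (Suc n) \<subseteq> E n"
  shows "\<exists>n0. \<forall>n\<ge>n0. E n = E n0"
proof -
  have dec: "E n \<subseteq> E m" if "m \<le> n" for m n
    using that by (induction rule: dec_induct) (use E(3) in auto)
  \<comment> \<open>Noetherian induction takes the place of a composition series: \<open>D L\<close>
    says that the chain becomes stationary inside \<open>L\<close>, and a maximal such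
    \<open>L\<close> is enlarged by one copy of the residue field.\<close>
  define D where "D L \<longleftrightarrow> (\<exists>n0. \<forall>n\<ge>n0. E n \<inter> L = E n0 \<inter> L)" for L
  define S where "S = {L. saturated P L \<and> J \<subseteq> L \<and> D L}"
  have "saturation P J \<in> S"
  proof -
    have "saturation P J \<subseteq> E n" for n using sat_minimal[OF E(1,2)] .
    then have "D (saturation P J)" unfolding D_def by (intro exI[of _ 0]) auto
    then show ?thesis unfolding S_def using sat_saturated[OF P J] sat_supset[OF P J] by auto
  qed
  then obtain L where LS: "L \<in> S" and Lm: "\<And>I. I \<in> S \<Longrightarrow> L \<subseteq> I \<Longrightarrow> I = L"
    by (rule noetherian_maximal) (auto simp: S_def intro: saturated_ideal)
  then have L: "saturated P L" "J \<subseteq> L" "D L" unfolding S_def by auto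
  have Li: "ideal L R" using saturated_ideal L by auto
  note Lc = subsetD[OF ideal_sub[OF Li]]
  have "L = carrier R"
  proof (rule ccontr)
    assume "L \<noteq> carrier R"
    then obtain h where h: "h \<in> carrier R" "h \<notin> L" "\<And>a. a \<in> P \<Longrightarrow> a \<otimes> h \<in> L"
      using associated_prime[OF P L(1) _ L(2) only] by auto
    define L' where "L' = saturation P (adjoin L h)"
    have adjL: "ideal (adjoin L h) R" using adj_ideal[OF Li h(1)] .
    have L': "saturated P L'" unfolding L'_def by (rule sat_saturated[OF P adjL])
    have sup: "adjoin L h \<subseteq> L'" unfolding L'_def by (rule sat_supset[OF P adjL])
    have LL': "L \<subseteq> L'" using adj_supset[OF Li h(1)] sup by auto
    have L'E: "\<exists>s l r. s \<in> carrier R \<and> s \<notin> P \<and> l \<in> L \<and> r \<in> carrier R \<and> s \<otimes> b = l \<oplus> r \<otimes> h" if "b \<in> L'" for b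
      using that unfolding L'_def by (elim satE adjE) blast
    obtain n0 where n0: "\<And>n. n \<ge> n0 \<Longrightarrow> E n \<inter> L = E n0 \<inter> L" using L(3) unfolding D_def by auto
    have "D L'"
    \<comment> \<open>\<open>L'\<close> is one-dimensional over \<open>L\<close>. If no
      \<open>E n1 \<inter> L'\<close> lies in \<open>L\<close>, every \<open>E n\<close> contains
      some \<open>b\<close> of \<open>L'\<close> outside \<open>L\<close>; an element
      \<open>c\<close> of \<open>E n0 \<inter> L'\<close> is then, up to a factor outside
      \<open>P\<close>, a multiple of \<open>b\<close> plus an element of
      \<open>E n0 \<inter> L\<close>, which equals \<open>E n \<inter> L\<close>.\<close>
    proof (cases "\<exists>n1. E n1 \<inter> L' \<subseteq> L")
      case True
      then obtain n1 where n1: "E n1 \<inter> L' \<subseteq> L" by auto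
      have "E n \<inter> L' = E n \<inter> L" if "n \<ge> n1" for n using dec[OF that] n1 LL' by blast
      then have "E n \<inter> L' = E (max n0 n1) \<inter> L'" if "n \<ge> max n0 n1" for n
        using that n0[of n] n0[of "max n0 n1"] by auto
      then show ?thesis unfolding D_def by blast
    next
      case False
      have "E n0 \<inter> L' \<subseteq> E n" if n: "n \<ge> n0" for n
      proof
        fix c assume c: "c \<in> E n0 \<inter> L'"
        obtain b where b: "b \<in> E n" "b \<in> L'" "b \<notin> L" using False by auto
        have cc: "c \<in> carrier R" "b \<in> carrier R" using c b ideal_sub[OF saturated_ideal[OF L']] by auto
        obtain s l r where 1: "s \<in> carrier R" "s \<notin> P" "l \<in> L" "r \<in> carrier R" "s \<otimes> b = l \<oplus> r \<otimes> h"
          using L'E[OF b(2)] by blast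
        obtain s' l' r' where 2: "s' \<in> carrier R" "s' \<notin> P" "l' \<in> L" "r' \<in> carrier R" "s' \<otimes> c = l' \<oplus> r' \<otimes> h"
          using L'E[of c] c by blast
        have "r \<notin> P"
        proof
          assume "r \<in> P"
          then have "s \<otimes> b \<in> L" unfolding 1(5) using ideal_add[OF Li 1(3)] h(3) by auto
          then show False using saturatedD[OF L(1) 1(1,2) cc(2)] b(3) by auto
        qed
        have En: "ideal (E n) R" "ideal (E n0) R" using saturated_ideal E(1) by auto
        have id: "r \<otimes> (s' \<otimes> c) \<ominus> r' \<otimes> (s \<otimes> b) = r \<otimes> l' \<ominus> r' \<otimes> l"
          unfolding 1(5) 2(5) using Lc[OF 1(3)] Lc[OF 2(3)] 1(4) 2(4) h(1) by algebra
        have "r \<otimes> l' \<ominus> r' \<otimes> l \<in> L"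
          using ideal_minus[OF Li] ideal_mult[OF Li] 1 2 by auto
        moreover have "r \<otimes> (s' \<otimes> c) \<ominus> r' \<otimes> (s \<otimes> b) \<in> E n0"
          using ideal_minus[OF En(2)] ideal_mult[OF En(2)] 1 2 c b dec[OF n] by (meson Int_iff subsetD)
        ultimately have "r \<otimes> (s' \<otimes> c) \<ominus> r' \<otimes> (s \<otimes> b) \<in> E n" using n0[OF n] unfolding id by auto
        moreover have "r' \<otimes> (s \<otimes> b) \<in> E n"
          by (rule ideal_mult[OF En(1) ideal_mult[OF En(1) b(1) 1(1)] 2(4)])
        ultimately have "(r \<otimes> (s' \<otimes> c) \<ominus> r' \<otimes> (s \<otimes> b)) \<oplus> r' \<otimes> (s \<otimes> b) \<in> E n" by (rule ideal_add[OF En(1)])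
        moreover have "(r \<otimes> (s' \<otimes> c) \<ominus> r' \<otimes> (s \<otimes> b)) \<oplus> r' \<otimes> (s \<otimes> b) = (r \<otimes> s') \<otimes> c"
          using 1(1,4) 2(1,4) cc by algebra
        ultimately have "(r \<otimes> s') \<otimes> c \<in> E n" by simp
        moreover have "r \<otimes> s' \<in> carrier R - P" using prime_compl_mult[OF P] 1 2 \<open>r \<notin> P\<close> by auto
        ultimately show "c \<in> E n" using saturatedD[OF E(1)] cc by blast
      qed
      then have "E n \<inter> L' = E n0 \<inter> L'" if "n \<ge> n0" for n using dec[OF that] that by blast
      then show ?thesis unfolding D_def by blast
    qed
    then have "L' \<in> S" unfolding S_def using L' LL' L(2) by auto
    then have "L' = L" using Lm LL' by auto
    then show False using adj_mem[OF Li h(1)] sup h(2) by auto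
  qed
  then have "E n \<inter> L = E n" for n using ideal_sub[OF saturated_ideal[OF E(1)]] by blast
  then show ?thesis using L(3) unfolding D_def by auto
qed

text \<open>Nakayama's lemma for the local ring at \<open>P\<close>, where \<open>H\<close> says
  that \<open>M = N + x M\<close>. Over a maximal saturated ideal \<open>N'\<close> properly below
  \<open>M\<close> and above \<open>N\<close>, the ideal \<open>M\<close> is spanned by a single
  \<open>b\<close>, and \<open>H\<close> turns into \<open>(s' s - x q) b \<in> N'\<close> with a
  factor outside \<open>P\<close>.\<close>

lemma saturated_nakayama:
  assumes P: "primeideal P R" and M: "saturated P M" and N: "saturated P N" and NM: "N \<subseteq> M"
    and x: "x \<in> P"
    and H: "\<And>b. b \<in> M \<Longrightarrow> \<exists>s r. s \<in> carrier R \<and> s \<notin> P \<and> r \<in> M \<and> s \<otimes> b \<ominus> x \<otimes> r \<in> N"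
  shows "M = N"
proof (rule ccontr)
  assume "M \<noteq> N"
  note Mi = saturated_ideal[OF M] note Mc = subsetD[OF ideal_sub[OF Mi]]
  have xc: "x \<in> carrier R" using x ideal_sub[OF prime_ideal[OF P]] by auto
  define S where "S = {N'. saturated P N' \<and> N \<subseteq> N' \<and> N' \<subseteq> M \<and> N' \<noteq> M}"
  have "N \<in> S" using \<open>M \<noteq> N\<close> N NM unfolding S_def by auto
  then obtain N' where "N' \<in> S" and m: "\<And>I. I \<in> S \<Longrightarrow> N' \<subseteq> I \<Longrightarrow> I = N'"
    by (rule noetherian_maximal) (auto simp: S_def intro: saturated_ideal)
  then have N': "saturated P N'" "N \<subseteq> N'" "N' \<subseteq> M" "N' \<noteq> M" unfolding S_def by auto
  note Ni = saturated_ideal[OF N'(1)]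
  obtain b where b: "b \<in> M" "b \<notin> N'" using N' by auto
  have bc: "b \<in> carrier R" using Mc b by auto
  define N2 where "N2 = saturation P (adjoin N' b)"
  have aN: "ideal (adjoin N' b) R" by (rule adj_ideal[OF Ni bc])
  have "N2 \<subseteq> M" unfolding N2_def by (rule sat_minimal[OF M]) (rule adj_minimal[OF Mi N'(3) b(1)])
  moreover have sup: "adjoin N' b \<subseteq> N2" unfolding N2_def by (rule sat_supset[OF P aN])
  moreover have "N2 \<noteq> N'" using sup adj_mem[OF Ni bc] b by auto
  moreover have "N' \<subseteq> N2" using sup adj_supset[OF Ni bc] by auto
  ultimately have "N2 = M" using m[of N2] N'(2) sat_saturated[OF P aN] unfolding S_def N2_def by blast
  obtain s r where sr: "s \<in> carrier R" "s \<notin> P" "r \<in> M" "s \<otimes> b \<ominus> x \<otimes> r \<in> N" using H[OF b(1)] by auto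
  have "r \<in> saturation P (adjoin N' b)" using sr(3) \<open>N2 = M\<close> N2_def by simp
  then obtain s' n q where 2: "s' \<in> carrier R" "s' \<notin> P" "n \<in> N'" "q \<in> carrier R" "s' \<otimes> r = n \<oplus> q \<otimes> b"
    by (elim satE adjE) blast
  have nc: "n \<in> carrier R" "r \<in> carrier R" using Mc N'(3) 2 sr by auto
  have "s' \<otimes> (s \<otimes> b \<ominus> x \<otimes> r) \<oplus> x \<otimes> n \<in> N'"
    using ideal_add[OF Ni] ideal_mult[OF Ni] sr(4) N'(2) 2 xc by auto
  moreover have "s' \<otimes> (s \<otimes> b \<ominus> x \<otimes> r) = s' \<otimes> s \<otimes> b \<ominus> x \<otimes> (s' \<otimes> r)"
    using 2(1) sr(1) bc xc nc by algebra
  moreover have "s' \<otimes> s \<otimes> b \<ominus> x \<otimes> (n \<oplus> q \<otimes> b) \<oplus> x \<otimes> n = (s' \<otimes> s \<ominus> x \<otimes> q) \<otimes> b"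
    using 2(1,4) sr(1) bc xc nc by algebra
  ultimately have mem: "(s' \<otimes> s \<ominus> x \<otimes> q) \<otimes> b \<in> N'" using 2(5) by simp
  have "s' \<otimes> s \<ominus> x \<otimes> q \<notin> P"
  proof
    assume a: "s' \<otimes> s \<ominus> x \<otimes> q \<in> P"
    have "q \<otimes> x \<in> P" using ideal_mult[OF prime_ideal[OF P] x 2(4)] .
    then have "(s' \<otimes> s \<ominus> x \<otimes> q) \<oplus> q \<otimes> x \<in> P" using ideal_add[OF prime_ideal[OF P] a] by auto
    moreover have "(s' \<otimes> s \<ominus> x \<otimes> q) \<oplus> q \<otimes> x = s' \<otimes> s" using 2(1,4) sr(1) xc by algebra
    ultimately show False using prime_mult[OF P] 2 sr by auto
  qed
  then show False using saturatedD[OF N'(1) _ _ bc mem] 2 sr xc b(2) by auto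
qed

text \<open>A form of Krull's principal ideal theorem. The contractions of the ideals \<open>(y\<^sup>n) + p\<close> of the
  local ring at \<open>q\<close> take the place of the symbolic powers of \<open>q\<close> in the usual proof.\<close>

lemma prime_exchange:
  assumes p: "primeideal p R" and q: "primeideal q R" and P: "primeideal P R"
    and pq: "p \<subset> q" and qP: "q \<subset> P" and x: "x \<in> P"
  shows "\<exists>q'. primeideal q' R \<and> p \<subset> q' \<and> q' \<subset> P \<and> x \<in> q'"
proof (rule ccontr)
  assume no: "\<not> ?thesis"
  have xq: "x \<notin> q" using no pq qP q by auto
  have xp: "x \<notin> p" using xq pq by auto
  note pi = prime_ideal[OF p] note qi = prime_ideal[OF q] note Pi = prime_ideal[OF P]
  have xc: "x \<in> carrier R" using x ideal_sub[OF Pi] by auto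
  define J where "J = adjoin p x"
  have J: "ideal J R" unfolding J_def by (rule adj_ideal[OF pi xc])
  \<comment> \<open>If there is no \<open>q'\<close>, then \<open>P\<close> is the only prime
    between \<open>p + (x)\<close> and \<open>P\<close>, so the descending chain condition applies
    above \<open>J\<close>.\<close>
  have only: "p' = P" if "primeideal p' R" "J \<subseteq> p'" "p' \<subseteq> P" for p'
  proof -
    have "p \<subseteq> p'" "x \<in> p'" using that adj_supset[OF pi xc] adj_mem[OF pi xc] unfolding J_def by auto
    then show ?thesis using no that xp by blast
  qed
  obtain y where y: "y \<in> q" "y \<notin> p" using pq by auto
  have yc: "y \<in> carrier R" using y ideal_sub[OF qi] by auto
  define I where "I n = saturation q (adjoin p (y [^] (n::nat)))" for n
  have aI: "ideal (adjoin p (y [^] n)) R" for n :: nat by (rule adj_ideal[OF pi]) (use yc in simp)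
  have Iq: "saturated q (I n)" for n unfolding I_def by (rule sat_saturated[OF q aI])
  have IP: "saturated P (I n)" for n using Iq[of n] qP unfolding saturated_def by blast
  have Ii: "ideal (I n) R" for n using Iq saturated_ideal by auto
  have pI: "p \<subseteq> I n" and yI: "y [^] n \<in> I n" for n
    using sat_supset[OF q aI] adj_supset[OF pi] adj_mem[OF pi] yc unfolding I_def by blast+
  have Idec: "I (Suc n) \<subseteq> I n" for n
  proof -
    have "y [^] Suc n \<in> I n" using ideal_mult[OF Ii yI yc] yc nat_pow_Suc2 by auto
    then show ?thesis unfolding I_def[of "Suc n"]
      by (intro sat_minimal[OF Iq] adj_minimal[OF Ii pI])
  qed
  define E where "E n = saturation P (adjoin (I n) x)" for n
  have aE: "ideal (adjoin (I n) x) R" for n by (rule adj_ideal[OF Ii xc])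
  have ES: "saturated P (E n)" for n unfolding E_def by (rule sat_saturated[OF P aE])
  have adjE': "adjoin (I n) x \<subseteq> E n" for n unfolding E_def by (rule sat_supset[OF P aE])
  have "\<exists>n0. \<forall>n\<ge>n0. E n = E n0"
  proof (rule saturated_dcc[OF P J only ES])
    show "J \<subseteq> E n" for n unfolding J_def
      by (rule adj_minimal[OF saturated_ideal[OF ES]])
        (use pI adj_supset[OF Ii xc] adj_mem[OF Ii xc] adjE' in blast)+
    show "E (Suc n) \<subseteq> E n" for n unfolding E_def[of "Suc n"]
      by (intro sat_minimal[OF ES] adj_minimal[OF saturated_ideal[OF ES]])
        (use Idec adj_supset[OF Ii xc] adj_mem[OF Ii xc] adjE' in blast)+
  qed
  then obtain n where "E n = E (Suc n)" by (metis le_Suc_eq order_refl)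
  \<comment> \<open>Modulo a factor outside \<open>P\<close>, an element of \<open>I n\<close> is
    \<open>c + r x\<close> with \<open>c\<close> in \<open>I (Suc n)\<close>. Then
    \<open>r x\<close> is in \<open>I n\<close>, and so is \<open>r\<close>, because
    \<open>I n\<close> is saturated at \<open>q\<close> and \<open>x\<close> is not in
    \<open>q\<close>. This is the hypothesis of Nakayama's lemma.\<close>
  have "I n = I (Suc n)"
  proof (rule saturated_nakayama[OF P IP IP Idec x])
    fix b assume b: "b \<in> I n"
    have bc: "b \<in> carrier R" using b ideal_sub[OF Ii] by auto
    have "b \<in> E n" using b adj_supset[OF Ii xc] adjE' by blast
    then have "b \<in> saturation P (adjoin (I (Suc n)) x)" using \<open>E n = E (Suc n)\<close> E_def by simp
    then obtain s c r where 1: "s \<in> carrier R" "s \<notin> P" "c \<in> I (Suc n)" "r \<in> carrier R" "s \<otimes> b = c \<oplus> r \<otimes> x"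
      by (elim satE adjE) blast
    have cc: "c \<in> carrier R" using 1 ideal_sub[OF Ii] by auto
    have "s \<otimes> b \<ominus> c \<in> I n" 
      by (rule ideal_minus[OF Ii ideal_mult[OF Ii b 1(1)]]) (use 1(3) Idec in blast)
    moreover have "s \<otimes> b \<ominus> c = x \<otimes> r" unfolding 1(5) using cc 1(4) xc by algebra
    ultimately have "x \<otimes> r \<in> I n" by simp
    then have r: "r \<in> I n" using saturatedD[OF Iq xc xq 1(4)] by auto
    have "c \<oplus> r \<otimes> x \<ominus> x \<otimes> r = c" using cc 1(4) xc by algebra
    then have "s \<otimes> b \<ominus> x \<otimes> r \<in> I (Suc n)" using 1(3,5) by simp
    then show "\<exists>s r. s \<in> carrier R \<and> s \<notin> P \<and> r \<in> I n \<and> s \<otimes> b \<ominus> x \<otimes> r \<in> I (Suc n)"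
      using 1 r by blast
  qed
  \<comment> \<open>The contradiction: \<open>y^n (s - r y)\<close> lies in \<open>p\<close>, which
    contains no power of \<open>y\<close>; so \<open>s - r y\<close> is in \<open>p\<close>, and
    \<open>s\<close> in \<open>q\<close>.\<close>
  then have "y [^] n \<in> saturation q (adjoin p (y [^] Suc n))" using yI[of n] I_def by simp
  then obtain s a r where 1: "s \<in> carrier R" "s \<notin> q" "a \<in> p" "r \<in> carrier R" "s \<otimes> y [^] n = a \<oplus> r \<otimes> y [^] Suc n"
    by (elim satE adjE) blast
  have ac: "a \<in> carrier R" "y [^] n \<in> carrier R" using 1 ideal_sub[OF pi] yc by auto
  have "y [^] n \<otimes> (s \<ominus> r \<otimes> y) = s \<otimes> y [^] n \<ominus> r \<otimes> (y [^] n \<otimes> y)" using 1(1,4) ac(2) yc by algebra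
  also have "\<dots> = a" using 1 ac yc by (simp, algebra)
  finally have e: "y [^] n \<otimes> (s \<ominus> r \<otimes> y) \<in> p" using 1 by auto
  have "y [^] m \<notin> p" for m :: nat
  proof (induction m)
    case (Suc m)
    then show ?case using prime_mult[OF p, of "y [^] m" y] yc y(2) by auto
  qed (use prime_one[OF p] in simp)
  then have "s \<ominus> r \<otimes> y \<in> q" using prime_mult[OF p _ _ e] 1 yc pq by auto
  then have "(s \<ominus> r \<otimes> y) \<oplus> r \<otimes> y \<in> q" using ideal_add[OF qi] ideal_mult[OF qi y(1) 1(4)] by auto
  moreover have "(s \<ominus> r \<otimes> y) \<oplus> r \<otimes> y = s" using 1 yc by algebra
  ultimately show False using 1 by auto
qed

text \<open>The element is pushed down from the top: \<open>prime_exchange\<close> replaces the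
  prime below the top by one that contains \<open>x\<close>, which then is the top of a shorter
  chain with the same bottom.\<close>

lemma prime_chain_exchange:
  assumes "prime_chain R (Suc n) p" "x \<in> p (Suc n)"
  shows "\<exists>p'. prime_chain R (Suc n) p' \<and> p' 0 = p 0 \<and> p' (Suc n) = p (Suc n) \<and> x \<in> p' 1"
  using assms
proof (induction n arbitrary: p)
  case 0
  then show ?case by auto
next
  case (Suc n)
  note c = Suc.prems(1)[unfolded prime_chain_def]
  have "p n \<subset> p (Suc n)" "p (Suc n) \<subset> p (Suc (Suc n))"
    "primeideal (p n) R" "primeideal (p (Suc n)) R" "primeideal (p (Suc (Suc n))) R" using c by auto
  from prime_exchange[OF this(3-5,1,2) Suc.prems(2)] obtain q where
    q: "primeideal q R" "p n \<subset> q" "q \<subset> p (Suc (Suc n))" "x \<in> q" by auto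
  have "prime_chain R (Suc n) (p(Suc n := q))" unfolding prime_chain_def
    using c q by (auto simp: less_Suc_eq le_Suc_eq)
  from Suc.IH[OF this] q(4) obtain p' where p': "prime_chain R (Suc n) p'" "p' 0 = p 0"
    "p' (Suc n) = q" "x \<in> p' 1" by auto
  define p2 where "p2 = p'(Suc (Suc n) := p (Suc (Suc n)))"
  have "prime_chain R (Suc (Suc n)) p2"
    using p'(1,3) q(3) c unfolding prime_chain_def p2_def by (auto simp: less_Suc_eq le_Suc_eq)
  moreover have "p2 0 = p 0" "p2 (Suc (Suc n)) = p (Suc (Suc n))" "x \<in> p2 1"
    using p'(2,4) by (auto simp: p2_def)
  ultimately show ?case by blast
qed

end

section \<open>Parameters and chains of primes in a noetherian local ring\<close>

locale noetherian_local = noetherian_cring +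
  fixes M
  assumes M_prime: "primeideal M R"
    and units: "s \<in> carrier R \<Longrightarrow> s \<notin> M \<Longrightarrow> s \<in> Units R"
begin

lemma ideal_saturated: assumes I: "ideal I R" shows "saturated M I"
  unfolding saturated_def
proof (intro conjI ballI impI I)
  fix s b assume s: "s \<in> carrier R - M" and b: "b \<in> carrier R" and sb: "s \<otimes> b \<in> I"
  then have u: "s \<in> Units R" using units by auto
  have "b = inv s \<otimes> (s \<otimes> b)" using u s b by (simp add: m_assoc[symmetric])
  also have "\<dots> \<in> I" using ideal_mult[OF I sb] u by auto
  finally show "b \<in> I" .
qed

lemma prime_le_M: assumes p: "primeideal p R" shows "p \<subseteq> M"
proof
  fix s assume s: "s \<in> p"
  show "s \<in> M"
  proof (rule ccontr)
    assume "s \<notin> M"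
    moreover have sc: "s \<in> carrier R" using s ideal_sub[OF prime_ideal[OF p]] by auto
    ultimately have "s \<in> Units R" using units by auto
    then have "\<one> \<in> p" using ideal_mult[OF prime_ideal[OF p] s, of "inv s"] by simp
    then show False using prime_one[OF p] by auto
  qed
qed

lemma prime_chain_top:
  assumes "prime_chain R n p" shows "prime_chain R n (p(n := M))"
  using assms M_prime prime_le_M[of "p n"] unfolding prime_chain_def by (auto simp: less_Suc_eq)

lemma genideal_adj:
  assumes I: "ideal I R" and x: "x \<in> carrier R" and S: "S \<subseteq> carrier R"
  shows "Idl (I \<union> insert x S) = Idl (adjoin I x \<union> S)"
proof
  note ai = adj_ideal[OF I x]
  have sub: "adjoin I x \<union> S \<subseteq> carrier R" "I \<union> insert x S \<subseteq> carrier R"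
    using ideal_sub[OF ai] ideal_sub[OF I] x S by auto
  show "Idl (I \<union> insert x S) \<subseteq> Idl (adjoin I x \<union> S)"
    by (rule genideal_minimal[OF genideal_ideal[OF sub(1)]])
      (use genideal_self[OF sub(1)] adj_supset[OF I x] adj_mem[OF I x] in blast)
  have "adjoin I x \<subseteq> Idl (I \<union> insert x S)"
    by (rule adj_minimal[OF genideal_ideal[OF sub(2)]]) (use genideal_self[OF sub(2)] in auto)
  then show "Idl (adjoin I x \<union> S) \<subseteq> Idl (I \<union> insert x S)"
    by (intro genideal_minimal[OF genideal_ideal[OF sub(2)]]) (use genideal_self[OF sub(2)] in auto)
qed

lemma genideal_with_zero:
  assumes S: "S \<subseteq> carrier R" shows "Idl ({\<zero>} \<union> S) = Idl S"
proof
  have S0: "{\<zero>} \<union> S \<subseteq> carrier R" using S by auto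
  show "Idl ({\<zero>} \<union> S) \<subseteq> Idl S"
    by (rule genideal_minimal[OF genideal_ideal[OF S]])
      (use genideal_self[OF S] ideal_zero[OF genideal_ideal[OF S]] in blast)
  show "Idl S \<subseteq> Idl ({\<zero>} \<union> S)"
    by (rule genideal_minimal[OF genideal_ideal[OF S0]]) (use genideal_self[OF S0] in blast)
qed

lemma genideal_of_ideal: assumes "ideal I R" shows "Idl I = I"
  using genideal_minimal[OF assms, of I] genideal_self[OF ideal_sub[OF assms]] by auto

text \<open>The inductive step of the three lemmas below: one generator is moved into the base ideal
  at the price of one prime of the chain.\<close>

lemma chain_through_generator:
  assumes I: "ideal I R" and x: "x \<in> M" and p: "prime_chain R (Suc n) p" "I \<subseteq> p 0"
  shows "\<exists>p'. prime_chain R (Suc n) p' \<and> p' 0 = p 0 \<and> prime_chain R n (\<lambda>i. p' (Suc i)) \<and> adjoin I x \<subseteq> p' 1"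
proof -
  have "x \<in> (p(Suc n := M)) (Suc n)" using x by simp
  from prime_chain_exchange[OF prime_chain_top[OF p(1)] this] obtain p' where
    p': "prime_chain R (Suc n) p'" "p' 0 = p 0" "x \<in> p' 1" by auto
  have "p' 0 \<subset> p' 1" "primeideal (p' 1) R" using p'(1) unfolding prime_chain_def by auto
  then have "adjoin I x \<subseteq> p' 1" using p' p(2) by (intro adj_minimal[OF prime_ideal]) auto
  moreover have "prime_chain R n (\<lambda>i. p' (Suc i))" using p'(1) unfolding prime_chain_def by auto
  ultimately show ?thesis using p' by blast
qed

text \<open>The dimension of \<open>R / I\<close> is at most the number of generators of its maximal
  ideal.\<close>

lemma chain_length_le_generators:
  assumes "ideal I R" "set xs \<subseteq> carrier R" "M = Idl (I \<union> set xs)" "prime_chain R n p" "I \<subseteq> p 0"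
  shows "n \<le> length xs"
  using assms
proof (induction xs arbitrary: I n p)
  case Nil
  then have MI: "M = I" using genideal_of_ideal by auto
  show ?case
  proof (rule ccontr)
    assume "\<not> ?case"
    then have "p 0 \<subset> p 1" "primeideal (p 1) R" using Nil(4) unfolding prime_chain_def by auto
    then show False using prime_le_M[of "p 1"] MI Nil(5) by blast
  qed
next
  case (Cons x xs)
  show ?case
  proof (cases n)
    case (Suc k)
    have xc: "x \<in> carrier R" using Cons.prems by auto
    have "x \<in> M" using Cons.prems genideal_self[of "I \<union> set (x # xs)"] ideal_sub by auto
    from chain_through_generator[OF Cons.prems(1) this Cons.prems(4)[unfolded Suc] Cons.prems(5)]
    obtain p' where p': "prime_chain R k (\<lambda>i. p' (Suc i))" "adjoin I x \<subseteq> p' 1" by auto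
    have "k \<le> length xs"
      by (rule Cons.IH[OF adj_ideal[OF Cons.prems(1) xc] _ _ p'(1)])
        (use Cons.prems genideal_adj[OF Cons.prems(1) xc] p' in auto)
    then show ?thesis using Suc by auto
  qed auto
qed

text \<open>Equality in the previous bound makes \<open>R / I\<close> regular, and a regular local
  ring is a domain. By induction \<open>adjoin I x\<close> is prime. The bound for
  \<open>adjoin I x\<close> shows that \<open>x\<close> is not in \<open>p' 0\<close> and that
  \<open>adjoin I x\<close> is \<open>p' 1\<close>, since otherwise it could replace
  \<open>p' 0\<close> in a chain that is too long. So \<open>p' 0 = I + x p' 0\<close>, and
  Nakayama's lemma gives \<open>p' 0 = I\<close>.\<close>

lemma prime_of_maximal_chain:
  assumes "ideal I R" "set xs \<subseteq> carrier R" "M = Idl (I \<union> set xs)"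
    "prime_chain R (length xs) p" "I \<subseteq> p 0"
  shows "primeideal I R"
  using assms
proof (induction xs arbitrary: I p)
  case Nil
  then have "M = I" using genideal_of_ideal by auto
  then show ?case using M_prime by simp
next
  case (Cons x xs)
  note I = Cons.prems(1)
  have xc: "x \<in> carrier R" using Cons.prems by auto
  note ai = adj_ideal[OF I xc]
  have xM: "x \<in> M" using Cons.prems genideal_self[of "I \<union> set (x # xs)"] ideal_sub by auto
  have Ma: "M = Idl (adjoin I x \<union> set xs)" using Cons.prems(2,3) genideal_adj[OF I xc] by auto
  from chain_through_generator[OF I xM Cons.prems(4)[unfolded list.size add_Suc_right add_0_right] Cons.prems(5)]
  obtain p' where p': "prime_chain R (Suc (length xs)) p'" "p' 0 = p 0"
    "prime_chain R (length xs) (\<lambda>i. p' (Suc i))" "adjoin I x \<subseteq> p' 1" by auto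
  have pr: "primeideal (p' 0) R" "p' 0 \<subset> p' 1" "primeideal (p' 1) R"
    using p'(1) unfolding prime_chain_def by auto
  note p0i = prime_ideal[OF pr(1)]
  have aprime: "primeideal (adjoin I x) R"
    by (rule Cons.IH[OF ai _ Ma p'(3)]) (use Cons.prems p' in auto)
  have xp: "x \<notin> p' 0"
  proof
    assume "x \<in> p' 0"
    then have "adjoin I x \<subseteq> p' 0" using Cons.prems(5) p' by (intro adj_minimal[OF p0i]) auto
    from chain_length_le_generators[OF ai _ Ma p'(1) this] Cons.prems show False by auto
  qed
  have "adjoin I x = p' 1"
  proof (rule ccontr)
    assume "adjoin I x \<noteq> p' 1"
    then have "prime_chain R (Suc (length xs)) (p'(0 := adjoin I x))"
      using p' aprime unfolding prime_chain_def by (auto simp: less_Suc_eq_0_disj)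
    from chain_length_le_generators[OF ai _ Ma this] Cons.prems show False by auto
  qed
  have "p' 0 = I"
  proof (rule saturated_nakayama[OF M_prime ideal_saturated[OF p0i] ideal_saturated[OF I] _ xM])
    show "I \<subseteq> p' 0" using Cons.prems p' by auto
    fix b assume b: "b \<in> p' 0"
    then have "b \<in> adjoin I x" using pr(2) \<open>adjoin I x = p' 1\<close> by auto
    then obtain i r where ir: "i \<in> I" "r \<in> carrier R" "b = i \<oplus> r \<otimes> x" by (rule adjE)
    have ic: "i \<in> carrier R" using ideal_sub[OF I] ir by auto
    have "b \<ominus> i \<in> p' 0" by (rule ideal_minus[OF p0i b]) (use ir Cons.prems p' in auto)
    moreover have "b \<ominus> i = r \<otimes> x" "\<one> \<otimes> b \<ominus> x \<otimes> r = i" unfolding ir(3) using ic ir(2) xc by algebra+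
    ultimately have "r \<in> p' 0" "\<one> \<otimes> b \<ominus> x \<otimes> r \<in> I" using prime_mult[OF pr(1) ir(2) xc] xp ir(1) by auto
    then show "\<exists>s r. s \<in> carrier R \<and> s \<notin> M \<and> r \<in> p' 0 \<and> s \<otimes> b \<ominus> x \<otimes> r \<in> I"
      using prime_one[OF M_prime] by blast
  qed
  then show ?case using pr by simp
qed

lemma chain_above_generators:
  assumes "ideal I R" "set (ys @ zs) \<subseteq> carrier R" "M = Idl (I \<union> set (ys @ zs))"
    "prime_chain R (length (ys @ zs)) p" "I \<subseteq> p 0"
  shows "\<exists>p'. prime_chain R (length zs) p' \<and> Idl (I \<union> set ys) \<subseteq> p' 0 \<and>
    M = Idl (Idl (I \<union> set ys) \<union> set zs)"
  using assms
proof (induction ys arbitrary: I p)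
  case Nil
  then show ?case using genideal_of_ideal by auto
next
  case (Cons x ys)
  note I = Cons.prems(1)
  have xc: "x \<in> carrier R" using Cons.prems by auto
  have xM: "x \<in> M" using Cons.prems genideal_self[of "I \<union> set ((x # ys) @ zs)"] ideal_sub by auto
  from chain_through_generator[OF I xM Cons.prems(4)[unfolded append_Cons list.size add_Suc_right add_0_right] Cons.prems(5)]
  obtain p' where p': "prime_chain R (length (ys @ zs)) (\<lambda>i. p' (Suc i))" "adjoin I x \<subseteq> p' 1" by auto
  from Cons.IH[OF adj_ideal[OF I xc] _ _ p'(1)] Cons.prems p'(2)
    genideal_adj[OF I xc, of "set (ys @ zs)"] genideal_adj[OF I xc, of "set ys"]
  show ?case by auto
qed

end

text \<open>A system of parameters generating the maximal ideal, with a chain of primes of maximal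
  length: by \<open>prefix_prime\<close> this amounts to regularity.\<close>

locale regular_parameters = noetherian_local +
  fixes xs p
  assumes xs: "set xs \<subseteq> carrier R" "M = Idl (set xs)"
    and chain: "prime_chain R (length xs) p"
begin

lemma chain_above:
  assumes "set (ys @ zs) = set xs" "length (ys @ zs) = length xs"
  shows "\<exists>p'. prime_chain R (length zs) p' \<and> Idl (set ys) \<subseteq> p' 0 \<and>
    M = Idl (Idl (set ys) \<union> set zs)"
proof -
  note sub = genideal_with_zero
  have ys: "set ys \<subseteq> carrier R" using assms xs by auto
  have "primeideal (p 0) R" using chain unfolding prime_chain_def by auto
  from ideal_zero[OF prime_ideal[OF this]] show ?thesis
    using chain_above_generators[OF zeroideal, of ys zs p] assms xs chain
    unfolding sub[OF ys] sub[OF xs(1)] assms by auto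
qed

text \<open>Only the set and the number of the parameters enter the hypotheses, so that any of them,
  in any order, may be taken for \<open>ys\<close>.\<close>

lemma prefix_prime:
  assumes "set (ys @ zs) = set xs" "length (ys @ zs) = length xs"
  shows "primeideal (Idl (set ys)) R"
proof -
  have ys: "set ys \<subseteq> carrier R" "set zs \<subseteq> carrier R" using assms xs by auto
  show ?thesis using chain_above[OF assms] prime_of_maximal_chain[OF genideal_ideal[OF ys(1)] ys(2)] by auto
qed

text \<open>Otherwise \<open>zs\<close> alone would generate \<open>M\<close> over the ideal of
  \<open>ys\<close>, while the chain above that ideal has one step more.\<close>

lemma prefix_strict:
  assumes "set (ys @ y # zs) = set xs" "length (ys @ y # zs) = length xs"
  shows "y \<notin> Idl (set ys)"
proof
  assume y: "y \<in> Idl (set ys)"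
  have ys: "set ys \<subseteq> carrier R" "set zs \<subseteq> carrier R" using assms xs by auto
  from chain_above[OF assms] obtain p' where p': "prime_chain R (Suc (length zs)) p'"
    "Idl (set ys) \<subseteq> p' 0" "M = Idl (Idl (set ys) \<union> set (y # zs))" by auto
  have "Idl (set ys) \<union> set (y # zs) = Idl (set ys) \<union> set zs" using y by auto
  then have "Suc (length zs) \<le> length zs"
    using chain_length_le_generators[OF genideal_ideal[OF ys(1)] ys(2) _ p'(1,2)] p'(3) by simp
  then show False by simp
qed

lemma chain_length_le: "prime_chain R n q \<Longrightarrow> n \<le> length xs"
proof -
  assume q: "prime_chain R n q"
  then have "{\<zero>} \<subseteq> q 0" using ideal_zero[OF prime_ideal] unfolding prime_chain_def by auto
  then show ?thesis
    using chain_length_le_generators[OF zeroideal xs(1) _ q] xs(2) genideal_with_zero[OF xs(1)] by auto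
qed

end

section \<open>Adjoining one element to a subring of a field\<close>

text \<open>Values at \<open>w\<close> of polynomials of degree less than \<open>n\<close> in Horner
  form. With values in place of formal polynomials, \<open>polys_in A w\<close> is the subring
  \<open>A[w]\<close> itself; the price is that coefficients are not determined by the
  element.\<close>

primrec (in ring) poly_in :: "'a set \<Rightarrow> 'a \<Rightarrow> nat \<Rightarrow> 'a set"
  where "poly_in J w 0 = {\<zero>}"
  | "poly_in J w (Suc n) = {a \<oplus> w \<otimes> f | a f. a \<in> J \<and> f \<in> poly_in J w n}"

definition (in ring) polys_in :: "'a set \<Rightarrow> 'a \<Rightarrow> 'a set"
  where "polys_in J w = (\<Union>n. poly_in J w n)"

context domain
begin

lemma subring_cring: assumes "subring A R" shows "cring (subring_of R A)"
  using subring_is_domain[OF assms] domain.axioms(1) by blast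

lemma ideal_subring_iff:
  assumes A: "subring A R"
  shows "ideal I (subring_of R A) \<longleftrightarrow> I \<subseteq> A \<and> \<zero> \<in> I \<and> (\<forall>a\<in>I. \<forall>b\<in>I. a \<oplus> b \<in> I) \<and> (\<forall>a\<in>I. \<forall>r\<in>A. r \<otimes> a \<in> I)"
    (is "?L \<longleftrightarrow> ?R")
proof -
  interpret A: cring "subring_of R A" by (rule subring_cring[OF A])
  show ?thesis
  proof
    assume I: ?L
    show ?R using A.ideal_sub[OF I] A.ideal_zero[OF I] A.ideal_add[OF I] A.ideal_mult[OF I] by simp
  next
    assume ?R then show ?L by (intro A.ideal_intro) auto
  qed
qed

lemma prime_subring_iff:
  assumes A: "subring A R"
  shows "primeideal P (subring_of R A) \<longleftrightarrow> ideal P (subring_of R A) \<and> \<one> \<notin> P \<and>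
    (\<forall>a\<in>A. \<forall>b\<in>A. a \<otimes> b \<in> P \<longrightarrow> a \<in> P \<or> b \<in> P)" (is "?L \<longleftrightarrow> ?R")
proof -
  interpret A: cring "subring_of R A" by (rule subring_cring[OF A])
  show ?thesis
  proof
    assume P: ?L
    show ?R using A.prime_ideal[OF P] A.prime_one[OF P] A.prime_mult[OF P] by simp
  next
    assume ?R then show ?L by (intro A.prime_intro) auto
  qed
qed

lemma subring_ideal_neg:
  assumes A: "subring A R" and I: "ideal I (subring_of R A)" and a: "a \<in> I"
  shows "\<ominus> a \<in> I"
proof -
  have ac: "a \<in> carrier R" using a I subringE(1)[OF A] unfolding ideal_subring_iff[OF A] by auto
  have "(\<ominus> \<one>) \<otimes> a \<in> I" using I a subringE(3,5)[OF A] unfolding ideal_subring_iff[OF A] by auto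
  moreover have "(\<ominus> \<one>) \<otimes> a = \<ominus> a" using ac by (simp add: l_minus)
  ultimately show ?thesis by simp
qed

lemma genideal_subring:
  assumes A: "subring A R" and S: "S \<subseteq> A"
  shows "ideal (Idl\<^bsub>subring_of R A\<^esub> S) (subring_of R A)" "S \<subseteq> Idl\<^bsub>subring_of R A\<^esub> S"
    "\<And>J. ideal J (subring_of R A) \<Longrightarrow> S \<subseteq> J \<Longrightarrow> Idl\<^bsub>subring_of R A\<^esub> S \<subseteq> J"
proof -
  interpret A: cring "subring_of R A" by (rule subring_cring[OF A])
  show "ideal (Idl\<^bsub>subring_of R A\<^esub> S) (subring_of R A)" using A.genideal_ideal S by simp
  show "S \<subseteq> Idl\<^bsub>subring_of R A\<^esub> S" using A.genideal_self S by simp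
  show "\<And>J. ideal J (subring_of R A) \<Longrightarrow> S \<subseteq> J \<Longrightarrow> Idl\<^bsub>subring_of R A\<^esub> S \<subseteq> J"
    by (rule A.genideal_minimal)
qed

lemma genideal_single:
  assumes A: "subring A R" and a: "a \<in> A"
  shows "Idl\<^bsub>subring_of R A\<^esub> {a} = {r \<otimes> a | r. r \<in> A}"
proof -
  interpret A: cring "subring_of R A" by (rule subring_cring[OF A])
  show ?thesis using A.cgenideal_eq_genideal[of a] a unfolding cgenideal_def by simp
qed

lemma noetherian_subring_iff:
  assumes A: "subring A R"
  shows "noetherian_ring (subring_of R A) \<longleftrightarrow>
    (\<forall>I. ideal I (subring_of R A) \<longrightarrow> (\<exists>G\<subseteq>A. finite G \<and> I = Idl\<^bsub>subring_of R A\<^esub> G))"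
proof -
  interpret A: cring "subring_of R A" by (rule subring_cring[OF A])
  show ?thesis
  proof
    assume "noetherian_ring (subring_of R A)"
    then interpret N: noetherian_ring "subring_of R A" .
    show "\<forall>I. ideal I (subring_of R A) \<longrightarrow> (\<exists>G\<subseteq>A. finite G \<and> I = Idl\<^bsub>subring_of R A\<^esub> G)"
      using N.finetely_gen by auto
  next
    assume "\<forall>I. ideal I (subring_of R A) \<longrightarrow> (\<exists>G\<subseteq>A. finite G \<and> I = Idl\<^bsub>subring_of R A\<^esub> G)"
    then show "noetherian_ring (subring_of R A)" by (intro A.noetherian_ringI) auto
  qed
qed

end

section \<open>The ring generated by one element\<close>

context domain
begin

context
  fixes A J w
  assumes A: "subring A R" and J: "ideal J (subring_of R A)" and w: "w \<in> carrier R"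
begin

lemma coeff_carrier: "a \<in> J \<Longrightarrow> a \<in> carrier R" "a \<in> J \<Longrightarrow> a \<in> A"
  using J subringE(1)[OF A] unfolding ideal_subring_iff[OF A] by auto

lemma poly_in_carrier: "f \<in> poly_in J w n \<Longrightarrow> f \<in> carrier R"
  by (induction n arbitrary: f) (use w coeff_carrier in auto)

lemma poly_in_zero: "\<zero> \<in> poly_in J w n"
proof (induction n)
  case (Suc n)
  have "\<zero> = \<zero> \<oplus> w \<otimes> \<zero>" using w by simp
  then show ?case using Suc J unfolding ideal_subring_iff[OF A] poly_in.simps by blast
qed simp

lemma poly_in_mono_Suc: "poly_in J w n \<subseteq> poly_in J w (Suc n)"
proof (induction n)
  case 0
  then show ?case using poly_in_zero[of "Suc 0"] by auto
next
  case (Suc n)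
  then show ?case unfolding poly_in.simps(2)[of J w "Suc n"] poly_in.simps(2)[of J w n] by blast
qed

lemma poly_in_mono: "m \<le> n \<Longrightarrow> poly_in J w m \<subseteq> poly_in J w n"
  by (induction rule: dec_induct) (use poly_in_mono_Suc in auto)

lemma poly_in_add: "f \<in> poly_in J w n \<Longrightarrow> g \<in> poly_in J w n \<Longrightarrow> f \<oplus> g \<in> poly_in J w n"
proof (induction n arbitrary: f g)
  case (Suc n)
  then obtain a b f' g' where *: "f = a \<oplus> w \<otimes> f'" "g = b \<oplus> w \<otimes> g'" "a \<in> J" "b \<in> J"
    "f' \<in> poly_in J w n" "g' \<in> poly_in J w n" by auto
  have "f \<oplus> g = (a \<oplus> b) \<oplus> w \<otimes> (f' \<oplus> g')" unfolding *
    using coeff_carrier(1)[OF *(3)] coeff_carrier(1)[OF *(4)] poly_in_carrier[OF *(5)] poly_in_carrier[OF *(6)] w by algebra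
  moreover have "a \<oplus> b \<in> J" using J * unfolding ideal_subring_iff[OF A] by auto
  ultimately show ?case using Suc.IH[OF *(5,6)] by auto
qed simp

lemma poly_in_smult: "r \<in> A \<Longrightarrow> f \<in> poly_in J w n \<Longrightarrow> r \<otimes> f \<in> poly_in J w n"
proof (induction n arbitrary: f)
  case (Suc n)
  have rc: "r \<in> carrier R" using subringE(1)[OF A] Suc by auto
  from Suc obtain a f' where *: "f = a \<oplus> w \<otimes> f'" "a \<in> J" "f' \<in> poly_in J w n" by auto
  have "r \<otimes> f = r \<otimes> a \<oplus> w \<otimes> (r \<otimes> f')" unfolding *
    using coeff_carrier(1)[OF *(2)] poly_in_carrier[OF *(3)] w rc by algebra
  moreover have "r \<otimes> a \<in> J" using J * Suc unfolding ideal_subring_iff[OF A] by auto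
  ultimately show ?case using Suc.IH[OF Suc(2) *(3)] by auto
qed (use subringE(1)[OF A] in auto)

lemma poly_in_coeff: assumes "a \<in> J" shows "a \<in> poly_in J w (Suc 0)"
proof -
  have "a = a \<oplus> w \<otimes> \<zero>" using coeff_carrier(1)[OF assms] w by simp
  then show ?thesis using assms by auto
qed

lemma poly_in_shift: assumes "f \<in> poly_in J w n" shows "w \<otimes> f \<in> poly_in J w (Suc n)"
proof -
  have "w \<otimes> f = \<zero> \<oplus> w \<otimes> f" using poly_in_carrier[OF assms] w by simp
  then show ?thesis using assms J unfolding ideal_subring_iff[OF A] poly_in.simps by blast
qed

lemma poly_in_monomial: assumes "a \<in> J" shows "a \<otimes> w [^] n \<in> poly_in J w (Suc n)"
proof (induction n)
  case 0
  then show ?case using poly_in_coeff[OF assms] coeff_carrier(1)[OF assms] by simp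
next
  case (Suc n)
  have "w \<otimes> (a \<otimes> w [^] n) = a \<otimes> w [^] Suc n"
    using coeff_carrier(1)[OF assms] w by (simp add: m_ac)
  then show ?case using poly_in_shift[OF Suc] by (simp only:)
qed

text \<open>The Horner form displays the constant coefficient; arguments by degree need the leading
  one.\<close>

lemma poly_in_lead:
  assumes "f \<in> poly_in J w (Suc n)"
  shows "\<exists>a\<in>J. \<exists>g\<in>poly_in J w n. f = a \<otimes> w [^] n \<oplus> g"
  using assms
proof (induction n arbitrary: f)
  case 0
  then show ?case using coeff_carrier w by auto
next
  case (Suc n)
  then obtain a f' where *: "f = a \<oplus> w \<otimes> f'" "a \<in> J" "f' \<in> poly_in J w (Suc n)" by auto
  from Suc.IH[OF *(3)] obtain b g where bg: "b \<in> J" "g \<in> poly_in J w n" "f' = b \<otimes> w [^] n \<oplus> g" by auto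
  have "f = b \<otimes> w [^] Suc n \<oplus> (a \<oplus> w \<otimes> g)" unfolding * bg nat_pow_Suc
    using coeff_carrier(1)[OF *(2)] coeff_carrier(1)[OF bg(1)] poly_in_carrier[OF bg(2)] w
      nat_pow_closed[OF w, of n] by algebra
  moreover have "a \<oplus> w \<otimes> g \<in> poly_in J w (Suc n)" using *(2) bg(2) by auto
  ultimately show ?case using bg(1) by blast
qed

lemma polys_in_add: "f \<in> polys_in J w \<Longrightarrow> g \<in> polys_in J w \<Longrightarrow> f \<oplus> g \<in> polys_in J w"
proof -
  assume "f \<in> polys_in J w" "g \<in> polys_in J w"
  then obtain m n where "f \<in> poly_in J w m" "g \<in> poly_in J w n" unfolding polys_in_def by auto
  then have "f \<in> poly_in J w (max m n)" "g \<in> poly_in J w (max m n)"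
    using poly_in_mono[of m "max m n"] poly_in_mono[of n "max m n"] by auto
  then show ?thesis using poly_in_add unfolding polys_in_def by blast
qed

lemma polys_in_carrier: "polys_in J w \<subseteq> carrier R"
  using poly_in_carrier unfolding polys_in_def by auto

lemma polys_in_smult: "r \<in> A \<Longrightarrow> f \<in> polys_in J w \<Longrightarrow> r \<otimes> f \<in> polys_in J w"
  using poly_in_smult unfolding polys_in_def by blast

lemma polys_in_shift: "f \<in> polys_in J w \<Longrightarrow> w \<otimes> f \<in> polys_in J w"
  using poly_in_shift unfolding polys_in_def by blast

lemma polys_in_coeff: "a \<in> J \<Longrightarrow> a \<in> polys_in J w"
  using poly_in_coeff unfolding polys_in_def by blast

lemma polys_in_horner: "a \<in> J \<Longrightarrow> f \<in> polys_in J w \<Longrightarrow> a \<oplus> w \<otimes> f \<in> polys_in J w"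
  using polys_in_add polys_in_coeff polys_in_shift by blast

lemma polys_in_zero: "\<zero> \<in> polys_in J w" using poly_in_zero unfolding polys_in_def by blast

lemma polys_in_cases:
  assumes "f \<in> polys_in J w" obtains a g where "a \<in> J" "g \<in> polys_in J w" "f = a \<oplus> w \<otimes> g"
proof -
  obtain n where "f \<in> poly_in J w (Suc n)" using assms poly_in_mono_Suc unfolding polys_in_def by blast
  then show thesis using that unfolding polys_in_def by auto
qed

end

lemma whole_ideal: assumes "subring A R" shows "ideal A (subring_of R A)"
  unfolding ideal_subring_iff[OF assms] using subringE[OF assms] by auto

lemma polys_in_mult:
  assumes A: "subring A R" and J: "ideal J (subring_of R A)" and w: "w \<in> carrier R"
    and f: "f \<in> polys_in A w" and g: "g \<in> polys_in J w"
  shows "f \<otimes> g \<in> polys_in J w"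
proof -
  have gc: "g \<in> carrier R" using polys_in_carrier[OF A J w] g by auto
  obtain n where "f \<in> poly_in A w n" using f unfolding polys_in_def by auto
  then show ?thesis
  proof (induction n arbitrary: f)
    case 0
    then show ?case using gc polys_in_zero[OF A J w] by simp
  next
    case (Suc n)
    then obtain a f' where *: "f = a \<oplus> w \<otimes> f'" "a \<in> A" "f' \<in> poly_in A w n" by auto
    have c: "a \<in> carrier R" "f' \<in> carrier R"
      using *(2) subringE(1)[OF A] poly_in_carrier[OF A whole_ideal[OF A] w *(3)] by auto
    have "f \<otimes> g = a \<otimes> g \<oplus> w \<otimes> (f' \<otimes> g)" unfolding * using c gc w by algebra
    then show ?case
      using polys_in_add[OF A J w polys_in_smult[OF A J w *(2) g] polys_in_shift[OF A J w Suc.IH[OF *(3)]]]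
      by simp
  qed
qed

lemma polys_in_mono: assumes "I \<subseteq> J" shows "polys_in I w \<subseteq> polys_in J w"
proof -
  have "poly_in I w n \<subseteq> poly_in J w n" for n
  proof (induction n)
    case (Suc n)
    then show ?case using assms unfolding poly_in.simps by blast
  qed simp
  then show ?thesis unfolding polys_in_def by auto
qed

lemma polys_in_subring:
  assumes A: "subring A R" and w: "w \<in> carrier R"
  shows "subring (polys_in A w) R"
proof (rule subringI)
  note AA = whole_ideal[OF A]
  show "polys_in A w \<subseteq> carrier R" by (rule polys_in_carrier[OF A AA w])
  show one: "\<one> \<in> polys_in A w" by (rule polys_in_coeff[OF A AA w subringE(3)[OF A]])
  show "h1 \<oplus> h2 \<in> polys_in A w" if "h1 \<in> polys_in A w" "h2 \<in> polys_in A w" for h1 h2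
    by (rule polys_in_add[OF A AA w that])
  show "h1 \<otimes> h2 \<in> polys_in A w" if "h1 \<in> polys_in A w" "h2 \<in> polys_in A w" for h1 h2
    by (rule polys_in_mult[OF A AA w that])
  show "\<ominus> h \<in> polys_in A w" if "h \<in> polys_in A w" for h
  proof -
    have "(\<ominus> \<one>) \<otimes> h \<in> polys_in A w"
      by (rule polys_in_smult[OF A AA w _ that]) (use subringE(3,5)[OF A] in auto)
    moreover have "h \<in> carrier R" using polys_in_carrier[OF A AA w] that by auto
    ultimately show ?thesis by (simp add: l_minus)
  qed
qed

lemma polys_in_gen: assumes A: "subring A R" and w: "w \<in> carrier R" shows "A \<subseteq> polys_in A w" "w \<in> polys_in A w"
proof -
  note AA = whole_ideal[OF A]
  show "A \<subseteq> polys_in A w" using polys_in_coeff[OF A AA w] by auto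
  have "w = w \<otimes> \<one>" using w by simp
  then show "w \<in> polys_in A w" using polys_in_shift[OF A AA w polys_in_coeff[OF A AA w subringE(3)[OF A]]] by simp
qed

lemma polys_in_minimal:
  assumes D: "subring D R" and "A \<subseteq> D" "w \<in> D" shows "polys_in A w \<subseteq> D"
proof -
  have "poly_in A w n \<subseteq> D" for n
  proof (induction n)
    case (Suc n)
    have "a \<oplus> w \<otimes> f \<in> D" if "a \<in> A" "f \<in> poly_in A w n" for a f
      by (intro subringE(6,7)[OF D]) (use that Suc assms in auto)
    then show ?case by auto
  qed (use subringE(2)[OF D] in auto)
  then show ?thesis unfolding polys_in_def by auto
qed

text \<open>Hilbert's basis theorem: an ideal is determined by the ideals of leading coefficients.\<close>

lemma hilbert_basis:
  assumes A: "subring A R" and w: "w \<in> carrier R" and N: "noetherian_ring (subring_of R A)"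
  shows "noetherian_ring (subring_of R (polys_in A w))"
proof -
  define B where "B = polys_in A w"
  note AA = whole_ideal[OF A]
  have B: "subring B R" unfolding B_def by (rule polys_in_subring[OF A w])
  have AB: "A \<subseteq> B" and wB: "w \<in> B" using polys_in_gen[OF A w] unfolding B_def by auto
  note Ac = subsetD[OF subringE(1)[OF A]]
  note pc = poly_in_carrier[OF A AA w]
  have wn: "w [^] n \<in> carrier R" for n :: nat using w by simp
  have wnB: "w [^] n \<in> B" for n :: nat
    by (induction n) (use subringE(3)[OF B] subringE(6)[OF B] wB in auto)
  \<comment> \<open>As \<open>w\<close> may satisfy relations over \<open>A\<close>, a leading
    coefficient belongs to a representation and not to an element. So \<open>L I n\<close> collects
    the coefficients of \<open>w^n\<close> in all representations of degree at most \<open>n\<close>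
    of elements of \<open>I\<close>.\<close>
  define L where "L I n = {a \<in> A. \<exists>b\<in>poly_in A w n. a \<otimes> w [^] n \<oplus> b \<in> I}" for I and n :: nat
  have Lid: "ideal (L I n) (subring_of R A)" if I: "ideal I (subring_of R B)" for I n
    unfolding ideal_subring_iff[OF A]
  proof (intro conjI ballI)
    note I' = I[unfolded ideal_subring_iff[OF B]]
    show "L I n \<subseteq> A" unfolding L_def by auto
    have "\<zero> \<otimes> w [^] n \<oplus> \<zero> \<in> I" using I' wn by simp
    then show "\<zero> \<in> L I n" unfolding L_def using poly_in_zero[OF A AA w] subringE(2)[OF A] by blast
    fix a assume "a \<in> L I n"
    then obtain f where f: "a \<in> A" "f \<in> poly_in A w n" "a \<otimes> w [^] n \<oplus> f \<in> I" unfolding L_def by auto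
    { fix b assume "b \<in> L I n"
      then obtain g where g: "b \<in> A" "g \<in> poly_in A w n" "b \<otimes> w [^] n \<oplus> g \<in> I" unfolding L_def by auto
      have "(a \<otimes> w [^] n \<oplus> f) \<oplus> (b \<otimes> w [^] n \<oplus> g) = (a \<oplus> b) \<otimes> w [^] n \<oplus> (f \<oplus> g)"
        using Ac[OF f(1)] Ac[OF g(1)] pc[OF f(2)] pc[OF g(2)] wn[of n] by algebra
      moreover have "(a \<otimes> w [^] n \<oplus> f) \<oplus> (b \<otimes> w [^] n \<oplus> g) \<in> I" using I' f(3) g(3) by blast
      ultimately have "(a \<oplus> b) \<otimes> w [^] n \<oplus> (f \<oplus> g) \<in> I" by (simp only:)
      then show "a \<oplus> b \<in> L I n" unfolding L_def
        using poly_in_add[OF A AA w f(2) g(2)] subringE(7)[OF A f(1) g(1)] by blast }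
    { fix r assume r: "r \<in> A"
      have "r \<otimes> (a \<otimes> w [^] n \<oplus> f) = (r \<otimes> a) \<otimes> w [^] n \<oplus> (r \<otimes> f)"
        using Ac[OF f(1)] Ac[OF r] pc[OF f(2)] wn[of n] by algebra
      moreover have "r \<otimes> (a \<otimes> w [^] n \<oplus> f) \<in> I" using I' f(3) r AB by blast
      ultimately have "(r \<otimes> a) \<otimes> w [^] n \<oplus> (r \<otimes> f) \<in> I" by (simp only:)
      then show "r \<otimes> a \<in> L I n" unfolding L_def
        using poly_in_smult[OF A AA w r f(2)] subringE(6)[OF A r f(1)] by blast }
  qed
  have Lmono: "L I n \<subseteq> L I (Suc n)" if I: "ideal I (subring_of R B)" for I n
  proof
    note I' = I[unfolded ideal_subring_iff[OF B]]
    fix a assume "a \<in> L I n"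
    then obtain f where f: "a \<in> A" "f \<in> poly_in A w n" "a \<otimes> w [^] n \<oplus> f \<in> I" unfolding L_def by auto
    have "w \<otimes> (a \<otimes> w [^] n \<oplus> f) = a \<otimes> w [^] Suc n \<oplus> w \<otimes> f" unfolding nat_pow_Suc
      using Ac[OF f(1)] w pc[OF f(2)] wn[of n] by algebra
    moreover have "w \<otimes> (a \<otimes> w [^] n \<oplus> f) \<in> I" using I' f(3) wB by blast
    ultimately have "a \<otimes> w [^] Suc n \<oplus> w \<otimes> f \<in> I" by (simp only:)
    then show "a \<in> L I (Suc n)" unfolding L_def using poly_in_shift[OF A AA w f(2)] f(1) by blast
  qed
  have Lmono': "L I m \<subseteq> L I n" if "ideal I (subring_of R B)" "m \<le> n" for I m n
    using that(2) by (induction rule: dec_induct) (use Lmono[OF that(1)] in auto)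
  have determined: "I \<subseteq> I'" if I: "ideal I (subring_of R B)" and I': "ideal I' (subring_of R B)" and sub: "I' \<subseteq> I"
    and L: "\<And>n. L I n \<subseteq> L I' n" for I I'
  proof -
    note Ii = I[unfolded ideal_subring_iff[OF B]] note Ii' = I'[unfolded ideal_subring_iff[OF B]]
    have "f \<in> I'" if "f \<in> poly_in A w n" "f \<in> I" for f n
      using that
    proof (induction n arbitrary: f)
      case 0
      then show ?case using Ii' by auto
    next
      case (Suc n)
      obtain a g where ag: "a \<in> A" "g \<in> poly_in A w n" "f = a \<otimes> w [^] n \<oplus> g"
        using poly_in_lead[OF A AA w Suc.prems(1)] by auto
      then have "a \<in> L I n" unfolding L_def using Suc.prems by auto
      then obtain h where h: "h \<in> poly_in A w n" "a \<otimes> w [^] n \<oplus> h \<in> I'" using L[of n] unfolding L_def by auto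
      have c: "a \<in> carrier R" "g \<in> carrier R" "h \<in> carrier R" "w [^] n \<in> carrier R"
        using Ac ag pc h wn by auto
      have "\<ominus> (a \<otimes> w [^] n \<oplus> h) \<in> I" by (rule subring_ideal_neg[OF B I]) (use h sub in auto)
      then have "f \<oplus> \<ominus> (a \<otimes> w [^] n \<oplus> h) \<in> I" using Ii Suc.prems(2) by blast
      moreover have "f \<oplus> \<ominus> (a \<otimes> w [^] n \<oplus> h) = g \<oplus> \<ominus> \<one> \<otimes> h" unfolding ag(3) using c by algebra
      moreover have "g \<oplus> \<ominus> \<one> \<otimes> h \<in> poly_in A w n"
        by (intro poly_in_add[OF A AA w ag(2)] poly_in_smult[OF A AA w _ h(1)]) (use subringE(3,5)[OF A] in auto)
      ultimately have "g \<oplus> \<ominus> \<one> \<otimes> h \<in> I'" using Suc.IH by simp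
      then have "(g \<oplus> \<ominus> \<one> \<otimes> h) \<oplus> (a \<otimes> w [^] n \<oplus> h) \<in> I'" using Ii' h(2) by blast
      moreover have "(g \<oplus> \<ominus> \<one> \<otimes> h) \<oplus> (a \<otimes> w [^] n \<oplus> h) = f" unfolding ag(3) using c by algebra
      ultimately show ?case by (simp only:)
    qed
    then show ?thesis using Ii unfolding B_def polys_in_def by auto
  qed
  show ?thesis unfolding B_def[symmetric] noetherian_subring_iff[OF B]
  proof (intro allI impI)
    fix I assume I: "ideal I (subring_of R B)"
    note I' = I[unfolded ideal_subring_iff[OF B]]
    interpret NA: noetherian_ring "subring_of R A" by (rule N)
    have "L I 0 \<in> range (L I)" by simp
    then obtain M where M: "M \<in> range (L I)" "\<And>J. J \<in> range (L I) \<Longrightarrow> M \<subseteq> J \<Longrightarrow> J = M"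
      by (rule NA.noetherian_maximal) (use Lid[OF I] in auto)
    \<comment> \<open>The increasing sequence \<open>L I\<close> is stationary from
      \<open>n0\<close> on, so it suffices to take lifts of generators of \<open>L I n\<close> for
      the finitely many \<open>n\<close> up to \<open>n0\<close>.\<close>
    from M(1) obtain n0 where "M = L I n0" by auto
    then have n0: "L I n = L I n0" if "n \<ge> n0" for n using M(2)[of "L I n"] Lmono'[OF I that] by auto
    have "\<exists>G. finite G \<and> G \<subseteq> I \<and> L I n \<subseteq> L (Idl\<^bsub>subring_of R B\<^esub> G) n" for n
    proof -
      obtain H where H: "H \<subseteq> A" "finite H" "L I n = Idl\<^bsub>subring_of R A\<^esub> H"
        using Lid[OF I, of n] N unfolding noetherian_subring_iff[OF A] by blast
      have "\<forall>a\<in>H. \<exists>b. b \<in> poly_in A w n \<and> a \<otimes> w [^] n \<oplus> b \<in> I"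
        using genideal_subring(2)[OF A H(1)] H(3) unfolding L_def by auto
      then obtain b where b: "\<And>a. a \<in> H \<Longrightarrow> b a \<in> poly_in A w n \<and> a \<otimes> w [^] n \<oplus> b a \<in> I" by metis
      define G where "G = (\<lambda>a. a \<otimes> w [^] n \<oplus> b a) ` H"
      have G: "G \<subseteq> I" "finite G" "G \<subseteq> B" unfolding G_def using b H I' by auto
      have "H \<subseteq> L (Idl\<^bsub>subring_of R B\<^esub> G) n"
        using genideal_subring(2)[OF B G(3)] b H(1) unfolding L_def G_def by auto
      then have "L I n \<subseteq> L (Idl\<^bsub>subring_of R B\<^esub> G) n"
        unfolding H(3) by (rule genideal_subring(3)[OF A H(1) Lid[OF genideal_subring(1)[OF B G(3)]]])
      then show ?thesis using G by auto
    qed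
    then obtain G where G: "\<And>n. finite (G n) \<and> G n \<subseteq> I \<and> L I n \<subseteq> L (Idl\<^bsub>subring_of R B\<^esub> (G n)) n" by metis
    define G' where "G' = (\<Union>n\<le>n0. G n)"
    have G': "finite G'" "G' \<subseteq> I" "G' \<subseteq> B" unfolding G'_def using G I' by auto
    note Gi = genideal_subring[OF B G'(3)]
    have sub: "Idl\<^bsub>subring_of R B\<^esub> G' \<subseteq> I" by (rule Gi(3)[OF I G'(2)])
    have Gn: "L I n \<subseteq> L (Idl\<^bsub>subring_of R B\<^esub> G') n" if "n \<le> n0" for n
    proof -
      have GnB: "G n \<subseteq> B" using G I' by blast
      have "Idl\<^bsub>subring_of R B\<^esub> (G n) \<subseteq> Idl\<^bsub>subring_of R B\<^esub> G'"
        by (rule genideal_subring(3)[OF B GnB Gi(1)]) (use Gi(2) that in \<open>auto simp: G'_def\<close>)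
      then show ?thesis using G[of n] unfolding L_def by blast
    qed
    have "L I n \<subseteq> L (Idl\<^bsub>subring_of R B\<^esub> G') n" for n
    proof (cases "n \<le> n0")
      case False
      then show ?thesis using n0[of n] Gn[of n0] Lmono'[OF Gi(1), of n0 n] by auto
    qed (use Gn in auto)
    then have "I = Idl\<^bsub>subring_of R B\<^esub> G'" using determined[OF I Gi(1) sub] sub by auto
    then show "\<exists>G\<subseteq>B. finite G \<and> I = Idl\<^bsub>subring_of R B\<^esub> G" using G' by auto
  qed
qed

end

section \<open>Subrings of a field dominated by a real valuation\<close>

locale valued_field = field K for K (structure) +
  fixes V v
  assumes val: "real_valuation K V v"
begin

lemma v_zero [simp]: "v \<zero> = \<infinity>" using val unfolding real_valuation_def by auto

lemma v_finite: assumes "x \<in> carrier K" "x \<noteq> \<zero>" obtains r where "v x = ereal r"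
  using val assms unfolding real_valuation_def by (cases "v x") auto

lemma v_eq_zero: "x \<in> carrier K \<Longrightarrow> v x = 0 \<Longrightarrow> x \<noteq> \<zero>" by auto

lemma v_mult: "x \<in> carrier K \<Longrightarrow> y \<in> carrier K \<Longrightarrow> v (x \<otimes> y) = v x + v y"
  using val unfolding real_valuation_def by auto

lemma v_add: "x \<in> carrier K \<Longrightarrow> y \<in> carrier K \<Longrightarrow> min (v x) (v y) \<le> v (x \<oplus> y)"
  using val unfolding real_valuation_def by auto

lemma V_eq: "V = {x \<in> carrier K. 0 \<le> v x}"
  using val unfolding real_valuation_def by auto

lemma v_one [simp]: "v \<one> = 0"
proof -
  obtain r where "v \<one> = ereal r" using v_finite[of \<one>] by auto
  moreover have "v \<one> = v \<one> + v \<one>" using v_mult[of \<one> \<one>] by simp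
  ultimately show ?thesis by simp
qed

lemma v_neg [simp]: assumes x: "x \<in> carrier K" shows "v (\<ominus> x) = v x"
proof -
  obtain r where r: "v (\<ominus> \<one>) = ereal r" using v_finite[of "\<ominus> \<one>"] by auto
  have "v (\<ominus> \<one> \<otimes> \<ominus> \<one>) = v (\<ominus> \<one>) + v (\<ominus> \<one>)" by (rule v_mult) auto
  moreover have "\<ominus> \<one> \<otimes> \<ominus> \<one> = \<one>" by algebra
  ultimately have "r = 0" using r by simp
  moreover have "\<ominus> x = \<ominus> \<one> \<otimes> x" using x by (simp add: l_minus)
  ultimately show ?thesis using v_mult[of "\<ominus> \<one>" x] r x by simp
qed

lemma inv_facts [simp]:
  assumes "x \<in> carrier K" "x \<noteq> \<zero>"
  shows "inv x \<in> carrier K" "inv x \<noteq> \<zero>" "x \<otimes> inv x = \<one>" "inv x \<otimes> x = \<one>"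
  using assms field_Units Units_inv_closed Units_r_inv Units_l_inv Units_inv_Units by auto

lemma v_inv: assumes "x \<in> carrier K" "x \<noteq> \<zero>" shows "v (inv x) = - v x"
proof -
  obtain r s where r: "v x = ereal r" "v (inv x) = ereal s"
    using v_finite[OF assms] v_finite[OF inv_facts(1,2)[OF assms]] by metis
  have "v x + v (inv x) = 0" using v_mult[of x "inv x"] assms by simp
  then show ?thesis using r by simp
qed

lemma v_div:
  assumes "x \<in> carrier K" "y \<in> carrier K" "y \<noteq> \<zero>" shows "v (x \<otimes> inv y) = v x - v y"
  using v_mult[of x "inv y"] v_inv[OF assms(2,3)] assms by (simp add: minus_ereal_def)

definition pos where "pos = {x \<in> carrier K. 0 < v x}"

text \<open>Local subrings dominated by \<open>V\<close>, described without a maximal ideal: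
  elements of value zero are units. By \<open>maximal_dominated_iff\<close> the maximal ideal is
  then \<open>A \<inter> pos\<close>.\<close>

definition dominated where
  "dominated A \<longleftrightarrow> subring A K \<and> A \<subseteq> V \<and> (\<forall>x\<in>A. v x = 0 \<longrightarrow> inv x \<in> A)"

lemma pos_add: "x \<in> pos \<Longrightarrow> y \<in> pos \<Longrightarrow> x \<oplus> y \<in> pos"
  using v_add[of x y] unfolding pos_def by (auto simp: min_def split: if_splits)

lemma pos_mult: "r \<in> V \<Longrightarrow> y \<in> pos \<Longrightarrow> r \<otimes> y \<in> pos"
  using v_mult[of r y] unfolding pos_def V_eq by (auto simp: add_nonneg_pos)

lemma pos_sub: "pos \<subseteq> V" unfolding pos_def V_eq by auto

lemma V_subring: "subring V K"
proof (rule subringI)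
  show "x \<oplus> y \<in> V" if "x \<in> V" "y \<in> V" for x y
    using that v_add[of x y] unfolding V_eq by (auto simp: min_def split: if_splits)
  show "x \<otimes> y \<in> V" if "x \<in> V" "y \<in> V" for x y
    using that v_mult[of x y] unfolding V_eq by auto
qed (auto simp: V_eq)

lemma V_dominated: "dominated V"
  unfolding dominated_def using V_subring v_inv v_eq_zero by (auto simp: V_eq)

lemma dominatedD:
  assumes "dominated A"
  shows "subring A K" "A \<subseteq> V" "x \<in> A \<Longrightarrow> v x = 0 \<Longrightarrow> inv x \<in> A" "A \<subseteq> carrier K"
  using assms V_eq unfolding dominated_def by auto

lemma v_cases: assumes "x \<in> V" "x \<notin> pos" shows "v x = 0"
  using assms unfolding V_eq pos_def by auto

lemma pos_ideal: assumes "dominated A" shows "ideal (A \<inter> pos) (subring_of K A)"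
  unfolding ideal_subring_iff[OF dominatedD(1)[OF assms]]
  using subringE[OF dominatedD(1)[OF assms]] pos_add pos_mult dominatedD(2)[OF assms]
  by (auto simp: pos_def)

lemma ideal_not_pos:
  assumes A: "dominated A" and I: "ideal I (subring_of K A)" and x: "x \<in> I" "x \<notin> pos"
  shows "I = A"
proof -
  note I' = I[unfolded ideal_subring_iff[OF dominatedD(1)[OF A]]]
  have xA: "x \<in> A" "v x = 0" using x I' v_cases dominatedD(2)[OF A] by auto
  then have "inv x \<otimes> x \<in> I" using I' x dominatedD(3)[OF A] by blast
  moreover have "x \<in> carrier K" using xA dominatedD(4)[OF A] by auto
  ultimately have "\<one> \<in> I" using xA v_eq_zero by simp
  then have "r \<in> I" if "r \<in> A" for r
  proof -
    have "r \<otimes> \<one> \<in> I" using \<open>\<one> \<in> I\<close> I' that by blast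
    then show ?thesis using dominatedD(4)[OF A] that by auto
  qed
  then show ?thesis using I' by blast
qed

lemma one_not_pos: "\<one> \<notin> pos" unfolding pos_def by auto

lemma maximal_dominated_iff:
  assumes A: "dominated A" shows "maximalideal N (subring_of K A) \<longleftrightarrow> N = A \<inter> pos"
proof
  assume N: "maximalideal N (subring_of K A)"
  then have Ni: "ideal N (subring_of K A)" by (simp add: maximalideal_def)
  have "N \<noteq> A" using maximalideal.I_notcarr[OF N] by auto
  then have "N \<subseteq> A \<inter> pos" using ideal_not_pos[OF A Ni] Ni
    unfolding ideal_subring_iff[OF dominatedD(1)[OF A]] by blast
  moreover have "A \<inter> pos \<noteq> A" using one_not_pos subringE(3)[OF dominatedD(1)[OF A]] by auto
  ultimately show "N = A \<inter> pos" using maximalideal.I_maximal[OF N pos_ideal[OF A]] by auto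
next
  assume N: "N = A \<inter> pos"
  show "maximalideal N (subring_of K A)" unfolding N
  proof (rule maximalidealI[OF pos_ideal[OF A]])
    show "carrier (subring_of K A) \<noteq> A \<inter> pos"
      using one_not_pos subringE(3)[OF dominatedD(1)[OF A]] by auto
    show "J = A \<inter> pos \<or> J = carrier (subring_of K A)"
      if "ideal J (subring_of K A)" "A \<inter> pos \<subseteq> J" "J \<subseteq> carrier (subring_of K A)" for J
      using ideal_not_pos[OF A that(1)] that by auto
  qed
qed

lemma max_ideal_dominated: "dominated A \<Longrightarrow> max_ideal (subring_of K A) = A \<inter> pos"
  unfolding max_ideal_def using maximal_dominated_iff by auto

lemma local_dominated: "dominated A \<Longrightarrow> local_ring (subring_of K A)"
  unfolding local_ring_def using maximal_dominated_iff subring_cring[OF dominatedD(1)] by auto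

lemma pos_prime: assumes A: "dominated A" shows "primeideal (A \<inter> pos) (subring_of K A)"
  unfolding prime_subring_iff[OF dominatedD(1)[OF A]]
proof (intro conjI ballI impI pos_ideal[OF A])
  show "\<one> \<notin> A \<inter> pos" using one_not_pos by auto
  fix a b assume ab: "a \<in> A" "b \<in> A" "a \<otimes> b \<in> A \<inter> pos"
  then have c: "a \<in> V" "b \<in> V" using dominatedD(2)[OF A] by auto
  show "a \<in> A \<inter> pos \<or> b \<in> A \<inter> pos"
  proof (rule ccontr)
    assume "\<not> ?thesis"
    then have "v a = 0" "v b = 0" using v_cases c ab by auto
    then show False using ab v_mult[of a b] c unfolding pos_def V_eq by auto
  qed
qed

lemma prime_le_pos:
  assumes A: "dominated A" and P: "primeideal P (subring_of K A)" shows "P \<subseteq> A \<inter> pos"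
proof
  note P' = P[unfolded prime_subring_iff[OF dominatedD(1)[OF A]]]
  fix z assume z: "z \<in> P"
  have "z \<in> pos" using ideal_not_pos[OF A _ z] P' subringE(3)[OF dominatedD(1)[OF A]] by auto
  then show "z \<in> A \<inter> pos" using z P' unfolding ideal_subring_iff[OF dominatedD(1)[OF A]] by auto
qed

text \<open>A generator of the maximal ideal has the least positive value; comparison with
  \<open>x\<close> shows that it is finite.\<close>

lemma DVR_value_bound:
  assumes "is_DVR (subring_of K V)" and x: "x \<in> pos" "x \<noteq> \<zero>"
  shows "\<exists>c>0. \<forall>z\<in>pos. ereal c \<le> v z"
proof -
  have "principal_domain (subring_of K V)" using assms(1) unfolding is_DVR_def by auto
  then have "\<exists>a\<in>carrier (subring_of K V). V \<inter> pos = PIdl\<^bsub>subring_of K V\<^esub> a"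
    using principal_domain.exists_gen pos_ideal[OF V_dominated] by blast
  then obtain a where a: "a \<in> V" "V \<inter> pos = {r \<otimes> a | r. r \<in> V}" unfolding cgenideal_def by auto
  have ac: "a \<in> carrier K" using a V_eq by auto
  have le: "v a \<le> v z" if z: "z \<in> pos" for z
  proof -
    have "z \<in> V \<inter> pos" using z pos_sub by auto
    then obtain r where r: "z = r \<otimes> a" "r \<in> V" unfolding a(2) by auto
    then have "v z = v r + v a" "0 \<le> v r" using v_mult[of r a] ac V_eq by auto
    then show ?thesis using add_increasing[of "v r" "v a" "v a"] by simp
  qed
  have "\<one> \<otimes> a \<in> V \<inter> pos" unfolding a(2) using subringE(3)[OF V_subring] by blast
  then have "0 < v a" using ac unfolding pos_def by simp
  moreover obtain g where "v x = ereal g" using v_finite[of x] x unfolding pos_def by auto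
  moreover have "v a \<le> v x" by (rule le[OF x(1)])
  ultimately obtain c where "v a = ereal c" "0 < c" by (cases "v a") auto
  then show ?thesis using le by auto
qed

text \<open>For \<open>B\<close> inside \<open>V\<close> this is the localization of
  \<open>B\<close> at \<open>B \<inter> pos\<close>, written with cleared denominators instead of
  inverses; \<open>loc_eq\<close> identifies it with \<open>localize_at\<close>.\<close>

definition localized where "localized B = {z \<in> carrier K. \<exists>s\<in>B. v s = 0 \<and> s \<otimes> z \<in> B}"

lemma loc_eq:
  assumes B: "subring B K" "B \<subseteq> V"
  shows "localize_at K B (max_ideal (subring_of K V) \<inter> B) = localized B"
proof -
  have P: "max_ideal (subring_of K V) \<inter> B = pos \<inter> B"
    unfolding max_ideal_dominated[OF V_dominated] using pos_sub by auto
  have Bc: "B \<subseteq> carrier K" using subringE(1)[OF B(1)] .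
  show ?thesis unfolding P
  proof (intro equalityI subsetI)
    fix z assume "z \<in> localize_at K B (pos \<inter> B)"
    then obtain x y where xy: "z = x \<otimes> inv y" "x \<in> B" "y \<in> B" "y \<notin> pos" unfolding localize_at_def by auto
    have y: "v y = 0" "y \<noteq> \<zero>" "y \<in> carrier K" "x \<in> carrier K" using xy v_cases B(2) v_eq_zero Bc by auto
    have "y \<otimes> z = x \<otimes> (y \<otimes> inv y)" unfolding xy using y by (simp add: m_ac)
    then have "y \<otimes> z \<in> B" using xy y by simp
    then show "z \<in> localized B" unfolding localized_def using xy y by auto
  next
    fix z assume "z \<in> localized B"
    then obtain s where s: "z \<in> carrier K" "s \<in> B" "v s = 0" "s \<otimes> z \<in> B" unfolding localized_def by auto
    have y: "s \<noteq> \<zero>" "s \<in> carrier K" using s v_eq_zero Bc by auto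
    have "(s \<otimes> z) \<otimes> inv s = (s \<otimes> inv s) \<otimes> z" using s(1) y(2) inv_facts(1)[OF y(2,1)] by algebra
    then have "z = (s \<otimes> z) \<otimes> inv s" using s(1) y by simp
    then show "z \<in> localize_at K B (pos \<inter> B)" unfolding localize_at_def pos_def using s by force
  qed
qed

lemma loc_supset: assumes "subring B K" shows "B \<subseteq> localized B"
proof
  fix b assume "b \<in> B"
  then have "b \<in> carrier K" "\<one> \<in> B" "\<one> \<otimes> b \<in> B" using subringE(1,3,6)[OF assms] by auto
  then show "b \<in> localized B" unfolding localized_def by (auto intro!: bexI[of _ \<one>])
qed

lemma loc_dominated:
  assumes B: "subring B K" "B \<subseteq> V" shows "dominated (localized B)"
proof -
  note Bc = subsetD[OF subringE(1)[OF B(1)]]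
  have "subring (localized B) K"
  proof (rule subringI)
    show "localized B \<subseteq> carrier K" unfolding localized_def by auto
    show "\<one> \<in> localized B" using loc_supset[OF B(1)] subringE(3)[OF B(1)] by auto
    fix a assume "a \<in> localized B"
    then obtain s where s: "a \<in> carrier K" "s \<in> B" "v s = 0" "s \<otimes> a \<in> B" unfolding localized_def by auto
    have "s \<otimes> \<ominus> a = \<ominus> (s \<otimes> a)" using s Bc by (simp add: r_minus)
    then show "\<ominus> a \<in> localized B" unfolding localized_def using s subringE(5)[OF B(1)] by auto
    fix b assume "b \<in> localized B"
    then obtain t where t: "b \<in> carrier K" "t \<in> B" "v t = 0" "t \<otimes> b \<in> B" unfolding localized_def by auto
    have st: "s \<otimes> t \<in> B" "v (s \<otimes> t) = 0" using s t Bc v_mult subringE(6)[OF B(1)] by auto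
    have c: "s \<in> carrier K" "t \<in> carrier K" using s t Bc by auto
    have "(s \<otimes> t) \<otimes> (a \<otimes> b) = (s \<otimes> a) \<otimes> (t \<otimes> b)" using s(1) t(1) c by algebra
    also have "\<dots> \<in> B" using subringE(6)[OF B(1)] s t by auto
    finally show "a \<otimes> b \<in> localized B" unfolding localized_def using s(1) t(1) st by blast
    have "(s \<otimes> t) \<otimes> (a \<oplus> b) = t \<otimes> (s \<otimes> a) \<oplus> s \<otimes> (t \<otimes> b)" using s(1) t(1) c by algebra
    also have "\<dots> \<in> B" using subringE(6,7)[OF B(1)] s t by auto
    finally show "a \<oplus> b \<in> localized B" unfolding localized_def using s(1) t(1) st by blast
  qed
  moreover have "localized B \<subseteq> V"
  proof
    fix a assume "a \<in> localized B"
    then obtain s where s: "a \<in> carrier K" "s \<in> B" "v s = 0" "s \<otimes> a \<in> B" unfolding localized_def by auto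
    then have "0 \<le> v (s \<otimes> a)" using B(2) V_eq by auto
    then show "a \<in> V" using v_mult[of s a] s Bc unfolding V_eq by auto
  qed
  moreover have "inv a \<in> localized B" if a: "a \<in> localized B" "v a = 0" for a
  proof -
    obtain s where s: "a \<in> carrier K" "s \<in> B" "v s = 0" "s \<otimes> a \<in> B" using a unfolding localized_def by auto
    have "a \<noteq> \<zero>" using a s v_eq_zero by auto
    then have "(s \<otimes> a) \<otimes> inv a = s" using s Bc by (simp add: m_assoc)
    moreover have "v (s \<otimes> a) = 0" using v_mult[of s a] s a Bc by auto
    ultimately show ?thesis unfolding localized_def using s \<open>a \<noteq> \<zero>\<close> by (auto intro!: bexI[of _ "s \<otimes> a"])
  qed
  ultimately show ?thesis unfolding dominated_def by auto
qed

lemma loc_minimal: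
  assumes D: "dominated D" and "B \<subseteq> D" shows "localized B \<subseteq> D"
proof
  fix a assume "a \<in> localized B"
  then obtain s where s: "a \<in> carrier K" "s \<in> D" "v s = 0" "s \<otimes> a \<in> D" using assms(2) unfolding localized_def by auto
  have sc: "s \<in> carrier K" "s \<noteq> \<zero>" using dominatedD(4)[OF D] s v_eq_zero by auto
  then have "a = inv s \<otimes> (s \<otimes> a)" using s(1) by (simp add: m_assoc[symmetric])
  also have "\<dots> \<in> D" using subringE(6)[OF dominatedD(1)[OF D]] dominatedD(3)[OF D] s by auto
  finally show "a \<in> D" .
qed

text \<open>An ideal of the localization is generated by its contraction to
  \<open>B\<close>.\<close>

lemma loc_noetherian:
  assumes B: "subring B K" "B \<subseteq> V" and N: "noetherian_ring (subring_of K B)"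
  shows "noetherian_ring (subring_of K (localized B))"
proof -
  note C = loc_dominated[OF B] note Cs = dominatedD(1)[OF C] note BC = loc_supset[OF B(1)]
  show ?thesis unfolding noetherian_subring_iff[OF Cs]
  proof (intro allI impI)
    fix I assume I: "ideal I (subring_of K (localized B))"
    note I' = I[unfolded ideal_subring_iff[OF Cs]]
    have IB: "ideal (I \<inter> B) (subring_of K B)" unfolding ideal_subring_iff[OF B(1)]
      using I' BC subringE(2,6,7)[OF B(1)] by blast
    then obtain G where G: "G \<subseteq> B" "finite G" "I \<inter> B = Idl\<^bsub>subring_of K B\<^esub> G"
      using N unfolding noetherian_subring_iff[OF B(1)] by blast
    have GC: "G \<subseteq> localized B" using G BC by auto
    note Gi = genideal_subring[OF Cs GC] note Gi' = Gi(1)[unfolded ideal_subring_iff[OF Cs]]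
    have "G \<subseteq> I" using genideal_subring(2)[OF B(1) G(1)] G(3) by auto
    then have "Idl\<^bsub>subring_of K (localized B)\<^esub> G \<subseteq> I" by (rule Gi(3)[OF I])
    moreover have "I \<subseteq> Idl\<^bsub>subring_of K (localized B)\<^esub> G" (is "_ \<subseteq> ?T")
    proof
      fix z assume z: "z \<in> I"
      then obtain s where s: "z \<in> carrier K" "s \<in> B" "v s = 0" "s \<otimes> z \<in> B" using I' unfolding localized_def by auto
      have "ideal (?T \<inter> B) (subring_of K B)" unfolding ideal_subring_iff[OF B(1)]
        using Gi' BC subringE(2,6,7)[OF B(1)] by blast
      then have "I \<inter> B \<subseteq> ?T \<inter> B" unfolding G(3)
        by (rule genideal_subring(3)[OF B(1) G(1)]) (use Gi(2) G(1) in auto)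
      moreover have "s \<otimes> z \<in> I" using I' z s(2) BC by blast
      ultimately have "s \<otimes> z \<in> ?T" using s(4) by auto
      moreover have "inv s \<in> localized B" using dominatedD(3)[OF C] s BC by auto
      ultimately have "inv s \<otimes> (s \<otimes> z) \<in> ?T" using Gi' by blast
      moreover have "inv s \<otimes> (s \<otimes> z) = z"
        using s v_eq_zero subringE(1)[OF B(1)] by (subst m_assoc[symmetric]) auto
      ultimately show "z \<in> ?T" by simp
    qed
    ultimately show "\<exists>G\<subseteq>localized B. finite G \<and> I = Idl\<^bsub>subring_of K (localized B)\<^esub> G" using GC G(2) by auto
  qed
qed

definition extended_ideal where "extended_ideal B P = {z \<in> carrier K. \<exists>s\<in>B. v s = 0 \<and> s \<otimes> z \<in> P}"

text \<open>A prime inside \<open>pos\<close> contains no denominator, so contraction recovers it;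
  hence strict inclusions of such primes survive localization.\<close>

lemma ext_prime:
  assumes B: "subring B K" "B \<subseteq> V" and P: "primeideal P (subring_of K B)" "P \<subseteq> pos"
  shows "primeideal (extended_ideal B P) (subring_of K (localized B))" "extended_ideal B P \<inter> B = P"
proof -
  note C = loc_dominated[OF B] note Cs = dominatedD(1)[OF C] note BC = loc_supset[OF B(1)]
  note Bc = subsetD[OF subringE(1)[OF B(1)]]
  note P' = P(1)[unfolded prime_subring_iff[OF B(1)] ideal_subring_iff[OF B(1)]]
  have nP: "s \<notin> P" if "v s = 0" for s using that P(2) unfolding pos_def by auto
  show e: "extended_ideal B P \<inter> B = P"
  proof
    show "extended_ideal B P \<inter> B \<subseteq> P" unfolding extended_ideal_def using P' nP by blast
    have "p \<in> extended_ideal B P" if "p \<in> P" for p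
    proof -
      have "p \<in> B" using P' that by auto
      then have "p \<in> carrier K" "\<one> \<otimes> p \<in> P" using Bc that by auto
      then show ?thesis unfolding extended_ideal_def using subringE(3)[OF B(1)] by (auto intro!: bexI[of _ \<one>])
    qed
    then show "P \<subseteq> extended_ideal B P \<inter> B" using P' by auto
  qed
  show "primeideal (extended_ideal B P) (subring_of K (localized B))"
    unfolding prime_subring_iff[OF Cs] ideal_subring_iff[OF Cs]
  proof (intro conjI ballI impI)
    show "extended_ideal B P \<subseteq> localized B" using P' unfolding extended_ideal_def localized_def by blast
    show "\<zero> \<in> extended_ideal B P" "\<one> \<notin> extended_ideal B P" using e P' subringE(2,3)[OF B(1)] by blast+
    fix a assume "a \<in> extended_ideal B P"
    then obtain s where s: "a \<in> carrier K" "s \<in> B" "v s = 0" "s \<otimes> a \<in> P" unfolding extended_ideal_def by auto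
    { fix b assume "b \<in> extended_ideal B P"
      then obtain t where t: "b \<in> carrier K" "t \<in> B" "v t = 0" "t \<otimes> b \<in> P" unfolding extended_ideal_def by auto
      have st: "s \<otimes> t \<in> B" "v (s \<otimes> t) = 0" using s t Bc v_mult subringE(6)[OF B(1)] by auto
      have c: "s \<in> carrier K" "t \<in> carrier K" using s t Bc by auto
      have "(s \<otimes> t) \<otimes> (a \<oplus> b) = t \<otimes> (s \<otimes> a) \<oplus> s \<otimes> (t \<otimes> b)" using s(1) t(1) c by algebra
      also have "\<dots> \<in> P" using P' s t by blast
      finally show "a \<oplus> b \<in> extended_ideal B P" unfolding extended_ideal_def using s(1) t(1) st by blast }
    { fix b assume "b \<in> localized B"
      then obtain t where t: "b \<in> carrier K" "t \<in> B" "v t = 0" "t \<otimes> b \<in> B" unfolding localized_def by auto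
      have st: "s \<otimes> t \<in> B" "v (s \<otimes> t) = 0" using s t Bc v_mult subringE(6)[OF B(1)] by auto
      have c: "s \<in> carrier K" "t \<in> carrier K" using s t Bc by auto
      have "(s \<otimes> t) \<otimes> (b \<otimes> a) = (t \<otimes> b) \<otimes> (s \<otimes> a)" using s(1) t(1) c by algebra
      also have "\<dots> \<in> P" using P' s t by blast
      finally show "b \<otimes> a \<in> extended_ideal B P" unfolding extended_ideal_def using s(1) t(1) st by blast }
  next
    fix a b assume "a \<in> localized B" "b \<in> localized B" and ab: "a \<otimes> b \<in> extended_ideal B P"
    then obtain s t where s: "a \<in> carrier K" "s \<in> B" "v s = 0" "s \<otimes> a \<in> B"
      and t: "b \<in> carrier K" "t \<in> B" "v t = 0" "t \<otimes> b \<in> B" unfolding localized_def by auto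
    obtain u where u: "u \<in> B" "v u = 0" "u \<otimes> (a \<otimes> b) \<in> P" using ab unfolding extended_ideal_def by auto
    have c: "s \<in> carrier K" "t \<in> carrier K" "u \<in> carrier K" using s t u Bc by auto
    have "u \<otimes> ((s \<otimes> a) \<otimes> (t \<otimes> b)) = (s \<otimes> t) \<otimes> (u \<otimes> (a \<otimes> b))" using s(1) t(1) c by algebra
    also have "\<dots> \<in> P" using P' u subringE(6)[OF B(1) s(2) t(2)] by blast
    finally have "u \<otimes> ((s \<otimes> a) \<otimes> (t \<otimes> b)) \<in> P" .
    then have "(s \<otimes> a) \<otimes> (t \<otimes> b) \<in> P" using P' nP u subringE(6)[OF B(1) s(4) t(4)] by blast
    then show "a \<in> extended_ideal B P \<or> b \<in> extended_ideal B P" using P' s t unfolding extended_ideal_def by blast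
  qed
qed

text \<open>Regularity in the form in which it passes to the transforms. The generators bound the
  dimension from above and the chain bounds it from below; \<open>reg_parameters\<close> makes the
  results on parameters available.\<close>

definition regular_system where
  "regular_system A xs \<longleftrightarrow> dominated A \<and> noetherian_ring (subring_of K A) \<and> set xs \<subseteq> A \<and>
    A \<inter> pos = Idl\<^bsub>subring_of K A\<^esub> (set xs) \<and> (\<exists>p. prime_chain (subring_of K A) (length xs) p)"

lemma dominated_units:
  assumes A: "dominated A" and s: "s \<in> A" "s \<notin> A \<inter> pos" shows "s \<in> Units (subring_of K A)"
proof -
  have "v s = 0" using v_cases s dominatedD(2)[OF A] by auto
  then have "inv s \<in> A" "s \<noteq> \<zero>" using dominatedD(3)[OF A s(1)] v_eq_zero s dominatedD(4)[OF A] by auto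
  then show ?thesis unfolding Units_def using s dominatedD(4)[OF A] by (auto intro!: bexI[of _ "inv s"])
qed

lemma reg_parameters:
  assumes r: "regular_system A xs"
  shows "\<exists>p. regular_parameters (subring_of K A) (A \<inter> pos) xs p"
proof -
  have A: "dominated A" using r unfolding regular_system_def by auto
  have "noetherian_local (subring_of K A) (A \<inter> pos)"
  proof (intro noetherian_local.intro noetherian_cring.intro noetherian_local_axioms.intro)
    show "noetherian_ring (subring_of K A)" using r unfolding regular_system_def by auto
    show "cring (subring_of K A)" by (rule subring_cring[OF dominatedD(1)[OF A]])
  qed (use pos_prime[OF A] dominated_units[OF A] in auto)
  moreover obtain p where "prime_chain (subring_of K A) (length xs) p" using r unfolding regular_system_def by auto
  ultimately show ?thesis using r unfolding regular_system_def regular_parameters_def regular_parameters_axioms_def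
    by auto
qed

lemma parameter_nonzero:
  assumes r: "regular_system A xs" and x: "x \<in> set xs" shows "x \<in> A \<inter> pos" "x \<noteq> \<zero>"
proof -
  have As: "subring A K" and xs: "set xs \<subseteq> A" "A \<inter> pos = Idl\<^bsub>subring_of K A\<^esub> (set xs)"
    using r dominatedD(1) unfolding regular_system_def by auto
  show "x \<in> A \<inter> pos" using genideal_subring(2)[OF As xs(1)] x xs(2) by auto
  obtain us ws where uw: "xs = us @ x # ws" using x by (meson split_list)
  obtain p where "regular_parameters (subring_of K A) (A \<inter> pos) xs p" using reg_parameters[OF r] by auto
  then interpret RP: regular_parameters "subring_of K A" "A \<inter> pos" xs p .
  have "x \<notin> Idl\<^bsub>subring_of K A\<^esub> {}" using RP.prefix_strict[of "[]" x "us @ ws"] uw by auto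
  moreover have "\<zero> \<in> Idl\<^bsub>subring_of K A\<^esub> {}" using genideal_subring(1)[OF As, of "{}"]
    unfolding ideal_subring_iff[OF As] by auto
  ultimately show "x \<noteq> \<zero>" by auto
qed

end

section \<open>Quadratic transforms of regular local rings\<close>

context field
begin

text \<open>Adjoining \<open>w = y / x\<close> where \<open>y\<close> is a prime element of \<open>A\<close> not dividing \<open>x\<close>: the only
  relations are multiples of \<open>x w = y\<close>.\<close>

context
  fixes A x y w
  assumes A: "subring A R" and xA: "x \<in> A" and yA: "y \<in> A" and w: "w \<in> carrier R" and xw: "x \<otimes> w = y"
    and y_prime: "primeideal {r \<otimes> y | r. r \<in> A} (subring_of R A)" and xy: "x \<notin> {r \<otimes> y | r. r \<in> A}"
    and y0: "y \<noteq> \<zero>"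
begin

lemma elements: "x \<in> carrier R" "y \<in> carrier R" "w \<noteq> \<zero>" "x \<noteq> \<zero>"
proof -
  show x: "x \<in> carrier R" and "y \<in> carrier R" using xA yA subringE(1)[OF A] by auto
  show "w \<noteq> \<zero>" "x \<noteq> \<zero>" using xw y0 x w by auto
qed

lemma denominators: "f \<in> poly_in A w n \<Longrightarrow> x [^] n \<otimes> f \<in> A"
proof (induction n arbitrary: f)
  case 0
  then show ?case using subringE(2)[OF A] by simp
next
  case (Suc n)
  then obtain a f' where *: "f = a \<oplus> w \<otimes> f'" "a \<in> A" "f' \<in> poly_in A w n" by auto
  have c: "a \<in> carrier R" "f' \<in> carrier R" "x [^] n \<in> carrier R"
    using * subringE(1)[OF A] poly_in_carrier[OF A whole_ideal[OF A] w] elements by auto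
  have xn: "x [^] n \<in> A" for n :: nat by (induction n) (use subringE(3,6)[OF A] xA in auto)
  have "x [^] Suc n \<otimes> f = x [^] Suc n \<otimes> a \<oplus> (x \<otimes> w) \<otimes> (x [^] n \<otimes> f')" unfolding * nat_pow_Suc
    using c elements(1) w by algebra
  then have "x [^] Suc n \<otimes> f = x [^] Suc n \<otimes> a \<oplus> y \<otimes> (x [^] n \<otimes> f')" unfolding xw .
  then show ?case using subringE(6,7)[OF A] Suc.IH[OF *(3)] * yA xn[of "Suc n"] by simp
qed

text \<open>Multiplication by \<open>x^(n + 1)\<close> clears the denominators of \<open>f\<close>
  and gives \<open>x^(n + 1) a \<in> y A\<close>. As \<open>y\<close> is prime and does not divide
  \<open>x\<close>, it divides \<open>a\<close>.\<close>

lemma relation: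
  assumes a: "a \<in> A" and f: "f \<in> polys_in A w" and e: "a \<oplus> w \<otimes> f = \<zero>"
  shows "\<exists>c\<in>A. a = c \<otimes> y \<and> f = \<ominus> (c \<otimes> x)"
proof -
  define P where "P = {r \<otimes> y | r. r \<in> A}"
  note Pp = y_prime[folded P_def, unfolded prime_subring_iff[OF A] ideal_subring_iff[OF A]]
  note xP = xy[folded P_def]
  note Ac = subsetD[OF subringE(1)[OF A]]
  obtain n where n: "f \<in> poly_in A w n" using f unfolding polys_in_def by auto
  have fc: "f \<in> carrier R" using poly_in_carrier[OF A whole_ideal[OF A] w n] .
  have ac: "a \<in> carrier R" using a Ac by auto
  have "x [^] Suc n \<otimes> a = x [^] Suc n \<otimes> (a \<oplus> w \<otimes> f) \<oplus> (\<ominus> (x [^] n \<otimes> f)) \<otimes> (x \<otimes> w)"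
    unfolding nat_pow_Suc using ac fc w elements(1) nat_pow_closed[OF elements(1), of n] by algebra
  also have "\<dots> = (\<ominus> (x [^] n \<otimes> f)) \<otimes> y" unfolding e xw using elements fc by simp
  also have "\<dots> \<in> P" unfolding P_def using denominators[OF n] subringE(5)[OF A] by auto
  finally have xa: "x [^] Suc n \<otimes> a \<in> P" .
  have "x [^] m \<otimes> a \<in> P \<Longrightarrow> a \<in> P" for m :: nat
  proof (induction m)
    case (Suc m)
    have xm: "x [^] m \<in> A" for m :: nat by (induction m) (use subringE(3,6)[OF A] xA in auto)
    have "x \<otimes> (x [^] m \<otimes> a) = x [^] Suc m \<otimes> a" using elements(1) ac by (simp add: m_ac)
    then have "x \<otimes> (x [^] m \<otimes> a) \<in> P" using Suc.prems by simp
    then have "x [^] m \<otimes> a \<in> P" using Pp xA xP subringE(6)[OF A xm a] by blast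
    then show ?case by (rule Suc.IH)
  qed (use ac in simp)
  then obtain c where c: "c \<in> A" "a = c \<otimes> y" using xa unfolding P_def by blast
  have cc: "c \<in> carrier R" using c Ac by auto
  have "w \<otimes> (f \<oplus> c \<otimes> x) = c \<otimes> (x \<otimes> w) \<oplus> w \<otimes> f" using fc cc w elements(1) by algebra
  also have "\<dots> = \<zero>" using e unfolding xw c(2) .
  finally have "f \<oplus> c \<otimes> x = \<zero>" using integral_iff w fc cc elements by simp
  then have "f = \<ominus> (c \<otimes> x)" using fc cc elements(1) by (metis m_closed minus_equality)
  then show ?thesis using c by auto
qed

context
  fixes J
  assumes J: "ideal J (subring_of R A)" and xJ: "x \<in> J" and yJ: "y \<in> J"
begin

lemma J_facts: "J \<subseteq> A" "J \<subseteq> carrier R" "\<zero> \<in> J" "a \<in> J \<Longrightarrow> b \<in> J \<Longrightarrow> a \<oplus> b \<in> J" "r \<in> A \<Longrightarrow> a \<in> J \<Longrightarrow> r \<otimes> a \<in> J"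
  using J subringE(1)[OF A] unfolding ideal_subring_iff[OF A] by auto

lemma polys_J_sub: "polys_in J w \<subseteq> polys_in A w"
  using polys_in_mono J_facts(1) by auto

text \<open>Two representations of an element differ by a multiple of the relation
  \<open>x w = y\<close>, and both \<open>x\<close> and \<open>y\<close> are in \<open>J\<close>. So
  coefficients are well defined modulo \<open>J\<close>: the quotient of \<open>A[w]\<close> by
  \<open>J A[w]\<close> is a polynomial ring over \<open>A / J\<close>.\<close>

lemma polys_extract:
  assumes a: "a \<in> A" and f: "f \<in> polys_in A w" and m: "a \<oplus> w \<otimes> f \<in> polys_in J w"
  shows "a \<in> J" "f \<in> polys_in J w"
proof -
  note B = polys_in_subring[OF A w]
  obtain b g where bg: "b \<in> J" "g \<in> polys_in J w" "a \<oplus> w \<otimes> f = b \<oplus> w \<otimes> g"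
    using polys_in_cases[OF A J w m] by metis
  have c: "a \<in> carrier R" "b \<in> carrier R" "f \<in> carrier R" "g \<in> carrier R"
    using a bg f J_facts subringE(1)[OF A] subringE(1)[OF B] polys_J_sub by auto
  have "(a \<ominus> b) \<oplus> w \<otimes> (f \<ominus> g) = (a \<oplus> w \<otimes> f) \<ominus> (b \<oplus> w \<otimes> g)" using c w by algebra
  also have "\<dots> = \<zero>" unfolding bg(3) using c w by simp
  finally have e: "(a \<ominus> b) \<oplus> w \<otimes> (f \<ominus> g) = \<zero>" .
  have "a \<ominus> b \<in> A" unfolding a_minus_def using subringE(5,7)[OF A] a bg J_facts(1) by auto
  moreover have "f \<ominus> g \<in> polys_in A w" unfolding a_minus_def using subringE(5,7)[OF B] f bg polys_J_sub by auto
  ultimately obtain d where d: "d \<in> A" "a \<ominus> b = d \<otimes> y" "f \<ominus> g = \<ominus> (d \<otimes> x)" using relation e by blast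
  have dc: "d \<in> carrier R" using d subringE(1)[OF A] by auto
  have "a = d \<otimes> y \<oplus> b" unfolding d(2)[symmetric] using c by algebra
  then show "a \<in> J" using J_facts(4,5) d bg yJ by auto
  have "f = (f \<ominus> g) \<oplus> g" using c by algebra
  then have "f = \<ominus> (d \<otimes> x) \<oplus> g" unfolding d(3) .
  moreover have "\<ominus> (d \<otimes> x) \<in> J" using subring_ideal_neg[OF A J] J_facts(5) d xJ by auto
  ultimately show "f \<in> polys_in J w" using polys_in_add[OF A J w polys_in_coeff[OF A J w]] bg by auto
qed

lemma polys_inter: "polys_in J w \<inter> A = J"
proof
  show "polys_in J w \<inter> A \<subseteq> J"
  proof
    fix a assume a: "a \<in> polys_in J w \<inter> A"
    then have "a = a \<oplus> w \<otimes> \<zero>" using subringE(1)[OF A] w by auto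
    then show "a \<in> J" using polys_extract(1)[of a \<zero>] a polys_in_zero[OF A whole_ideal[OF A] w] by auto
  qed
  show "J \<subseteq> polys_in J w \<inter> A" using J_facts(1) polys_in_coeff[OF A J w] by auto
qed

lemma polys_monic:
  "g \<in> poly_in A w n \<Longrightarrow> w [^] n \<oplus> g \<in> polys_in J w \<Longrightarrow> \<one> \<in> J"
proof (induction n arbitrary: g)
  case 0
  then show ?case using polys_inter subringE(3)[OF A] by auto
next
  case (Suc n)
  note AA = whole_ideal[OF A]
  from Suc.prems obtain a f where *: "g = a \<oplus> w \<otimes> f" "a \<in> A" "f \<in> poly_in A w n" by auto
  have c: "a \<in> carrier R" "f \<in> carrier R" "w [^] n \<in> carrier R"
    using * subringE(1)[OF A] poly_in_carrier[OF A AA w] w by auto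
  have "w [^] Suc n \<oplus> g = a \<oplus> w \<otimes> (w [^] n \<oplus> f)" unfolding * nat_pow_Suc using c w by algebra
  moreover have "w [^] n \<oplus> f \<in> polys_in A w"
  proof -
    have "\<one> \<otimes> w [^] n \<in> polys_in A w"
      using poly_in_monomial[OF A AA w subringE(3)[OF A], of n] unfolding polys_in_def by blast
    then show ?thesis using polys_in_add[OF A AA w] *(3) c(3) unfolding polys_in_def by auto
  qed
  ultimately have "w [^] n \<oplus> f \<in> polys_in J w" using polys_extract(2)[OF *(2)] Suc.prems(2) by simp
  then show ?case using Suc.IH *(3) by auto
qed

text \<open>A polynomial ring over the domain \<open>A / J\<close> is a domain. The product of the
  constant coefficients is in \<open>J\<close>, so one of them is; it is split off, which shortens
  that factor.\<close>

lemma polys_prime: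
  assumes Jp: "primeideal J (subring_of R A)"
  shows "primeideal (polys_in J w) (subring_of R (polys_in A w))"
proof -
  note AA = whole_ideal[OF A]
  note B = polys_in_subring[OF A w]
  note Bc = subsetD[OF subringE(1)[OF B]] note Ac = subsetD[OF subringE(1)[OF A]]
  note P = Jp[unfolded prime_subring_iff[OF A]]
  let ?PJ = "polys_in J w"
  note PJ_neg = subringE(5)[OF B]
  have pi: "ideal ?PJ (subring_of R (polys_in A w))"
    unfolding ideal_subring_iff[OF B]
    using polys_J_sub polys_in_zero[OF A J w] polys_in_add[OF A J w] polys_in_mult[OF A J w] by blast
  have step: "f' \<otimes> g \<in> ?PJ" if "a \<in> J" "f' \<in> polys_in A w" "g \<in> polys_in A w" "(a \<oplus> w \<otimes> f') \<otimes> g \<in> ?PJ" for a f' g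
  proof -
    have c: "a \<in> carrier R" "f' \<in> carrier R" "g \<in> carrier R" using that Bc J_facts(2) by auto
    have "g \<otimes> a \<in> ?PJ" using polys_in_mult[OF A J w that(3)] polys_in_coeff[OF A J w that(1)] by auto
    then have "\<ominus> (g \<otimes> a) \<in> ?PJ" by (rule subring_ideal_neg[OF B pi])
    then have "(a \<oplus> w \<otimes> f') \<otimes> g \<oplus> \<ominus> (g \<otimes> a) \<in> ?PJ" by (rule polys_in_add[OF A J w that(4)])
    moreover have "(a \<oplus> w \<otimes> f') \<otimes> g \<oplus> \<ominus> (g \<otimes> a) = \<zero> \<oplus> w \<otimes> (f' \<otimes> g)" using c w by algebra
    ultimately show ?thesis
      using polys_extract(2)[OF subringE(2)[OF A], of "f' \<otimes> g"] subringE(6)[OF B that(2,3)] by simp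
  qed
  have main: "f \<in> poly_in A w m \<Longrightarrow> g \<in> poly_in A w n \<Longrightarrow> f \<otimes> g \<in> ?PJ \<Longrightarrow> f \<in> ?PJ \<or> g \<in> ?PJ" for f g m n
  proof (induction "m + n" arbitrary: f g m n rule: less_induct)
    case less
    show ?case
    proof (cases "m = 0 \<or> n = 0")
      case True
      then show ?thesis using less.prems polys_in_zero[OF A J w] by auto
    next
      case False
      then obtain m' n' where mn: "m = Suc m'" "n = Suc n'" by (meson not0_implies_Suc)
      from less.prems(1)[unfolded mn] obtain a f' where f: "f = a \<oplus> w \<otimes> f'" "a \<in> A" "f' \<in> poly_in A w m'" by auto
      from less.prems(2)[unfolded mn] obtain b g' where g: "g = b \<oplus> w \<otimes> g'" "b \<in> A" "g' \<in> poly_in A w n'" by auto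
      have B': "f' \<in> polys_in A w" "g' \<in> polys_in A w" "f \<in> polys_in A w" "g \<in> polys_in A w"
        using f(3) g(3) less.prems unfolding polys_in_def by auto
      have c: "a \<in> carrier R" "f' \<in> carrier R" "b \<in> carrier R" "g' \<in> carrier R" using f(2) g(2) B' Bc Ac by auto
      have "f \<otimes> g = a \<otimes> b \<oplus> w \<otimes> (a \<otimes> g' \<oplus> b \<otimes> f' \<oplus> w \<otimes> (f' \<otimes> g'))" unfolding f g using c w by algebra
      moreover have "a \<otimes> g' \<oplus> b \<otimes> f' \<oplus> w \<otimes> (f' \<otimes> g') \<in> polys_in A w"
        by (intro subringE(6,7)[OF B] B') (use f(2) g(2) polys_in_gen[OF A w] in auto)
      ultimately have "a \<otimes> b \<in> J" using polys_extract(1)[OF subringE(6)[OF A f(2) g(2)]] less.prems(3) by simp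
      then have "a \<in> J \<or> b \<in> J" using P f(2) g(2) by blast
      then show ?thesis
      proof
        assume a: "a \<in> J"
        have "f' \<otimes> g \<in> ?PJ" by (rule step[OF a B'(1,4)]) (use less.prems(3) f(1) in simp)
        then have "f' \<in> ?PJ \<or> g \<in> ?PJ" using less.hyps[OF _ f(3) less.prems(2)] mn by auto
        then show ?thesis using polys_in_horner[OF A J w a] f(1) by auto
      next
        assume b: "b \<in> J"
        have "g \<otimes> f \<in> ?PJ" using less.prems(3) m_comm B' Bc by metis
        then have "g' \<otimes> f \<in> ?PJ" using step[OF b B'(2,3)] g(1) by simp
        then have "f \<otimes> g' \<in> ?PJ" using m_comm B' Bc by metis
        then have "f \<in> ?PJ \<or> g' \<in> ?PJ" using less.hyps[OF _ less.prems(1) g(3)] mn by auto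
        then show ?thesis using polys_in_horner[OF A J w b] g(1) by auto
      qed
    qed
  qed
  show ?thesis unfolding prime_subring_iff[OF B]
  proof (intro conjI pi ballI impI)
    show "\<one> \<notin> ?PJ" using polys_inter subringE(3)[OF A] P by blast
    show "f \<in> ?PJ \<or> g \<in> ?PJ" if "f \<in> polys_in A w" "g \<in> polys_in A w" "f \<otimes> g \<in> ?PJ" for f g
      using that main unfolding polys_in_def[of A] by blast
  qed
qed

end
end
end

section \<open>Monoidal transforms preserve regularity\<close>

context valued_field
begin

lemma monoidal_step:
  assumes regular_system: "regular_system A (x # y # zs)" and le: "v x \<le> v y"
    and alg: "\<exists>n. \<exists>g\<in>poly_in A (y \<otimes> inv x) n. (y \<otimes> inv x) [^] n \<oplus> g \<in> pos"
  shows "\<exists>f. regular_system (localized (polys_in A (y \<otimes> inv x))) (x # zs @ [f])"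
proof -
  have Ad: "dominated A" using regular_system unfolding regular_system_def by auto
  note A = dominatedD(1)[OF Ad] note AA = whole_ideal[OF A] note Ac = subsetD[OF subringE(1)[OF A]]
  let ?A = "subring_of K A" let ?M = "A \<inter> pos"
  obtain p where "regular_parameters ?A ?M (x # y # zs) p" using reg_parameters[OF regular_system] by auto
  then interpret RP: regular_parameters ?A ?M "x # y # zs" p .
  have in_A: "x \<in> A" "y \<in> A" "set zs \<subseteq> A" using RP.xs(1) by auto
  have Mgen: "?M = Idl\<^bsub>?A\<^esub> (set (x # y # zs))" using RP.xs(2) .
  have in_M: "x \<in> ?M" "y \<in> ?M" "set zs \<subseteq> ?M"
    using genideal_subring(2)[OF A, of "set (x # y # zs)"] in_A unfolding Mgen by auto
  have x0: "x \<noteq> \<zero>" and y0: "y \<noteq> \<zero>" using parameter_nonzero[OF regular_system] by auto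
  have y_prime: "primeideal {r \<otimes> y | r. r \<in> A} ?A"
    using RP.prefix_prime[of "[y]" "x # zs"] genideal_single[OF A in_A(2)] by auto
  have xy: "x \<notin> {r \<otimes> y | r. r \<in> A}"
    using RP.prefix_strict[of "[y]" x "zs"] genideal_single[OF A in_A(2)] by auto
  define w where "w = y \<otimes> inv x"
  have xc: "x \<in> carrier K" and yc: "y \<in> carrier K" using in_A Ac by auto
  have w: "w \<in> carrier K" unfolding w_def using xc yc x0 by simp
  have "x \<otimes> w = y \<otimes> (x \<otimes> inv x)" unfolding w_def using xc yc inv_facts(1)[OF xc x0] by algebra
  then have xw: "x \<otimes> w = y" using xc yc x0 by simp
  have wV: "w \<in> V"
  proof -
    obtain r s where "v x = ereal r" "v w = ereal s"
      using v_finite[OF xc x0] v_finite[OF w] xw y0 xc by (metis r_null)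
    moreover have "v y = v x + v w" using v_mult[OF xc w] xw by simp
    ultimately show ?thesis using le w unfolding V_eq by auto
  qed
  note ctx = A in_A(1,2) w xw y_prime xy y0
  define B where "B = polys_in A w"
  have B: "subring B K" unfolding B_def by (rule polys_in_subring[OF A w])
  have BV: "B \<subseteq> V" unfolding B_def by (rule polys_in_minimal[OF V_subring dominatedD(2)[OF Ad] wV])
  have AB: "A \<subseteq> B" "w \<in> B" using polys_in_gen[OF A w] unfolding B_def by auto
  note Bc = subsetD[OF subringE(1)[OF B]]
  define C where "C = localized B"
  have C: "dominated C" unfolding C_def by (rule loc_dominated[OF B BV])
  note Cs = dominatedD(1)[OF C]
  have BC: "B \<subseteq> C" unfolding C_def by (rule loc_supset[OF B])
  have noeth: "noetherian_ring (subring_of K C)" unfolding C_def B_def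
    by (intro loc_noetherian hilbert_basis A w) (use B BV regular_system in \<open>auto simp: B_def regular_system_def\<close>)

  have poly_pos: "polys_in J w \<subseteq> pos" if "J \<subseteq> pos" for J
  proof -
    have "poly_in J w n \<subseteq> pos" for n
    proof (induction n)
      case (Suc n)
      have "a \<oplus> w \<otimes> f \<in> pos" if "a \<in> J" "f \<in> poly_in J w n" for a f
        by (intro pos_add pos_mult wV) (use that Suc \<open>J \<subseteq> pos\<close> in auto)
      then show ?case by auto
    qed (auto simp: pos_def)
    then show ?thesis unfolding polys_in_def by auto
  qed

  \<comment> \<open>Elements of \<open>A\<close> outside \<open>pos\<close> are units, so among the
    polynomials that vanish at the residue of \<open>w\<close> one of least degree can be taken
    monic; its degree is the degree of the residue of \<open>w\<close> over the residue field of
    \<open>A\<close>.\<close>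
  define n where "n = (LEAST n. \<exists>g\<in>poly_in A w n. w [^] n \<oplus> g \<in> pos)"
  have "\<exists>g\<in>poly_in A w n. w [^] n \<oplus> g \<in> pos" unfolding n_def
    by (rule LeastI_ex) (use alg w_def in auto)
  then obtain g where g: "g \<in> poly_in A w n" "w [^] n \<oplus> g \<in> pos" by auto
  have least: "w [^] k \<oplus> g' \<notin> pos" if "g' \<in> poly_in A w k" "k < n" for k g'
    using not_less_Least[of k "\<lambda>n. \<exists>g\<in>poly_in A w n. w [^] n \<oplus> g \<in> pos"] that unfolding n_def by blast
  define f where "f = w [^] n \<oplus> g"
  have wnB: "w [^] m \<in> B" for m :: nat by (induction m) (use subringE(3,6)[OF B] AB in auto)
  have fB: "f \<in> B" unfolding f_def using subringE(7)[OF B wnB] g(1) unfolding B_def polys_in_def by auto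
  have fpos: "f \<in> pos" using g f_def by simp

  define gens where "gens = set (x # zs @ [f])"
  have gensC: "gens \<subseteq> C" unfolding gens_def using in_A AB fB BC by auto
  note T = genideal_subring[OF Cs gensC]
  let ?T = "Idl\<^bsub>subring_of K C\<^esub> gens"
  note T' = T(1)[unfolded ideal_subring_iff[OF Cs]]
  have gensT: "x \<in> ?T" "set zs \<subseteq> ?T" "f \<in> ?T" using T(2) unfolding gens_def by auto
  have "w \<otimes> x \<in> ?T" using T' gensT AB BC by blast
  then have "y \<in> ?T" using xw m_comm xc w by simp
  have MT: "?M \<subseteq> ?T"
  proof -
    have "ideal (?T \<inter> A) ?A" unfolding ideal_subring_iff[OF A]
      using T' AB BC subringE(2,6,7)[OF A] by blast
    then have "Idl\<^bsub>?A\<^esub> (set (x # y # zs)) \<subseteq> ?T \<inter> A"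
      by (intro genideal_subring(3)[OF A]) (use in_A gensT \<open>y \<in> ?T\<close> in auto)
    then show ?thesis unfolding Mgen by auto
  qed
  \<comment> \<open>Division by \<open>f\<close> inside \<open>A[w]\<close>. In degree below
    \<open>n\<close> minimality forces the leading coefficient into \<open>pos\<close>, hence into
    the ideal of the old parameters; from degree \<open>n\<close> on a multiple of \<open>f\<close>
    removes the leading term.\<close>
  have poly_T: "b \<in> poly_in A w k \<Longrightarrow> b \<in> pos \<Longrightarrow> b \<in> ?T" for b k
  proof (induction k arbitrary: b)
    case 0
    then show ?case using T' by auto
  next
    case (Suc k)
    obtain a h where ah: "a \<in> A" "h \<in> poly_in A w k" "b = a \<otimes> w [^] k \<oplus> h"
      using poly_in_lead[OF A AA w Suc.prems(1)] by auto
    have c: "a \<in> carrier K" "h \<in> carrier K" "w [^] k \<in> carrier K" "g \<in> carrier K" "b \<in> carrier K"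
      using ah Ac poly_in_carrier[OF A AA w] w g(1) Suc.prems by auto
    have hB: "h \<in> B" using ah(2) unfolding B_def polys_in_def by auto
    show ?case
    proof (cases "k < n")
      case True
      have "a \<in> pos"
      proof (rule ccontr)
        assume "a \<notin> pos"
        then have "v a = 0" using v_cases ah(1) dominatedD(2)[OF Ad] by auto
        then have ia: "inv a \<in> A" "a \<noteq> \<zero>" using dominatedD(3)[OF Ad ah(1)] v_eq_zero c by auto
        then have iac: "inv a \<in> carrier K" using Ac by auto
        have "inv a \<otimes> b = (inv a \<otimes> a) \<otimes> w [^] k \<oplus> inv a \<otimes> h" unfolding ah(3) using c iac by algebra
        then have "inv a \<otimes> b = w [^] k \<oplus> inv a \<otimes> h" using c ia by simp
        moreover have "inv a \<otimes> b \<in> pos" using pos_mult[OF _ Suc.prems(2)] ia(1) dominatedD(2)[OF Ad] by auto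
        ultimately show False using least[OF poly_in_smult[OF A AA w ia(1) ah(2)] True] by simp
      qed
      then have "a \<in> ?T" using MT ah(1) by auto
      then have 1: "w [^] k \<otimes> a \<in> ?T" using T' wnB BC by blast
      have "w [^] k \<otimes> a \<in> pos" using pos_mult \<open>a \<in> pos\<close> wnB BV by auto
      then have "\<ominus> (w [^] k \<otimes> a) \<in> pos" using v_neg unfolding pos_def by auto
      then have "b \<oplus> \<ominus> (w [^] k \<otimes> a) \<in> pos" using pos_add Suc.prems by auto
      moreover have "b \<oplus> \<ominus> (w [^] k \<otimes> a) = h" unfolding ah(3) using c by algebra
      ultimately have "h \<in> ?T" using Suc.IH[OF ah(2)] by simp
      then have "w [^] k \<otimes> a \<oplus> h \<in> ?T" using T' 1 by blast
      then show ?thesis unfolding ah(3) using m_comm c by simp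
    next
      case False
      define m where "m = k - n"
      have km: "w [^] k = w [^] m \<otimes> w [^] n" using nat_pow_mult[OF w, of m n] False unfolding m_def by simp
      have cm: "w [^] m \<in> carrier K" "w [^] n \<in> carrier K" using w by auto
      have amf: "(a \<otimes> w [^] m) \<otimes> f \<in> ?T" using T' gensT(3) subringE(6)[OF B] ah(1) wnB AB BC by blast
      have "(a \<otimes> w [^] m) \<in> V" using subringE(6)[OF B _ wnB] ah(1) AB BV by auto
      then have "(a \<otimes> w [^] m) \<otimes> f \<in> pos" using pos_mult fpos by auto
      then have "\<ominus> ((a \<otimes> w [^] m) \<otimes> f) \<in> pos" using v_neg unfolding pos_def by auto
      then have bpos: "b \<oplus> \<ominus> ((a \<otimes> w [^] m) \<otimes> f) \<in> pos" using pos_add Suc.prems by auto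
      have e: "b \<oplus> \<ominus> ((a \<otimes> w [^] m) \<otimes> f) = h \<oplus> (\<ominus> a \<otimes> (w [^] m \<otimes> g))"
        unfolding ah(3) f_def km using c cm by algebra
      have "w [^] j \<otimes> g \<in> poly_in A w (j + n)" for j :: nat
      proof (induction j)
        case (Suc j)
        have "w [^] Suc j \<otimes> g = w \<otimes> (w [^] j \<otimes> g)" using w c by (simp add: m_ac)
        then show ?case using poly_in_shift[OF A AA w Suc] by simp
      qed (use g(1) c in simp)
      from this[of m] have "w [^] m \<otimes> g \<in> poly_in A w k" using False unfolding m_def by simp
      from poly_in_add[OF A AA w ah(2) poly_in_smult[OF A AA w subringE(5)[OF A ah(1)] this]]
      have "h \<oplus> (\<ominus> a \<otimes> (w [^] m \<otimes> g)) \<in> poly_in A w k" .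
      from Suc.IH[OF this] bpos have "b \<oplus> \<ominus> ((a \<otimes> w [^] m) \<otimes> f) \<in> ?T" unfolding e .
      then have "(a \<otimes> w [^] m) \<otimes> f \<oplus> (b \<oplus> \<ominus> ((a \<otimes> w [^] m) \<otimes> f)) \<in> ?T" using T' amf by blast
      moreover have "(a \<otimes> w [^] m) \<otimes> f \<oplus> (b \<oplus> \<ominus> ((a \<otimes> w [^] m) \<otimes> f)) = b"
        using c cm Bc[OF fB] by algebra
      ultimately show ?thesis by simp
    qed
  qed
  have gens_eq: "C \<inter> pos = ?T"
  proof
    show "?T \<subseteq> C \<inter> pos" by (rule T(3)[OF pos_ideal[OF C]]) (use gensC in_M fpos in \<open>auto simp: gens_def\<close>)
    show "C \<inter> pos \<subseteq> ?T"
    proof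
      fix z assume z: "z \<in> C \<inter> pos"
      then obtain s where s: "z \<in> carrier K" "s \<in> B" "v s = 0" "s \<otimes> z \<in> B" unfolding C_def localized_def by auto
      have "s \<otimes> z \<in> pos" using pos_mult z s BV by auto
      then have "s \<otimes> z \<in> ?T" using poly_T s(4) unfolding B_def polys_in_def by blast
      moreover have "inv s \<in> C" using dominatedD(3)[OF C] s BC by auto
      ultimately have "inv s \<otimes> (s \<otimes> z) \<in> ?T" using T' by blast
      moreover have "inv s \<otimes> (s \<otimes> z) = z"
        using s v_eq_zero Bc by (subst m_assoc[symmetric]) auto
      ultimately show "z \<in> ?T" by simp
    qed
  qed

  define l where "l = length zs"
  define J where "J i = Idl\<^bsub>?A\<^esub> (set (x # y # take i zs))" for i
  have Jsub: "set (x # y # take i zs) \<subseteq> A" for i using in_A set_take_subset[of i zs] by auto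
  note Ji = genideal_subring[OF A Jsub, folded J_def]
  have Jprime: "primeideal (J i) ?A" for i
    unfolding J_def using RP.prefix_prime[of "x # y # take i zs" "drop i zs"]
    by (simp flip: set_append length_append)
  have xyJ: "x \<in> J i" "y \<in> J i" for i using Ji(2)[of i] by auto
  have JM: "J i \<subseteq> ?M" for i using RP.prime_le_M[OF Jprime] .
  define P where "P i = extended_ideal B (polys_in (J i) w)" for i
  have PJpos: "polys_in (J i) w \<subseteq> pos" for i using poly_pos JM by auto
  have PJprime: "primeideal (polys_in (J i) w) (subring_of K B)" for i
    unfolding B_def by (rule polys_prime[OF ctx Ji(1) xyJ Jprime])
  have P1: "primeideal (P i) (subring_of K C)" and P2: "P i \<inter> B = polys_in (J i) w" for i
    unfolding P_def C_def using ext_prime[OF B BV PJprime PJpos] by auto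
  have P3: "P i \<inter> A = J i" for i using P2[of i] polys_inter[OF ctx Ji(1) xyJ, of i] AB by blast
  have P_strict: "P i \<subset> P (Suc i)" if "i < l" for i
  proof -
    have t: "take (Suc i) zs = take i zs @ [zs ! i]" using that unfolding l_def by (simp add: take_Suc_conv_app_nth)
    have "J i \<subseteq> J (Suc i)" by (rule Ji(3)[OF Ji(1)]) (use Ji(2)[of "Suc i"] t in auto)
    then have "P i \<subseteq> P (Suc i)" unfolding P_def extended_ideal_def using polys_in_mono by blast
    moreover have "zs ! i \<in> J (Suc i)" using Ji(2)[of "Suc i"] t by auto
    moreover have "zs ! i \<notin> J i"
    proof -
      have "(x # y # take i zs) @ zs ! i # drop (Suc i) zs = x # y # zs"
        using that unfolding l_def by (simp add: Cons_nth_drop_Suc)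
      then have "set ((x # y # take i zs) @ zs ! i # drop (Suc i) zs) = set (x # y # zs)"
        "length ((x # y # take i zs) @ zs ! i # drop (Suc i) zs) = length (x # y # zs)" by (simp_all only:)
      from RP.prefix_strict[OF this] show ?thesis unfolding J_def .
    qed
    ultimately show ?thesis using P3[of i] P3[of "Suc i"] by blast
  qed
  \<comment> \<open>Zero, the extensions of the primes generated by \<open>x\<close>,
    \<open>y\<close> and the first \<open>j\<close> of the \<open>zs\<close> for
    \<open>j = 0, ..., l\<close>, and the maximal ideal: \<open>l + 3\<close> primes for
    \<open>l + 2\<close> parameters. The last inclusion is strict because \<open>f\<close> is monic
    and \<open>P l\<close> contains no monic polynomial.\<close>
  define q where "q i = (case i of 0 \<Rightarrow> {\<zero>} | Suc j \<Rightarrow> if j \<le> l then P j else C \<inter> pos)" for i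
  have "prime_chain (subring_of K C) (Suc (Suc l)) q" unfolding prime_chain_def
  proof (intro conjI allI impI)
    fix i
    have "primeideal {\<zero>} (subring_of K C)"
      using domain.zeroprimeideal[OF subring_is_domain[OF Cs]] by simp
    then show "primeideal (q i) (subring_of K C)"
      unfolding q_def using P1 pos_prime[OF C] by (auto split: nat.split)
    assume i: "i < Suc (Suc l)"
    show "q i \<subset> q (Suc i)"
    proof (cases i)
      case 0
      have "x \<in> P 0" "\<zero> \<in> P 0" using P3[of 0] xyJ[of 0] Ji(1)[of 0] unfolding ideal_subring_iff[OF A] by blast+
      then show ?thesis unfolding q_def using 0 x0 by auto
    next
      case (Suc j)
      show ?thesis
      proof (cases "j < l")
        case True
        then show ?thesis unfolding q_def using Suc P_strict by auto
      next
        case False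
        then have j: "j = l" using i Suc by auto
        have "f \<notin> P l"
        proof
          assume "f \<in> P l"
          then have "f \<in> polys_in (J l) w" using P2 fB by blast
          then have "\<one> \<in> J l" using polys_monic[OF ctx Ji(1) xyJ g(1)] f_def by auto
          then show False using JM one_not_pos by auto
        qed
        moreover have "P l \<subseteq> C \<inter> pos" by (rule prime_le_pos[OF C P1])
        moreover have "f \<in> C \<inter> pos" using fB BC fpos by auto
        ultimately show ?thesis unfolding q_def using Suc j by auto
      qed
    qed
  qed
  then have "regular_system C (x # zs @ [f])"
    unfolding regular_system_def using C noeth gensC gens_eq unfolding gens_def l_def by auto
  then show ?thesis unfolding C_def B_def w_def by auto
qed

end

section \<open>Quadratic transforms as hulls inside the valuation ring\<close>

context valued_field
begin

definition dom_hull where "dom_hull S = localized (generate_ring K S)"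

lemma hull_facts:
  assumes S: "S \<subseteq> V"
  shows "dominated (dom_hull S)" "S \<subseteq> dom_hull S" "\<And>D. dominated D \<Longrightarrow> S \<subseteq> D \<Longrightarrow> dom_hull S \<subseteq> D"
proof -
  have Xc: "S \<subseteq> carrier K" using S V_eq by auto
  have g: "subring (generate_ring K S) K" by (rule generate_ring_is_subring[OF Xc])
  have gV: "generate_ring K S \<subseteq> V" by (rule generate_ring_min_subring1[OF Xc V_subring S])
  show "dominated (dom_hull S)" unfolding dom_hull_def by (rule loc_dominated[OF g gV])
  show "S \<subseteq> dom_hull S" unfolding dom_hull_def using loc_supset[OF g] generate_ring.incl[of _ S K] by auto
  show "dom_hull S \<subseteq> D" if "dominated D" "S \<subseteq> D" for D unfolding dom_hull_def
    by (rule loc_minimal[OF that(1)]) (rule generate_ring_min_subring1[OF Xc dominatedD(1)[OF that(1)] that(2)])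
qed

text \<open>Two transforms are compared by their universal property: it suffices that the same
  dominated rings contain the generators of either.\<close>

lemma hull_cong:
  assumes "S \<subseteq> V" "T \<subseteq> V" "\<And>D. dominated D \<Longrightarrow> S \<subseteq> D \<longleftrightarrow> T \<subseteq> D"
  shows "dom_hull S = dom_hull T"
  using hull_facts[OF assms(1)] hull_facts[OF assms(2)] assms(3) by (intro equalityI) blast+

lemma div_in_V:
  assumes "z \<in> carrier K" "a \<in> carrier K" "a \<noteq> \<zero>" "v a \<le> v z" shows "z \<otimes> inv a \<in> V"
proof -
  obtain r where r: "v a = ereal r" using v_finite assms by metis
  then have "0 \<le> v z - v a" using assms(4) by (cases "v z") auto
  then show ?thesis unfolding V_eq using v_div assms by auto
qed

lemma div_mult:
  assumes "z \<in> carrier K" "a \<in> carrier K" "a \<noteq> \<zero>" shows "(z \<otimes> inv a) \<otimes> a = z" "a \<otimes> (z \<otimes> inv a) = z"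
proof -
  show "(z \<otimes> inv a) \<otimes> a = z" using assms by (simp add: m_assoc)
  then show "a \<otimes> (z \<otimes> inv a) = z" using assms by (simp add: m_comm)
qed

lemma div_trans:
  assumes "z \<in> carrier K" "a \<in> carrier K" "a \<noteq> \<zero>" "b \<in> carrier K" "b \<noteq> \<zero>"
  shows "(z \<otimes> inv a) \<otimes> (a \<otimes> inv b) = z \<otimes> inv b"
  using assms by (simp add: m_assoc[symmetric]) (simp add: m_assoc)

definition min_element where
  "min_element A a \<longleftrightarrow> a \<in> A \<inter> pos \<and> a \<noteq> \<zero> \<and> (\<forall>z\<in>A \<inter> pos. v a \<le> v z)"

definition blowup where
  "blowup A a = dom_hull (A \<union> {x \<otimes> inv a | x. x \<in> A \<inter> pos})"

text \<open>That \<open>a\<close> generates the extension of the maximal ideal to \<open>V\<close>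
  means that \<open>a\<close> has least value in it; \<open>nz\<close> rules out
  \<open>a = 0\<close>.\<close>

lemma lqt_iff:
  assumes A: "dominated A" and nz: "\<exists>z\<in>A \<inter> pos. z \<noteq> \<zero>"
  shows "local_quadratic_transform K V A A' \<longleftrightarrow> (\<exists>a. min_element A a \<and> A' = blowup A a)"
proof -
  note VC = dominatedD(4)[OF V_dominated]
  have PV: "PIdl\<^bsub>subring_of K V\<^esub> a = {r \<otimes> a | r. r \<in> V}" for a unfolding cgenideal_def by simp
  have MV: "A \<inter> pos \<subseteq> V" using pos_sub by auto
  have min: "PIdl\<^bsub>subring_of K V\<^esub> a = Idl\<^bsub>subring_of K V\<^esub> (A \<inter> pos) \<longleftrightarrow> min_element A a" if a: "a \<in> A \<inter> pos" for a
  proof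
    have aV: "a \<in> V" "a \<in> carrier K" using a MV VC by auto
    assume "PIdl\<^bsub>subring_of K V\<^esub> a = Idl\<^bsub>subring_of K V\<^esub> (A \<inter> pos)"
    then have sub: "A \<inter> pos \<subseteq> {r \<otimes> a | r. r \<in> V}"
      using genideal_subring(2)[OF V_subring MV] unfolding PV by auto
    have "v a \<le> v z" if "z \<in> A \<inter> pos" for z
    proof -
      have "z \<in> {r \<otimes> a | r. r \<in> V}" using sub that by (rule subsetD)
      then obtain r where r: "z = r \<otimes> a" "r \<in> V" by blast
      then have "v z = v r + v a" "0 \<le> v r" using v_mult[of r a] aV VC V_eq by auto
      then show ?thesis using add_increasing[of "v r" "v a" "v a"] by simp
    qed
    moreover have "a \<noteq> \<zero>"
    proof
      assume "a = \<zero>"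
      have "z = \<zero>" if "z \<in> A \<inter> pos" for z
      proof -
        have "z \<in> {r \<otimes> a | r. r \<in> V}" using sub that by (rule subsetD)
        then show ?thesis using \<open>a = \<zero>\<close> VC by auto
      qed
      then show False using nz by auto
    qed
    ultimately show "min_element A a" unfolding min_element_def using a by auto
  next
    assume m: "min_element A a"
    have aV: "a \<in> V" "a \<in> carrier K" "a \<noteq> \<zero>" using a MV VC m unfolding min_element_def by auto
    have "A \<inter> pos \<subseteq> {r \<otimes> a | r. r \<in> V}"
    proof
      fix z assume z: "z \<in> A \<inter> pos"
      then have zc: "z \<in> carrier K" using MV VC by auto
      have "z \<otimes> inv a \<in> V" by (rule div_in_V[OF zc aV(2,3)]) (use m z in \<open>auto simp: min_element_def\<close>)
      then show "z \<in> {r \<otimes> a | r. r \<in> V}" using div_mult(1)[OF zc aV(2,3)] by force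
    qed
    then have "Idl\<^bsub>subring_of K V\<^esub> (A \<inter> pos) \<subseteq> {r \<otimes> a | r. r \<in> V}"
      using genideal_subring(3)[OF V_subring MV, of "Idl\<^bsub>subring_of K V\<^esub> {a}"]
        genideal_subring(1)[OF V_subring, of "{a}"] genideal_single[OF V_subring aV(1)] aV(1) by auto
    moreover have "Idl\<^bsub>subring_of K V\<^esub> {a} \<subseteq> Idl\<^bsub>subring_of K V\<^esub> (A \<inter> pos)"
      by (rule genideal_subring(3)[OF V_subring _ genideal_subring(1)[OF V_subring MV]])
        (use aV genideal_subring(2)[OF V_subring MV] a in auto)
    ultimately show "PIdl\<^bsub>subring_of K V\<^esub> a = Idl\<^bsub>subring_of K V\<^esub> (A \<inter> pos)"
      unfolding PV genideal_single[OF V_subring aV(1)] by auto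
  qed
  have bl: "localize_at K (generate_ring K (A \<union> {x \<otimes> inv a | x. x \<in> A \<inter> pos}))
      (max_ideal (subring_of K V) \<inter> generate_ring K (A \<union> {x \<otimes> inv a | x. x \<in> A \<inter> pos})) = blowup A a"
    if "min_element A a" for a
  proof -
    have a: "a \<in> carrier K" "a \<noteq> \<zero>" "\<And>z. z \<in> A \<inter> pos \<Longrightarrow> v a \<le> v z"
      using that MV VC unfolding min_element_def by auto
    have sub: "A \<union> {x \<otimes> inv a | x. x \<in> A \<inter> pos} \<subseteq> V"
      using dominatedD(2)[OF A] div_in_V[OF _ a(1,2) a(3)] VC MV by auto
    have "subring (generate_ring K (A \<union> {x \<otimes> inv a | x. x \<in> A \<inter> pos})) K"
      by (rule generate_ring_is_subring) (use sub VC in blast)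
    moreover have "generate_ring K (A \<union> {x \<otimes> inv a | x. x \<in> A \<inter> pos}) \<subseteq> V"
      by (rule generate_ring_min_subring1[OF _ V_subring sub]) (use sub VC in blast)
    ultimately show ?thesis unfolding blowup_def dom_hull_def by (rule loc_eq)
  qed
  show ?thesis
  proof
    assume "local_quadratic_transform K V A A'"
    then obtain a where a: "a \<in> A \<inter> pos" "PIdl\<^bsub>subring_of K V\<^esub> a = Idl\<^bsub>subring_of K V\<^esub> (A \<inter> pos)"
      "A' = localize_at K (generate_ring K (A \<union> {x \<otimes> inv a | x. x \<in> A \<inter> pos}))
      (max_ideal (subring_of K V) \<inter> generate_ring K (A \<union> {x \<otimes> inv a | x. x \<in> A \<inter> pos}))"
      unfolding local_quadratic_transform_def max_ideal_dominated[OF A] Let_def by blast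
    from a(2) have "min_element A a" unfolding min[OF a(1)] .
    with a(3) bl show "\<exists>a. min_element A a \<and> A' = blowup A a" by auto
  next
    assume "\<exists>a. min_element A a \<and> A' = blowup A a"
    then obtain a where a: "min_element A a" "A' = blowup A a" by blast
    then have am: "a \<in> A \<inter> pos" unfolding min_element_def by auto
    show "local_quadratic_transform K V A A'"
      unfolding local_quadratic_transform_def max_ideal_dominated[OF A] Let_def
      using am a(1)[folded min[OF am]] bl[OF a(1)] a(2) by blast
  qed
qed

lemma blowup_facts:
  assumes A: "dominated A" and a: "min_element A a"
  shows "A \<union> {x \<otimes> inv a | x. x \<in> A \<inter> pos} \<subseteq> V" "dominated (blowup A a)" "A \<subseteq> blowup A a"
    "z \<in> A \<inter> pos \<Longrightarrow> z \<otimes> inv a \<in> blowup A a"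
proof -
  have a': "a \<in> carrier K" "a \<noteq> \<zero>" "\<And>z. z \<in> A \<inter> pos \<Longrightarrow> v a \<le> v z"
    using a dominatedD(4)[OF A] unfolding min_element_def by auto
  show sub: "A \<union> {x \<otimes> inv a | x. x \<in> A \<inter> pos} \<subseteq> V"
    using dominatedD(2,4)[OF A] div_in_V[OF _ a'(1,2) a'(3)] by auto
  show "dominated (blowup A a)" "A \<subseteq> blowup A a" "z \<in> A \<inter> pos \<Longrightarrow> z \<otimes> inv a \<in> blowup A a"
    unfolding blowup_def using hull_facts[OF sub] by auto
qed

lemma ideal_value_min:
  assumes "min_element A a" shows "ideal_value v (A \<inter> pos) = v a"
  unfolding ideal_value_def using assms unfolding min_element_def
  by (intro antisym INF_greatest INF_lower) auto

text \<open>Algebraicity of the residue field of \<open>V\<close> over that of \<open>A\<close>,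
  expressed by monic polynomials of positive value so that no quotient ring appears. In this form it
  clearly passes to larger rings.\<close>

definition residually_algebraic where
  "residually_algebraic A \<longleftrightarrow> (\<forall>w\<in>V. \<exists>n. \<exists>g\<in>poly_in A w n. w [^] n \<oplus> g \<in> pos)"

lemma residually_algebraic_mono:
  assumes "residually_algebraic A" "A \<subseteq> B" shows "residually_algebraic B"
proof -
  have "poly_in A w n \<subseteq> poly_in B w n" for w n by (induction n) (use assms(2) in auto)
  then show ?thesis using assms(1) unfolding residually_algebraic_def by blast
qed

text \<open>Here \<open>ys\<close> are the parameters still to be divided by \<open>x\<close>, and
  \<open>fs\<close> those that arose from earlier divisions; each step moves one place from
  \<open>ys\<close> to \<open>fs\<close>.\<close>

lemma monoidal_steps:
  assumes "regular_system A (x # ys @ fs)" "\<forall>y\<in>set ys. v x \<le> v y" "residually_algebraic A"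
  shows "\<exists>fs'. length fs' = length (ys @ fs) \<and> regular_system (dom_hull (A \<union> {y \<otimes> inv x | y. y \<in> set ys})) (x # fs')"
  using assms
proof (induction ys arbitrary: A fs)
  case Nil
  then have A: "dominated A" unfolding regular_system_def by auto
  then have "dom_hull A = A" using hull_facts[of A] dominatedD(2)[OF A] by auto
  then show ?case using Nil by auto
next
  case (Cons y ys)
  then have A: "dominated A" and mem: "x \<in> A" "y \<in> A" "set ys \<subseteq> A" unfolding regular_system_def by auto
  note As = dominatedD(1)[OF A]
  define w where "w = y \<otimes> inv x"
  have x0: "x \<noteq> \<zero>" using parameter_nonzero[OF Cons.prems(1)] by auto
  have c: "x \<in> carrier K" "y \<in> carrier K" using mem dominatedD(4)[OF A] by auto
  have div: "z \<otimes> inv x \<in> V" if "z \<in> set (y # ys)" for z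
    using div_in_V[OF _ c(1) x0] that Cons.prems(2) mem dominatedD(4)[OF A] by auto
  have wV: "w \<in> V" and wc: "w \<in> carrier K" using div[of y] V_eq unfolding w_def by auto
  define A1 where "A1 = localized (polys_in A w)"
  obtain f where f: "regular_system A1 (x # (ys @ fs) @ [f])"
    using monoidal_step[of A x y "ys @ fs"] Cons.prems wV
    unfolding A1_def w_def residually_algebraic_def by auto
  have pV: "polys_in A w \<subseteq> V" by (rule polys_in_minimal[OF V_subring dominatedD(2)[OF A] wV])
  note ps = polys_in_subring[OF As wc]
  have A1: "dominated A1" unfolding A1_def by (rule loc_dominated[OF ps pV])
  have AA1: "A \<subseteq> A1" "w \<in> A1" using polys_in_gen[OF As wc] loc_supset[OF ps] unfolding A1_def by auto
  have A1min: "A1 \<subseteq> D" if "dominated D" "A \<subseteq> D" "w \<in> D" for D unfolding A1_def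
    by (rule loc_minimal[OF that(1) polys_in_minimal[OF dominatedD(1)[OF that(1)] that(2,3)]])
  have "dom_hull (A1 \<union> {y \<otimes> inv x | y. y \<in> set ys}) = dom_hull (A \<union> {y' \<otimes> inv x | y'. y' \<in> set (y # ys)})"
  proof (rule hull_cong)
    show "A1 \<union> {y \<otimes> inv x | y. y \<in> set ys} \<subseteq> V"
      "A \<union> {y' \<otimes> inv x | y'. y' \<in> set (y # ys)} \<subseteq> V"
      using dominatedD(2)[OF A] dominatedD(2)[OF A1] div by auto
    show "A1 \<union> {y \<otimes> inv x | y. y \<in> set ys} \<subseteq> D \<longleftrightarrow> A \<union> {y' \<otimes> inv x | y'. y' \<in> set (y # ys)} \<subseteq> D"
      if "dominated D" for D
      using A1min[OF that] AA1 unfolding w_def by auto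
  qed
  moreover have "\<exists>fs'. length fs' = length (ys @ fs @ [f]) \<and> regular_system (dom_hull (A1 \<union> {y \<otimes> inv x | y. y \<in> set ys})) (x # fs')"
    by (rule Cons.IH) (use f Cons.prems residually_algebraic_mono[OF _ AA1(1)] in auto)
  ultimately show ?case by auto
qed

text \<open>Otherwise the elements of value greater than \<open>v a\<close> form an ideal that
  contains all generators but not \<open>a\<close>.\<close>

lemma reg_min_generator:
  assumes r: "regular_system A xs" and a: "min_element A a"
  shows "\<exists>x\<in>set xs. v x = v a"
proof (rule ccontr)
  assume n: "\<not> ?thesis"
  have A: "dominated A" and xs: "set xs \<subseteq> A" "A \<inter> pos = Idl\<^bsub>subring_of K A\<^esub> (set xs)" using r unfolding regular_system_def by auto
  note As = dominatedD(1)[OF A] note Ac = dominatedD(4)[OF A]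
  have lt: "v a < v x" if "x \<in> set xs" for x
  proof -
    have "x \<in> A \<inter> pos" using that genideal_subring(2)[OF As xs(1)] xs(2) by auto
    then show ?thesis using n that a unfolding min_element_def by (metis antisym_conv2)
  qed
  have "ideal {z \<in> A. v a < v z} (subring_of K A)" unfolding ideal_subring_iff[OF As]
  proof (intro conjI ballI)
    obtain r where "v a = ereal r" using v_finite[of a] a Ac unfolding min_element_def by auto
    then show "\<zero> \<in> {z \<in> A. v a < v z}" using subringE(2)[OF As] by auto
    fix z assume z: "z \<in> {z \<in> A. v a < v z}"
    { fix y assume y: "y \<in> {z \<in> A. v a < v z}"
      have "v a < min (v z) (v y)" using y z by auto
      also have "\<dots> \<le> v (z \<oplus> y)" using v_add y z Ac by auto
      finally show "z \<oplus> y \<in> {z \<in> A. v a < v z}" using y z subringE(7)[OF As] by auto }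
    { fix y assume y: "y \<in> A"
      have "0 \<le> v y" using y dominatedD(2)[OF A] V_eq by auto
      have "v (y \<otimes> z) = v y + v z" using v_mult y z Ac by auto
      moreover have "v z \<le> v y + v z" using \<open>0 \<le> v y\<close> by (simp add: add_increasing)
      ultimately have "v a < v (y \<otimes> z)" using z by auto
      then show "y \<otimes> z \<in> {z \<in> A. v a < v z}" using y z subringE(6)[OF As] by auto }
  qed auto
  then have "A \<inter> pos \<subseteq> {z \<in> A. v a < v z}" unfolding xs(2)
    by (rule genideal_subring(3)[OF As xs(1)]) (use lt xs in auto)
  then show False using a unfolding min_element_def by auto
qed

text \<open>The element \<open>a\<close> need not be a parameter, but some parameter
  \<open>x\<close> has the same value. A dominated ring that contains \<open>a / x\<close> or
  \<open>x / a\<close> contains both, so division by \<open>a\<close> and division by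
  \<open>x\<close> lead to the same hull.\<close>

lemma reg_blowup:
  assumes r: "regular_system A xs" and a: "min_element A a" and alg: "residually_algebraic A"
  shows "\<exists>xs'. length xs' = length xs \<and> regular_system (blowup A a) xs'"
proof -
  have A: "dominated A" and xs: "set xs \<subseteq> A" "A \<inter> pos = Idl\<^bsub>subring_of K A\<^esub> (set xs)" using r unfolding regular_system_def by auto
  note As = dominatedD(1)[OF A] note Ac = subsetD[OF dominatedD(4)[OF A]]
  obtain x where x: "x \<in> set xs" "v x = v a" using reg_min_generator[OF r a] by auto
  then obtain us ws where uw: "xs = us @ x # ws" by (meson split_list)
  define ys where "ys = us @ ws"
  have set_eq: "set xs = set (x # ys)" "length xs = length (x # ys)" unfolding uw ys_def by auto
  have xsM: "set xs \<subseteq> A \<inter> pos" using genideal_subring(2)[OF As xs(1)] xs(2) by auto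
  have a': "a \<in> A \<inter> pos" "a \<in> carrier K" "a \<noteq> \<zero>" "\<And>z. z \<in> A \<inter> pos \<Longrightarrow> v a \<le> v z"
    using a Ac unfolding min_element_def by auto
  have xc: "x \<in> carrier K" using x xs Ac by auto
  have x0: "x \<noteq> \<zero>" using x a' v_finite[of a] by (metis PInfty_neq_ereal(1) v_zero)
  have va0: "v (a \<otimes> inv x) = 0" "v (x \<otimes> inv a) = 0"
  proof -
    obtain r where "v a = ereal r" using v_finite[OF a'(2,3)] by auto
    then show "v (a \<otimes> inv x) = 0" "v (x \<otimes> inv a) = 0" using v_div[OF a'(2) xc x0] v_div[OF xc a'(2,3)] x(2) by simp_all
  qed
  have reg': "regular_system A (x # ys)" using r set_eq unfolding regular_system_def by auto
  have "\<forall>y\<in>set ys. v x \<le> v y" using a'(4) x(2) xsM set_eq by auto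
  from monoidal_steps[of A x ys "[]"] reg' this alg obtain fs' where
    fs': "length fs' = length ys" "regular_system (dom_hull (A \<union> {y \<otimes> inv x | y. y \<in> set ys})) (x # fs')" by auto
  \<comment> \<open>It suffices to divide the parameters, because the elements whose quotient by
    \<open>x\<close> is in \<open>D\<close> form an ideal of \<open>A\<close>.\<close>
  have Dx: "z \<otimes> inv x \<in> D" if D: "dominated D" "A \<subseteq> D" "\<And>y. y \<in> set ys \<Longrightarrow> y \<otimes> inv x \<in> D" and z: "z \<in> A \<inter> pos" for D z
  proof -
    note Ds = subringE[OF dominatedD(1)[OF D(1)]]
    have "ideal {z \<in> A. z \<otimes> inv x \<in> D} (subring_of K A)" unfolding ideal_subring_iff[OF As]
    proof (intro conjI ballI)
      show "\<zero> \<in> {z \<in> A. z \<otimes> inv x \<in> D}" using subringE(2)[OF As] Ds(2) xc x0 by simp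
      fix z assume z: "z \<in> {z \<in> A. z \<otimes> inv x \<in> D}"
      then have zc: "z \<in> carrier K" using Ac by auto
      { fix y assume y: "y \<in> {z \<in> A. z \<otimes> inv x \<in> D}"
        then have "(z \<oplus> y) \<otimes> inv x = z \<otimes> inv x \<oplus> y \<otimes> inv x" using zc Ac xc x0 by (simp add: l_distr)
        then show "z \<oplus> y \<in> {z \<in> A. z \<otimes> inv x \<in> D}" using y z Ds(7) subringE(7)[OF As] by auto }
      { fix y assume y: "y \<in> A"
        then have "(y \<otimes> z) \<otimes> inv x = y \<otimes> (z \<otimes> inv x)" using zc Ac xc x0 by (simp add: m_assoc)
        then show "y \<otimes> z \<in> {z \<in> A. z \<otimes> inv x \<in> D}" using y z Ds(6) D(2) subringE(6)[OF As] by auto }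
    qed auto
    then have "Idl\<^bsub>subring_of K A\<^esub> (set xs) \<subseteq> {z \<in> A. z \<otimes> inv x \<in> D}"
    proof (rule genideal_subring(3)[OF As xs(1)])
      have "y \<otimes> inv x \<in> D" if "y \<in> set xs" for y
        using that D(3)[of y] Ds(3) inv_facts(3)[OF xc x0] unfolding set_eq(1) by (cases "y = x") simp_all
      then show "set xs \<subseteq> {z \<in> A. z \<otimes> inv x \<in> D}" using xs(1) by auto
    qed
    from subsetD[OF this] z show ?thesis unfolding xs(2) by simp
  qed
  have "dom_hull (A \<union> {y \<otimes> inv x | y. y \<in> set ys}) = blowup A a" unfolding blowup_def
  proof (rule hull_cong[OF _ blowup_facts(1)[OF A a]])
    have "y \<otimes> inv x \<in> V" if "y \<in> set ys" for y
    proof (rule div_in_V[OF _ xc x0])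
      have "y \<in> A \<inter> pos" using that set_eq(1) xsM by auto
      then show "y \<in> carrier K" "v x \<le> v y" using Ac a'(4)[of y] x(2) by auto
    qed
    then show "A \<union> {y \<otimes> inv x | y. y \<in> set ys} \<subseteq> V" using dominatedD(2)[OF A] by auto
    fix D assume D: "dominated D"
    note Ds = subringE[OF dominatedD(1)[OF D]]
    show "A \<union> {y \<otimes> inv x |y. y \<in> set ys} \<subseteq> D \<longleftrightarrow> A \<union> {x \<otimes> inv a |x. x \<in> A \<inter> pos} \<subseteq> D"
    proof
      assume s: "A \<union> {y \<otimes> inv x |y. y \<in> set ys} \<subseteq> D"
      have zx: "z \<otimes> inv x \<in> D" if "z \<in> A \<inter> pos" for z using Dx[OF D _ _ that] s by auto
      have "inv (a \<otimes> inv x) \<in> D" using dominatedD(3)[OF D zx[OF a'(1)]] va0 by auto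
      moreover have "inv (a \<otimes> inv x) = x \<otimes> inv a"
      proof -
        have "(x \<otimes> inv a) \<otimes> (a \<otimes> inv x) = \<one>" using div_trans[OF xc a'(2,3) xc x0] xc x0 by simp
        then show ?thesis using inv_unique'[of "a \<otimes> inv x" "x \<otimes> inv a"] m_comm xc x0 a' by auto
      qed
      ultimately have "x \<otimes> inv a \<in> D" by simp
      then have "z \<otimes> inv a \<in> D" if "z \<in> A \<inter> pos" for z
        using Ds(6)[OF zx[OF that] \<open>x \<otimes> inv a \<in> D\<close>] div_trans[OF _ xc x0 a'(2,3), of z] that Ac by simp
      then show "A \<union> {x \<otimes> inv a |x. x \<in> A \<inter> pos} \<subseteq> D" using s by auto
    next
      assume s: "A \<union> {x \<otimes> inv a |x. x \<in> A \<inter> pos} \<subseteq> D"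
      then have za: "z \<otimes> inv a \<in> D" if "z \<in> A \<inter> pos" for z using that by auto
      have "x \<in> A \<inter> pos" using x xsM by auto
      then have "inv (x \<otimes> inv a) \<in> D" using dominatedD(3)[OF D za] va0 by auto
      moreover have "inv (x \<otimes> inv a) = a \<otimes> inv x"
      proof -
        have "(a \<otimes> inv x) \<otimes> (x \<otimes> inv a) = \<one>" using div_trans[OF a'(2) xc x0 a'(2,3)] a' by simp
        then show ?thesis using inv_unique'[of "x \<otimes> inv a" "a \<otimes> inv x"] m_comm xc x0 a' by auto
      qed
      ultimately have "a \<otimes> inv x \<in> D" by simp
      then have "y \<otimes> inv x \<in> D" if "y \<in> set ys" for y
      proof -
        have "y \<in> A \<inter> pos" using that set_eq(1) xsM by auto
        then show ?thesis
          using Ds(6)[OF za[of y] \<open>a \<otimes> inv x \<in> D\<close>] div_trans[OF _ a'(2,3) xc x0, of y] Ac by simp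
      qed
      then show "A \<union> {y \<otimes> inv x |y. y \<in> set ys} \<subseteq> D" using s by auto
    qed
  qed
  then show ?thesis using fs' set_eq by (intro exI[of _ "x # fs'"]) auto
qed

end

section \<open>The sum of the values along the sequence\<close>

lemma rat_scale_vector_space: "vector_space rat_scale"
  by unfold_locales (auto simp: rat_scale_def algebra_simps of_rat_add of_rat_mult)

lemma rational_rank_one:
  assumes c: "c \<in> value_group K v" "c \<noteq> 0" and all: "\<And>z. z \<in> value_group K v \<Longrightarrow> z / c \<in> \<rat>"
  shows "rational_rank K v = 1"
proof -
  interpret rs: vector_space rat_scale by (rule rat_scale_vector_space)
  have "value_group K v \<subseteq> rs.span {c}"
  proof
    fix z assume "z \<in> value_group K v"
    then obtain q where "z / c = of_rat q" using all by (meson Rats_cases)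
    then have "z = rat_scale q c" unfolding rat_scale_def using c(2) by (simp add: field_simps)
    then show "z \<in> rs.span {c}" by (simp add: rs.span_base rs.span_scale)
  qed
  then have T: "rs.span (value_group K v) = rs.span {c}"
    using c(1) by (intro rs.span_eq[THEN iffD2]) (auto intro: rs.span_base)
  have "rs.independent {c}" using c(2) by (simp add: rs.independent_insert)
  then have "rs.dim (rs.span {c}) = 1" using rs.dim_span_eq_card_independent[of "{c}"] by simp
  then show ?thesis unfolding rational_rank_def Let_def T using finite.emptyI finite.insertI
    by (auto simp: one_enat_def)
qed

text \<open>A finite supremum of a nonempty set of naturals is attained. The empty set has supremum
  \<open>0\<close> and is excluded by \<open>0 < d\<close>.\<close>

lemma enat_Sup_attained:
  assumes "Sup {enat n | n. P n} = enat d" "0 < d" shows "P d"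
proof -
  define S where "S = {enat n | n. P n}"
  have SS: "Sup S = enat d" using assms(1) unfolding S_def .
  have ne: "S \<noteq> {}"
  proof
    assume "S = {}"
    then have "Sup S = 0" by (simp add: bot_enat_def)
    then show False using SS assms(2) by (simp add: zero_enat_def)
  qed
  have "finite S"
  proof (rule ccontr)
    assume "infinite S"
    then have "Sup S = \<infinity>" using ne unfolding Sup_enat_def by simp
    then show False using SS by simp
  qed
  moreover from this have "Max S = enat d" using SS ne unfolding Sup_enat_def by simp
  ultimately have "enat d \<in> S" using Max_in[of S] ne by simp
  then show ?thesis unfolding S_def by auto
qed

section \<open>Domination and algebraic residues from the hypotheses of the theorem\<close>

context valued_field
begin

lemma rational_ratio_trans:
  fixes a b c :: real
  assumes "a / c \<in> \<rat>" "b / c \<in> \<rat>" "c \<noteq> 0" shows "a / b \<in> \<rat>"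
proof -
  have "(a / c) / (b / c) = a / b" using assms(3) by simp
  then show ?thesis using Rats_divide[OF assms(1,2)] by (simp only:)
qed

text \<open>A nonunit lies in a maximal ideal, here found as a maximal member of a set of ideals of
  a noetherian ring. There is only one, and it is contained in \<open>pos\<close>; so elements of
  value zero are units.\<close>

lemma dominated_local_noetherian:
  assumes R: "subring R K" "R \<subseteq> V" and l: "local_ring (subring_of K R)" and N: "noetherian_ring (subring_of K R)"
    and M: "max_ideal (subring_of K R) \<subseteq> pos"
  shows "dominated R"
  unfolding dominated_def
proof (intro conjI ballI impI R)
  fix x assume x: "x \<in> R" "v x = 0"
  have c: "R \<subseteq> carrier K" using subringE(1)[OF R(1)] .
  have x0: "x \<in> carrier K" "x \<noteq> \<zero>" using x c v_eq_zero by auto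
  let ?I = "Idl\<^bsub>subring_of K R\<^esub> {x}"
  have xI: "{x} \<subseteq> R" using x by auto
  have "?I = R"
  proof (rule ccontr)
    assume "?I \<noteq> R"
    define S where "S = {J. ideal J (subring_of K R) \<and> ?I \<subseteq> J \<and> J \<noteq> R}"
    have "?I \<in> S" unfolding S_def using \<open>?I \<noteq> R\<close> genideal_subring(1)[OF R(1) xI] by auto
    then obtain J where J: "J \<in> S" "\<And>I. I \<in> S \<Longrightarrow> J \<subseteq> I \<Longrightarrow> I = J"
      by (rule noetherian_ring.noetherian_maximal[OF N]) (auto simp: S_def)
    have "maximalideal J (subring_of K R)"
    proof (rule maximalidealI)
      show "ideal J (subring_of K R)" "carrier (subring_of K R) \<noteq> J" using J(1) unfolding S_def by auto
      show "I = J \<or> I = carrier (subring_of K R)"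
        if "ideal I (subring_of K R)" "J \<subseteq> I" "I \<subseteq> carrier (subring_of K R)" for I
      proof (rule disjCI)
        assume "I \<noteq> carrier (subring_of K R)"
        then have "I \<in> S" using that J(1) unfolding S_def by auto
        then show "I = J" using J(2) that(2) by auto
      qed
    qed
    moreover have "\<exists>!M. maximalideal M (subring_of K R)" using l unfolding local_ring_def by auto
    ultimately have "J = max_ideal (subring_of K R)" unfolding max_ideal_def by (metis theI)
    moreover have "x \<in> J" using J(1) genideal_subring(2)[OF R(1) xI] unfolding S_def by auto
    ultimately show False using M x unfolding pos_def by auto
  qed
  then have "\<one> \<in> {r \<otimes> x | r. r \<in> R}" using genideal_single[OF R(1) x(1)] subringE(3)[OF R(1)] by simp
  then obtain r where r: "r \<in> R" "r \<otimes> x = \<one>" by auto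
  have "inv x = (r \<otimes> x) \<otimes> inv x" using r x0 by simp
  also have "\<dots> = r" using r(1) c x0 by (simp add: m_assoc subset_iff)
  finally show "inv x \<in> R" using r by simp
qed

text \<open>A polynomial over the residue field that vanishes at the residue of \<open>w\<close> is
  lifted to \<open>R\<close> coefficient by coefficient. The lift of its leading coefficient has
  value zero, so it is a unit of \<open>R\<close>, and dividing by it gives a monic
  polynomial.\<close>

lemma residually_algebraic_of_zero_dimensional:
  assumes R: "dominated R" and z: "zero_dimensional_over K V R"
  shows "residually_algebraic R"
  unfolding residually_algebraic_def
proof
  fix w assume w: "w \<in> V"
  have Rs: "subring R K" using dominatedD[OF R] by auto
  have wc: "w \<in> carrier K" using w V_eq by auto
  let ?A = "subring_of K V"
  let ?M = "V \<inter> pos"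
  interpret A: cring ?A by (rule subring_cring[OF V_subring])
  have Mmax: "maximalideal ?M ?A" using maximal_dominated_iff[OF V_dominated] by auto
  interpret M: maximalideal ?M ?A by (rule Mmax)
  define L where "L = ?A Quot ?M"
  define h where "h = (\<lambda>r. ?M +>\<^bsub>?A\<^esub> r)"
  have hom: "ring_hom_ring ?A L h" unfolding h_def L_def by (rule M.rcos_ring_hom_ring)
  interpret h: ring_hom_ring ?A L h by (rule hom)
  interpret L: field L unfolding L_def by (rule M.quotient_is_field) (rule A.is_cring)
  have RA: "subring R ?A"
  proof (rule A.ring_incl_imp_subring)
    show "R \<subseteq> carrier ?A" using dominatedD[OF R] by auto
    show "ring (?A\<lparr>carrier := R\<rparr>)" using subring_is_ring[OF Rs] by simp
  qed
  have kL: "subring (h ` R) L" by (rule h.img_is_subring[OF RA])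
  have "ring.algebraic L (h ` R) (h w)"
  proof -
    have "h w \<in> carrier L" using h.hom_closed w by simp
    then show ?thesis using z max_ideal_dominated[OF V_dominated] pos_sub
      unfolding zero_dimensional_over_def Let_def h_def L_def by (simp add: Int_absorb1)
  qed
  then obtain q where q: "q \<in> carrier (univ_poly L (h ` R))" "q \<noteq> []" "ring.eval L q (h w) = \<zero>\<^bsub>L\<^esub>"
    using L.algebraicE[OF kL, of "h w"] h.hom_closed w unfolding over_def by auto
  \<comment> \<open>The leading coefficient stands at the head of the list, so \<open>a # q\<close>
    evaluates to \<open>a\<close> times the power of exponent \<open>length q\<close> plus the value
    of \<open>q\<close>.\<close>
  have lift: "set q \<subseteq> h ` R \<Longrightarrow> \<exists>g\<in>poly_in R w (length q). ring.eval L q (h w) = h g" for q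
  proof (induction q)
    case Nil
    then show ?case using h.hom_zero by simp
  next
    case (Cons a q)
    then obtain r g where r: "r \<in> R" "a = h r" and g: "g \<in> poly_in R w (length q)" "ring.eval L q (h w) = h g" by auto
    have rV: "r \<in> V" using r dominatedD[OF R] by auto
    have gV: "g \<in> V" using g(1) polys_in_minimal[OF V_subring _ w, of R] dominatedD(2)[OF R] unfolding polys_in_def by blast
    have wn: "w [^] n \<in> V" for n :: nat by (induction n) (use subringE(3,6)[OF V_subring] w in auto)
    have "h (w [^] n) = h w [^]\<^bsub>L\<^esub> n" for n :: nat
      using h.hom_nat_pow[of w n] w by (simp add: nat_pow_consistent[of w _ V])
    then have "ring.eval L (a # q) (h w) = h (r \<otimes> w [^] length q \<oplus> g)"
      using h.hom_add[of "r \<otimes> w [^] length q" g] h.hom_mult[of r "w [^] length q"] rV gV wn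
        subringE(6)[OF V_subring] g(2) r(2) by simp
    moreover have "r \<otimes> w [^] length q \<oplus> g \<in> poly_in R w (length (a # q))"
      using poly_in_add[OF Rs whole_ideal[OF Rs] wc poly_in_monomial[OF Rs whole_ideal[OF Rs] wc r(1)]]
        poly_in_mono_Suc[OF Rs whole_ideal[OF Rs] wc] g(1) by auto
    ultimately show ?case by blast
  qed
  obtain a q' where aq: "q = a # q'" using q(2) by (cases q) auto
  have qp: "set q \<subseteq> h ` R" "a \<noteq> \<zero>\<^bsub>L\<^esub>" using q(1) aq unfolding univ_poly_def polynomial_def by auto
  obtain r where r: "r \<in> R" "a = h r" using qp aq by auto
  obtain g where g: "g \<in> poly_in R w (length q')" "ring.eval L q' (h w) = h g" using lift[of q'] qp(1) aq by auto
  have rV: "r \<in> V" using r dominatedD[OF R] by auto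
  have rc: "r \<in> carrier K" using rV V_eq by auto
  have gV: "g \<in> V" using g(1) polys_in_minimal[OF V_subring _ w, of R] dominatedD(2)[OF R] unfolding polys_in_def by blast
  have gc: "g \<in> carrier K" using gV V_eq by auto
  have wn: "w [^] n \<in> V" for n :: nat by (induction n) (use subringE(3,6)[OF V_subring] w in auto)
  have "h (w [^] n) = h w [^]\<^bsub>L\<^esub> n" for n :: nat
    using h.hom_nat_pow[of w n] w by (simp add: nat_pow_consistent[of w _ V])
  then have "\<zero>\<^bsub>L\<^esub> = h (r \<otimes> w [^] length q' \<oplus> g)"
    using h.hom_add[of "r \<otimes> w [^] length q'" g] h.hom_mult[of r "w [^] length q'"] rV gV wn
      subringE(6,7)[OF V_subring] g(2) r(2) q(3) aq by simp
  moreover have z: "h x = \<zero>\<^bsub>L\<^esub> \<longleftrightarrow> x \<in> ?M" if "x \<in> V" for x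
  proof -
    have "\<zero>\<^bsub>L\<^esub> = ?M" unfolding L_def FactRing_def by simp
    then show ?thesis using M.rcos_const_imp_mem[of x] A.a_rcos_zero[OF M.is_ideal, of x] that unfolding h_def by auto
  qed
  moreover have "r \<otimes> w [^] length q' \<oplus> g \<in> V" using subringE(6,7)[OF V_subring] rV wn gV by auto
  ultimately have e: "r \<otimes> w [^] length q' \<oplus> g \<in> pos" by auto
  have "r \<notin> pos" using z[OF rV] qp(2) r(2) rV by auto
  then have "v r = 0" using v_cases rV by auto
  then have ir: "inv r \<in> R" "r \<noteq> \<zero>" using dominatedD(3)[OF R r(1)] v_eq_zero rc by auto
  then have irc: "inv r \<in> carrier K" "inv r \<in> V" using rc dominatedD(2)[OF R] by auto
  have wnc: "w [^] length q' \<in> carrier K" using wc by simp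
  have "inv r \<otimes> (r \<otimes> w [^] length q' \<oplus> g) = (inv r \<otimes> r) \<otimes> w [^] length q' \<oplus> inv r \<otimes> g"
    using rc irc(1) wnc gc by algebra
  also have "\<dots> = w [^] length q' \<oplus> inv r \<otimes> g" using rc ir wnc by simp
  finally have "w [^] length q' \<oplus> inv r \<otimes> g \<in> pos" using pos_mult[OF irc(2) e] by simp
  moreover have "inv r \<otimes> g \<in> poly_in R w (length q')"
    by (rule poly_in_smult[OF Rs whole_ideal[OF Rs] wc ir(1) g(1)])
  ultimately show "\<exists>n. \<exists>g\<in>poly_in R w n. w [^] n \<oplus> g \<in> pos" by blast
qed

end

section \<open>The sequence of transforms along the valuation\<close>

locale quadratic_sequence = valued_field +
  fixes Rs :: "nat \<Rightarrow> 'a set"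
  assumes dominated0: "dominated (Rs 0)" and nonzero0: "\<exists>z\<in>Rs 0 \<inter> pos. z \<noteq> \<zero>"
    and lqt: "local_quadratic_transform K V (Rs n) (Rs (Suc n))"
begin

lemma step: "dominated (Rs n) \<and> (\<exists>z\<in>Rs n \<inter> pos. z \<noteq> \<zero>)"
proof (induction n)
  case 0
  then show ?case using dominated0 nonzero0 by auto
next
  case (Suc n)
  then obtain a where a: "min_element (Rs n) a" "Rs (Suc n) = blowup (Rs n) a"
    using lqt[of n] lqt_iff[of "Rs n" "Rs (Suc n)"] by auto
  then show ?case using Suc blowup_facts(2,3)[of "Rs n" a] by auto
qed

definition t where "t n = (SOME a. min_element (Rs n) a \<and> Rs (Suc n) = blowup (Rs n) a)"

lemma t: "min_element (Rs n) (t n)" "Rs (Suc n) = blowup (Rs n) (t n)"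
proof -
  have "\<exists>a. min_element (Rs n) a \<and> Rs (Suc n) = blowup (Rs n) a"
    using step[of n] lqt[of n] lqt_iff[of "Rs n" "Rs (Suc n)"] by auto
  from someI_ex[OF this] show "min_element (Rs n) (t n)" "Rs (Suc n) = blowup (Rs n) (t n)"
    unfolding t_def by auto
qed

lemma dom: "dominated (Rs n)" using step by auto

lemma next_ring:
  "Rs n \<subseteq> Rs (Suc n)" "z \<in> Rs n \<inter> pos \<Longrightarrow> z \<otimes> inv (t n) \<in> Rs (Suc n)" "t n \<in> Rs (Suc n)"
  using blowup_facts(3,4)[OF dom t(1)] t unfolding min_element_def by blast+

lemma t_facts: "t n \<in> carrier K" "t n \<noteq> \<zero>" "0 < v (t n)" "t n \<in> pos" "t n \<in> Rs n" "z \<in> Rs n \<inter> pos \<Longrightarrow> v (t n) \<le> v z"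
  using t(1)[of n] dominatedD(4)[OF dom, of n] unfolding min_element_def pos_def by auto

lemma t_value: obtains r where "v (t n) = ereal r" "0 < r"
proof -
  obtain r where r: "v (t n) = ereal r" using v_finite[OF t_facts(1,2)] .
  show thesis by (rule that[OF r]) (use t_facts(3)[of n] r in simp)
qed

lemma value_sum_eq: "value_sum K v Rs = suminf (\<lambda>i. v (t i))"
  unfolding value_sum_def max_ideal_dominated[OF dom] using ideal_value_min[OF t(1)] by simp

lemma value_sum_bound:
  assumes "\<And>n. (\<Sum>i<n. v (t i)) \<le> C" shows "value_sum K v Rs \<le> C"
  unfolding value_sum_eq by (rule suminf_bound) (use assms t_facts(3) in \<open>auto intro: less_imp_le\<close>)

lemma initial_sub: "Rs 0 \<subseteq> Rs n"
  by (induction n) (use next_ring in auto)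

lemma union_in_V: "(\<Union>n. Rs n) \<subseteq> V" using dominatedD(2)[OF dom] by auto

text \<open>As long as a fraction \<open>x = a / b\<close> is not in \<open>R\<^sub>n\<close>, the values of the generators \<open>t\<^sub>i\<close> can be
  cancelled against \<open>b\<close>.\<close>

lemma value_sum_finite_of_missing:
  assumes x: "x \<in> V" "x \<notin> (\<Union>n. Rs n)" and b: "b \<in> Rs 0" "b \<noteq> \<zero>" "x \<otimes> b \<in> Rs 0"
  shows "value_sum K v Rs < \<infinity>"
proof -
  have xc: "x \<in> carrier K" "0 \<le> v x" using x V_eq by auto
  \<comment> \<open>The witness is \<open>b\<close> divided by \<open>t 0, ..., t (n - 1)\<close>.
    It can be divided once more, because outside \<open>pos\<close> it would be a unit of
    \<open>Rs n\<close>, and \<open>x\<close> would belong to \<open>Rs n\<close>.\<close>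
  have "\<exists>c\<in>Rs n. c \<noteq> \<zero> \<and> x \<otimes> c \<in> Rs n \<and> v c + (\<Sum>i<n. v (t i)) = v b" for n
  proof (induction n)
    case 0
    then show ?case using b by (auto intro!: bexI[of _ b])
  next
    case (Suc n)
    then obtain c where c: "c \<in> Rs n" "c \<noteq> \<zero>" "x \<otimes> c \<in> Rs n" "v c + (\<Sum>i<n. v (t i)) = v b" by auto
    have cc: "c \<in> carrier K" using c dominatedD(4)[OF dom] by auto
    have cp: "c \<in> pos"
    proof (rule ccontr)
      assume "c \<notin> pos"
      then have "v c = 0" using v_cases dominatedD(2)[OF dom] c by blast
      then have "inv c \<in> Rs n" using dominatedD(3)[OF dom c(1)] by auto
      then have "(x \<otimes> c) \<otimes> inv c \<in> Rs n" using subringE(6)[OF dominatedD(1)[OF dom]] c by auto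
      moreover have "(x \<otimes> c) \<otimes> inv c = x" using xc cc c(2) by (simp add: m_assoc)
      ultimately show False using x by auto
    qed
    have xcp: "x \<otimes> c \<in> pos" using pos_mult x cp by auto
    let ?c = "c \<otimes> inv (t n)"
    have 1: "?c \<in> Rs (Suc n)" "(x \<otimes> c) \<otimes> inv (t n) \<in> Rs (Suc n)"
      using next_ring(2) c cp xcp by auto
    have 2: "(x \<otimes> c) \<otimes> inv (t n) = x \<otimes> ?c" using xc cc t_facts by (simp add: m_assoc)
    have 3: "?c \<noteq> \<zero>" using c(2) cc t_facts inv_facts integral by (metis m_closed)
    have "v ?c = v c - v (t n)" using v_div cc t_facts by auto
    moreover obtain r where "v (t n) = ereal r" using t_value .
    moreover obtain r where "v c = ereal r" using v_finite cc c(2) by auto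
    ultimately have "v ?c + (\<Sum>i<Suc n. v (t i)) = v c + (\<Sum>i<n. v (t i))"
      by (cases "\<Sum>i<n. v (t i)") auto
    then show ?case using 1 2 3 c(4) by auto
  qed
  then have "\<exists>c\<in>Rs n. c \<noteq> \<zero> \<and> v c + (\<Sum>i<n. v (t i)) = v b" for n by blast
  then have "(\<Sum>i<n. v (t i)) \<le> v b" for n
  proof -
    obtain c where c: "c \<in> Rs n" "v c + (\<Sum>i<n. v (t i)) = v b"
      using \<open>\<And>n. \<exists>c\<in>Rs n. c \<noteq> \<zero> \<and> v c + (\<Sum>i<n. v (t i)) = v b\<close> by blast
    have "0 \<le> v c" using c(1) dominatedD(2)[OF dom, of n] V_eq by auto
    then have "0 + (\<Sum>i<n. v (t i)) \<le> v c + (\<Sum>i<n. v (t i))" by (rule add_right_mono)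
    then show ?thesis using c(2) by simp
  qed
  then have "value_sum K v Rs \<le> v b" by (rule value_sum_bound)
  moreover obtain r where "v b = ereal r" using v_finite b dominatedD(4)[OF dom, of 0] by blast
  ultimately show ?thesis by auto
qed

lemma union_eq_V:
  assumes s: "value_sum K v Rs = \<infinity>" and f: "V \<subseteq> fraction_field K (Rs 0)"
  shows "(\<Union>n. Rs n) = V"
proof (rule ccontr)
  assume "(\<Union>n. Rs n) \<noteq> V"
  then have "\<not> V \<subseteq> (\<Union>n. Rs n)" using union_in_V by (meson subset_antisym)
  then obtain x where x: "x \<in> V" "x \<notin> (\<Union>n. Rs n)" by (meson subsetI)
  then obtain a b where ab: "a \<in> Rs 0" "b \<in> Rs 0" "b \<noteq> \<zero>" "x = a \<otimes> inv b"
    using f unfolding fraction_field_def localize_at_def by blast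
  have "x \<otimes> b = a" using ab dominatedD(4)[OF dom, of 0] by (auto simp: m_assoc subset_iff)
  then show False using value_sum_finite_of_missing[OF x ab(2,3)] ab s by auto
qed

text \<open>The pair \<open>a, b\<close> of elements with incommensurable values is replaced by \<open>a / t, t\<close> or by
  \<open>b / t, t\<close>; the sum of the two values decreases by at least \<open>v t\<close>.\<close>

lemma value_sum_finite_of_irrational:
  assumes "a \<in> Rs 0 \<inter> pos" "b \<in> Rs 0 \<inter> pos" "v a = ereal \<alpha>" "v b = ereal \<beta>" "\<alpha> / \<beta> \<notin> \<rat>"
  shows "value_sum K v Rs < \<infinity>"
proof -
  have "\<exists>a b \<alpha>' \<beta>'. a \<in> Rs n \<inter> pos \<and> b \<in> Rs n \<inter> pos \<and> v a = ereal \<alpha>' \<and> v b = ereal \<beta>' \<and>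
    \<alpha>' / \<beta>' \<notin> \<rat> \<and> (\<Sum>i<n. v (t i)) + ereal (\<alpha>' + \<beta>') \<le> ereal (\<alpha> + \<beta>)" for n
  proof (induction n)
    case 0
    then show ?case using assms by (intro exI[of _ a] exI[of _ b] exI[of _ \<alpha>] exI[of _ \<beta>]) auto
  next
    case (Suc n)
    then obtain a b A B where *: "a \<in> Rs n \<inter> pos" "b \<in> Rs n \<inter> pos" "v a = ereal A" "v b = ereal B"
      "A / B \<notin> \<rat>" "(\<Sum>i<n. v (t i)) + ereal (A + B) \<le> ereal (\<alpha> + \<beta>)" by blast
    obtain g where g: "v (t n) = ereal g" "0 < g" using t_value .
    \<comment> \<open>\<open>c\<close> is that one of \<open>a\<close>, \<open>b\<close> whose value
      is incommensurable with \<open>g\<close>. The other one is given up for \<open>t n\<close>,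
      whose value is not greater; this is where \<open>C + g \<le> A + B\<close> comes from.\<close>
    have key: "\<exists>a b \<alpha>' \<beta>'. a \<in> Rs (Suc n) \<inter> pos \<and> b \<in> Rs (Suc n) \<inter> pos \<and> v a = ereal \<alpha>' \<and> v b = ereal \<beta>' \<and>
        \<alpha>' / \<beta>' \<notin> \<rat> \<and> \<alpha>' + \<beta>' + g \<le> A + B"
      if c: "c \<in> Rs n \<inter> pos" "v c = ereal C" "C / g \<notin> \<rat>" and le: "C + g \<le> A + B" for c C
    proof -
      have cc: "c \<in> carrier K" using c dominatedD(4)[OF dom] by auto
      have vc: "v (c \<otimes> inv (t n)) = ereal (C - g)" using v_div[OF cc t_facts(1,2)] c g by simp
      have "g \<le> C" using t_facts(6)[OF c(1)] c g by simp
      moreover have "C \<noteq> g" using c(3) g by auto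
      ultimately have "g < C" by simp
      moreover have "c \<otimes> inv (t n) \<in> Rs (Suc n)" by (rule next_ring(2)[OF c(1)])
      ultimately have 1: "c \<otimes> inv (t n) \<in> Rs (Suc n) \<inter> pos"
        using vc dominatedD(4)[OF dom] unfolding pos_def by auto
      have 2: "t n \<in> Rs (Suc n) \<inter> pos" using t_facts(4) next_ring(3) by auto
      have "(C - g) / g \<notin> \<rat>"
      proof
        assume "(C - g) / g \<in> \<rat>"
        then have "(C - g) / g + 1 \<in> \<rat>" by (intro Rats_add) auto
        moreover have "(C - g) / g + 1 = C / g" using g by (simp add: field_simps)
        ultimately show False using c(3) by simp
      qed
      then show ?thesis using 1 2 vc g le
        by (intro exI[of _ "c \<otimes> inv (t n)"] exI[of _ "t n"] exI[of _ "C - g"] exI[of _ g]) auto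
    qed
    have AB: "g \<le> A" "g \<le> B" using t_facts(6)[OF *(1)] t_facts(6)[OF *(2)] *(3,4) g by auto
    have "A / g \<notin> \<rat> \<or> B / g \<notin> \<rat>" using rational_ratio_trans[of A g B] *(5) g by auto
    then obtain a' b' A' B' where n: "a' \<in> Rs (Suc n) \<inter> pos" "b' \<in> Rs (Suc n) \<inter> pos" "v a' = ereal A'" "v b' = ereal B'"
        "A' / B' \<notin> \<rat>" "A' + B' + g \<le> A + B"
      using key[OF *(1,3)] key[OF *(2,4)] AB by auto
    have "(\<Sum>i<Suc n. v (t i)) + ereal (A' + B') = (\<Sum>i<n. v (t i)) + ereal (A' + B' + g)"
    proof -
      have "ereal g + ereal (A' + B') = ereal (A' + B' + g)" by simp
      then show ?thesis using g(1) by (simp only: sum.lessThan_Suc add.assoc)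
    qed
    also have "\<dots> \<le> (\<Sum>i<n. v (t i)) + ereal (A + B)" using n(6) by (intro add_left_mono) auto
    also have "\<dots> \<le> ereal (\<alpha> + \<beta>)" by (rule *(6))
    finally show ?case using n by blast
  qed
  then have "(\<Sum>i<n. v (t i)) \<le> ereal (\<alpha> + \<beta>)" for n
  proof -
    obtain a b A B where *: "a \<in> pos" "b \<in> pos" "v a = ereal A" "v b = ereal B"
      "(\<Sum>i<n. v (t i)) + ereal (A + B) \<le> ereal (\<alpha> + \<beta>)"
      using \<open>\<And>n. \<exists>a b \<alpha>' \<beta>'. _ a b \<alpha>' \<beta>' n\<close> by blast
    have "0 < A" "0 < B" using * unfolding pos_def by auto
    then have "(\<Sum>i<n. v (t i)) + 0 \<le> (\<Sum>i<n. v (t i)) + ereal (A + B)" by (intro add_left_mono) auto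
    then show ?thesis using *(5) by simp
  qed
  then have "value_sum K v Rs \<le> ereal (\<alpha> + \<beta>)" by (rule value_sum_bound)
  then show ?thesis by auto
qed

text \<open>All values are differences of values on \<open>Rs 0\<close>, so incommensurable values,
  if there are any, occur already in its maximal ideal. With the previous lemma, an infinite sum
  implies rational rank one.\<close>

lemma rational_rank_one_of_commensurable:
  assumes all: "\<And>a b \<alpha> \<beta>. a \<in> Rs 0 \<inter> pos \<Longrightarrow> b \<in> Rs 0 \<inter> pos \<Longrightarrow> v a = ereal \<alpha> \<Longrightarrow> v b = ereal \<beta> \<Longrightarrow> \<alpha> / \<beta> \<in> \<rat>"
    and V: "\<forall>x\<in>carrier K - {\<zero>}. x \<in> V \<or> inv x \<in> V" and f: "V \<subseteq> fraction_field K (Rs 0)"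
  shows "rational_rank K v = 1"
proof -
  obtain g where g: "v (t 0) = ereal g" "0 < g" using t_value .
  have t0: "t 0 \<in> Rs 0 \<inter> pos" using t_facts by auto
  have R: "\<alpha> / g \<in> \<rat>" if "a \<in> Rs 0" "v a = ereal \<alpha>" for a \<alpha>
  proof (cases "a \<in> pos")
    case True
    then show ?thesis using all[OF _ t0 that(2) g(1)] that by auto
  next
    case False
    then have "v a = 0" using v_cases[of a] dominatedD(2)[OF dom, of 0] that(1) by auto
    then show ?thesis using that by simp
  qed
  have VV: "\<alpha> / g \<in> \<rat>" if xV: "x \<in> V" and vx: "v x = ereal \<alpha>" for x \<alpha>
  proof -
    obtain a b where ab: "a \<in> Rs 0" "b \<in> Rs 0" "b \<noteq> \<zero>" "x = a \<otimes> inv b"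
      using f xV unfolding fraction_field_def localize_at_def by blast
    have c: "a \<in> carrier K" "b \<in> carrier K" using ab dominatedD(4)[OF dom, of 0] by auto
    obtain B where B: "v b = ereal B" using v_finite[OF c(2) ab(3)] .
    have "v x = v a - v b" using v_div[OF c ab(3)] ab(4) by simp
    then obtain A where A: "v a = ereal A" "\<alpha> = A - B" using vx B by (cases "v a") auto
    have "A / g - B / g \<in> \<rat>" by (intro Rats_diff R[OF ab(1) A(1)] R[OF ab(2) B])
    then show ?thesis unfolding A(2) by (simp add: diff_divide_distrib)
  qed
  show ?thesis
  proof (rule rational_rank_one[of g])
    show "g \<in> value_group K v" unfolding value_group_def using g t_facts by auto
    show "g \<noteq> 0" using g by simp
    fix z assume "z \<in> value_group K v"
    then obtain x where x: "x \<in> carrier K" "x \<noteq> \<zero>" "v x = ereal z" unfolding value_group_def by auto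
    then consider "x \<in> V" | "inv x \<in> V" using V by blast
    then show "z / g \<in> \<rat>"
    proof cases
      case 1 then show ?thesis using VV x by auto
    next
      case 2
      have "(- z) / g \<in> \<rat>" by (rule VV[OF 2]) (use v_inv x in simp)
      then show ?thesis using Rats_minus_iff[of "z / g"] by simp
    qed
  qed
qed

text \<open>As \<open>V\<close> has rank one, every element \<open>z\<close> of the maximal ideal of \<open>R\<^sub>j\<close> has a power in \<open>y V\<close>, for any
  nonzero \<open>y\<close>. If \<open>y\<close> is in a prime \<open>P\<close> whose localization contains \<open>V\<close>, then \<open>z\<close> is in \<open>P\<close>; so \<open>P\<close> is
  maximal, and its height is not one.\<close>

lemma switches_of_union:
  assumes U: "(\<Union>n. Rs n) = V" and r: "\<And>n. \<exists>xs. regular_system (Rs n) xs \<and> 2 \<le> length xs"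
  shows "switches_strongly_infinitely_often K Rs"
  unfolding switches_strongly_infinitely_often_def
proof
  assume "\<exists>j p. primeideal p (subring_of K (Rs j)) \<and> height (subring_of K (Rs j)) p = 1 \<and>
        (\<Union>n. Rs n) \<subseteq> localize_at K (Rs j) p"
  then obtain j P where P: "primeideal P (subring_of K (Rs j))" "height (subring_of K (Rs j)) P = 1"
    "V \<subseteq> localize_at K (Rs j) P" using U by auto
  note As = dominatedD(1)[OF dom, of j] note Ac = dominatedD(4)[OF dom, of j]
  note P' = P(1)[unfolded prime_subring_iff[OF As] ideal_subring_iff[OF As]]
  obtain xs where xs: "regular_system (Rs j) xs" "2 \<le> length xs" using r by auto
  then obtain p where "regular_parameters (subring_of K (Rs j)) (Rs j \<inter> pos) xs p" using reg_parameters by auto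
  then interpret RP: regular_parameters "subring_of K (Rs j)" "Rs j \<inter> pos" xs p .
  have "\<exists>q. prime_chain (subring_of K (Rs j)) 1 q \<and> q 1 = P"
    using enat_Sup_attained[of "\<lambda>n. \<exists>p. prime_chain (subring_of K (Rs j)) n p \<and> p n = P" 1] P(2)
    unfolding height_def one_enat_def by auto
  then obtain q where q': "prime_chain (subring_of K (Rs j)) 1 q" "q 1 = P" by auto
  \<comment> \<open>Height one provides a prime properly below \<open>P\<close>, and thus a nonzero
    element \<open>y\<close> of \<open>P\<close>.\<close>
  then have q: "primeideal (q 0) (subring_of K (Rs j))" "q 0 \<subset> P" unfolding prime_chain_def by auto
  then obtain y where y: "y \<in> P" "y \<notin> q 0" by auto
  moreover have "\<zero> \<in> q 0" using q(1) unfolding prime_subring_iff[OF As] ideal_subring_iff[OF As] by simp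
  ultimately have y: "y \<in> P" "y \<noteq> \<zero>" by auto
  have yc: "y \<in> carrier K" using y P' Ac by auto
  obtain Y where Y: "v y = ereal Y" using v_finite[OF yc y(2)] .
  have Pm: "a \<in> P \<or> b \<in> P" if "a \<in> Rs j" "b \<in> Rs j" "a \<otimes> b \<in> P" for a b
    using P' that by simp
  have "z \<in> P" if z: "z \<in> Rs j \<inter> pos" for z
  proof (cases "z = \<zero>")
    case True
    then show ?thesis using P' by auto
  next
    case False
    have zc: "z \<in> carrier K" using z Ac by auto
    obtain Z where Z1: "v z = ereal Z" using v_finite[OF zc False] .
    have "0 < v z" using z unfolding pos_def by simp
    with Z1 have Z: "v z = ereal Z" "0 < Z" by simp_all
    obtain k :: nat where k: "Y < real k * Z" using reals_Archimedean3[OF Z(2)] by auto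
    have vk: "v (z [^] k) = ereal (real k * Z)" for k :: nat
      by (induction k) (use v_mult zc Z(1) in \<open>auto simp: algebra_simps\<close>)
    have zk: "z [^] k \<in> Rs j" for k :: nat by (induction k) (use subringE(3,6)[OF As] z in auto)
    have "z [^] k \<otimes> inv y \<in> V" by (rule div_in_V[OF _ yc y(2)]) (use zc vk[of k] Y k in auto)
    then obtain s u where su: "z [^] k \<otimes> inv y = s \<otimes> inv u" "s \<in> Rs j" "u \<in> Rs j" "u \<notin> P"
      using P(3) unfolding localize_at_def by blast
    have "u \<noteq> \<zero>" using su(4) P' by auto
    then have c: "s \<in> carrier K" "u \<in> carrier K" "u \<noteq> \<zero>" "z [^] k \<in> carrier K" "inv y \<in> carrier K" "inv u \<in> carrier K"
      using subsetD[OF Ac su(2)] subsetD[OF Ac su(3)] zc inv_facts(1)[OF yc y(2)] by simp_all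
    have "((z [^] k \<otimes> inv y) \<otimes> y) \<otimes> u = (z [^] k \<otimes> inv y) \<otimes> (y \<otimes> u)" using c(2,4,5) yc by algebra
    moreover have "((z [^] k \<otimes> inv y) \<otimes> y) \<otimes> u = u \<otimes> z [^] k"
      unfolding div_mult(1)[OF c(4) yc y(2)] using m_comm c(2,4) by simp
    ultimately have "u \<otimes> z [^] k = (z [^] k \<otimes> inv y) \<otimes> (y \<otimes> u)" by simp
    also have "\<dots> = ((s \<otimes> inv u) \<otimes> u) \<otimes> y" unfolding su(1) using c yc by algebra
    also have "\<dots> = s \<otimes> y" using div_mult(1)[OF c(1,2,3)] by simp
    finally have "u \<otimes> z [^] k \<in> P" using P' y(1) su(2) by simp
    then have "z [^] k \<in> P" using Pm[OF su(3) zk] su(4) by simp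
    then show ?thesis
    proof (induction k)
      case 0
      then show ?case using P' by simp
    next
      case (Suc k)
      then show ?case using Pm[OF zk[of k], of z] z by auto
    qed
  qed
  then have "P = Rs j \<inter> pos" using RP.prime_le_M[OF P(1)] by auto
  \<comment> \<open>A chain with a step for each parameter may end in the maximal ideal, so the
    height of \<open>P\<close> is at least \<open>2\<close>.\<close>
  moreover have "prime_chain (subring_of K (Rs j)) (length xs) (p(length xs := Rs j \<inter> pos))"
    by (rule RP.prime_chain_top[OF RP.chain])
  ultimately have "enat (length xs) \<le> height (subring_of K (Rs j)) P"
    unfolding height_def by (intro Sup_upper) (auto intro!: exI[of _ "p(length xs := Rs j \<inter> pos)"])
  then show False using xs(2) P(2) by (auto simp: one_enat_def)
qed

end

lemma suminf_ereal_infinite: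
  fixes f :: "nat \<Rightarrow> ereal"
  assumes "0 < c" "\<And>n. ereal c \<le> f n" shows "suminf f = \<infinity>"
proof -
  have f0: "0 \<le> f n" for n using assms order_trans[of 0 "ereal c" "f n"] by simp
  have le: "ereal (real N * c) \<le> suminf f" for N
  proof -
    have "ereal (real N * c) = (\<Sum>n<N. ereal c)" by simp
    also have "\<dots> \<le> (\<Sum>n<N. f n)" by (intro sum_mono assms(2))
    also have "\<dots> \<le> suminf f" by (rule suminf_upper[OF f0])
    finally show ?thesis .
  qed
  show ?thesis
  proof (rule ereal_top)
    fix r
    obtain N where "r < real N * c" using reals_Archimedean3[OF assms(1)] by auto
    then have "ereal r \<le> ereal (real N * c)" by simp
    then show "ereal r \<le> suminf f" using le[of N] by (rule order_trans)
  qed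
qed

context valued_field
begin

lemma reg_of_regular_local_ring:
  assumes R: "dominated R" and r: "regular_local_ring (subring_of K R) d" and d: "0 < d"
  shows "\<exists>xs. regular_system R xs \<and> length xs = d"
proof -
  obtain S where S: "S \<subseteq> R" "finite S" "card S = d" "R \<inter> pos = Idl\<^bsub>subring_of K R\<^esub> S"
    using r unfolding regular_local_ring_def max_ideal_dominated[OF R] by auto
  obtain xs where xs: "set xs = S" "length xs = card S" using finite_distinct_list[OF S(2)] distinct_card by metis
  have "Sup {enat n | n. \<exists>p. prime_chain (subring_of K R) n p} = enat d"
    using r unfolding regular_local_ring_def krull_dim_def by simp
  from enat_Sup_attained[OF this d] have "\<exists>p. prime_chain (subring_of K R) d p" .
  then have "regular_system R xs" unfolding regular_system_def using R r S xs unfolding regular_local_ring_def by auto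
  then show ?thesis using xs S by auto
qed

end

theorem lqt_setting_properties:
  fixes K :: "('a, 'b) ring_scheme"
  assumes s: "lqt_setting K d R V v Rs"
  shows "is_DVR (subring_of K V) \<Longrightarrow> value_sum K v Rs = \<infinity> \<and> (\<Union>n. Rs n) = V"
    and "value_sum K v Rs = \<infinity> \<Longrightarrow> switches_strongly_infinitely_often K Rs"
    and "2 \<le> rational_rank K v \<Longrightarrow> value_sum K v Rs < \<infinity>"
    and "value_sum K v Rs = \<infinity> \<Longrightarrow> rational_rank K v = 1"
proof -
  note s' = s[unfolded lqt_setting_def real_valuation_domain_def lqt_sequence_def]
  interpret field K using s' by auto
  interpret valued_field K V v using s' by unfold_locales auto
  have R: "subring R K" "R \<subseteq> V" using s' unfolding birationally_dominates_def by auto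
  have frac: "V \<subseteq> fraction_field K R" using s' unfolding birationally_dominates_def by auto
  have reglocal: "regular_local_ring (subring_of K R) d" and d: "2 \<le> d" using s' by auto
  have domR: "dominated R"
  proof (rule dominated_local_noetherian[OF R])
    show "local_ring (subring_of K R)" "noetherian_ring (subring_of K R)"
      using reglocal unfolding regular_local_ring_def by auto
    show "max_ideal (subring_of K R) \<subseteq> pos"
      using s' max_ideal_dominated[OF V_dominated] unfolding birationally_dominates_def by auto
  qed
  have alg: "residually_algebraic R" using residually_algebraic_of_zero_dimensional[OF domR] s' by auto
  obtain xs0 where xs0: "regular_system R xs0" "length xs0 = d"
    using reg_of_regular_local_ring[OF domR reglocal] d by auto
  have Rs0: "Rs 0 = R" using s' by auto
  have "hd xs0 \<in> set xs0" using xs0(2) d by (intro hd_in_set) auto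
  then have nz: "\<exists>z\<in>R \<inter> pos. z \<noteq> \<zero>\<^bsub>K\<^esub>" using parameter_nonzero[OF xs0(1)] by auto
  interpret quadratic_sequence K V v Rs
    by unfold_locales (use Rs0 domR nz s' in simp_all)
  have regn: "\<exists>xs. regular_system (Rs n) xs \<and> 2 \<le> length xs" for n
  proof (induction n)
    case 0
    then show ?case using xs0 Rs0 d by auto
  next
    case (Suc n)
    then obtain xs where xs: "regular_system (Rs n) xs" "2 \<le> length xs" by auto
    have "residually_algebraic (Rs n)"
      using residually_algebraic_mono[OF alg] initial_sub[of n] Rs0 by auto
    from reg_blowup[OF xs(1) t(1) this] t(2)[of n] xs(2) show ?case by auto
  qed
  have V: "\<forall>x\<in>carrier K - {\<zero>\<^bsub>K\<^esub>}. x \<in> V \<or> inv\<^bsub>K\<^esub> x \<in> V" using s' unfolding valuation_domain_def by auto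
  show "value_sum K v Rs = \<infinity> \<and> (\<Union>n. Rs n) = V" if DVR: "is_DVR (subring_of K V)"
  proof
    obtain c where c: "0 < c" "\<forall>z\<in>pos. ereal c \<le> v z"
      using DVR_value_bound[OF DVR t_facts(4,2)] by auto
    show inf: "value_sum K v Rs = \<infinity>" unfolding value_sum_eq
      by (rule suminf_ereal_infinite[OF c(1)]) (use c(2) t_facts(4) in simp)
    show "(\<Union>n. Rs n) = V" using union_eq_V[OF inf] frac Rs0 by simp
  qed
  show "switches_strongly_infinitely_often K Rs" if inf: "value_sum K v Rs = \<infinity>"
    using union_eq_V[OF inf] frac Rs0 by (intro switches_of_union regn) simp
  have rank: "rational_rank K v = 1" if "\<not> value_sum K v Rs < \<infinity>"
  proof (rule rational_rank_one_of_commensurable[OF _ V])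
    show "V \<subseteq> fraction_field K (Rs 0)" using frac Rs0 by simp
    show "\<alpha> / \<beta> \<in> \<rat>" if "a \<in> Rs 0 \<inter> pos" "b \<in> Rs 0 \<inter> pos" "v a = ereal \<alpha>" "v b = ereal \<beta>" for a b \<alpha> \<beta>
      using value_sum_finite_of_irrational[OF that] \<open>\<not> value_sum K v Rs < \<infinity>\<close> by auto
  qed
  show "value_sum K v Rs < \<infinity>" if "2 \<le> rational_rank K v"
  proof (rule ccontr)
    assume "\<not> ?thesis"
    then show False using rank that by (simp add: one_enat_def numeral_eq_enat)
  qed
  show "rational_rank K v = 1" if "value_sum K v Rs = \<infinity>"
    using rank that by simp
qed

section \<open>Valuations of rational rank one on the rational function field\<close>

definition ring_hom_pred :: "('a::comm_ring_1 \<Rightarrow> 'b::comm_ring_1) \<Rightarrow> bool" where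
  "ring_hom_pred h \<longleftrightarrow> h 0 = 0 \<and> h 1 = 1 \<and> (\<forall>a b. h (a + b) = h a + h b) \<and> (\<forall>a b. h (a * b) = h a * h b)"

lemma ring_hom_predD:
  assumes "ring_hom_pred h"
  shows "h 0 = 0" "h 1 = 1" "h (a + b) = h a + h b" "h (a * b) = h a * h b" "h (a - b) = h a - h b" "h (a ^ n) = h a ^ n"
proof -
  show *: "h 0 = 0" "h 1 = 1" "h (a + b) = h a + h b" "h (a * b) = h a * h b" for a b
    using assms unfolding ring_hom_pred_def by auto
  show "h (a - b) = h a - h b" using *(3)[of "a - b" b] by (simp add: algebra_simps)
  show "h (a ^ n) = h a ^ n" by (induction n) (use * in auto)
qed

definition poly_hom :: "('a::comm_ring_1 \<Rightarrow> 'b::comm_ring_1) \<Rightarrow> 'b \<Rightarrow> 'a poly \<Rightarrow> 'b" where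
  "poly_hom h a p = poly (map_poly h p) a"

lemma poly_hom_pCons:
  assumes "ring_hom_pred h" shows "poly_hom h a (pCons c p) = h c + a * poly_hom h a p"
  unfolding poly_hom_def using ring_hom_predD(1)[OF assms] by (simp add: map_poly_pCons)

lemma
  assumes "ring_hom_pred h"
  shows poly_hom_const: "poly_hom h a [:c:] = h c" and poly_hom_var: "poly_hom h a [:0, 1:] = a"
proof -
  have "poly_hom h a 0 = 0" unfolding poly_hom_def by simp
  then show "poly_hom h a [:c:] = h c" "poly_hom h a [:0, 1:] = a"
    using ring_hom_predD(1,2)[OF assms] by (simp_all add: poly_hom_pCons[OF assms])
qed

lemma poly_hom_ring_hom:
  assumes h: "ring_hom_pred h" shows "ring_hom_pred (poly_hom h a)"
proof -
  note hD = ring_hom_predD[OF h] note pC = poly_hom_pCons[OF h]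
  have z: "poly_hom h a 0 = 0" unfolding poly_hom_def by simp
  have add: "poly_hom h a (p + q) = poly_hom h a p + poly_hom h a q" for p q
    by (induction p q rule: poly_induct2) (simp_all add: z pC hD algebra_simps)
  have smult: "poly_hom h a (Polynomial.smult c q) = h c * poly_hom h a q" for c q
    by (induction q) (simp_all add: z pC hD algebra_simps)
  have mult: "poly_hom h a (p * q) = poly_hom h a p * poly_hom h a q" for p q
    by (induction p) (simp_all add: z pC hD add smult algebra_simps)
  have "poly_hom h a 1 = 1" using pC[of a 1 0] by (simp add: z hD one_pCons)
  then show ?thesis unfolding ring_hom_pred_def using z add mult by auto
qed

lemma poly_hom_sum:
  assumes h: "ring_hom_pred h" and n: "Polynomial.degree p \<le> n"
  shows "poly_hom h a p = (\<Sum>i\<le>n. h (Polynomial.coeff p i) * a ^ i)"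
proof -
  note hD = ring_hom_predD[OF h]
  have "Polynomial.degree (map_poly h p) \<le> n" 
    by (rule degree_le) (use n in \<open>auto simp: coeff_map_poly hD coeff_eq_0\<close>)
  then have "poly_hom h a p = (\<Sum>i\<le>n. Polynomial.coeff (map_poly h p) i * a ^ i)"
    unfolding poly_hom_def by (simp add: poly_altdef) (intro sum.mono_neutral_left, auto intro: le_degree)
  then show ?thesis by (simp add: coeff_map_poly hD)
qed

abbreviation T1 :: "rat poly" where "T1 \<equiv> [:1, 1:]"

abbreviation const2 :: "rat \<Rightarrow> rat poly poly" where "const2 c \<equiv> [:[:c:]:]"

text \<open>Polynomials in \<open>x\<close> whose coefficients are polynomials in \<open>y\<close>.\<close>

abbreviation x_var :: "rat poly poly" where "x_var \<equiv> [:0, 1:]"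

abbreviation y_var :: "rat poly poly" where "y_var \<equiv> [:[:0, 1:]:]"

text \<open>The substitution \<open>x \<mapsto> x\<^sup>2 (1 + y)\<close>, \<open>y \<mapsto> x\<^bsup>2 N + 1\<^esup> (1 + y)\<^bsup>N + 1\<^esup>\<close>, which expresses the
  coordinates of a regular local ring by those obtained after \<open>N + 2\<close> quadratic transforms.\<close>

definition blow :: "nat \<Rightarrow> rat poly poly \<Rightarrow> rat poly poly" where
  "blow N = poly_hom (poly_hom const2 (Polynomial.monom (T1 ^ (N + 1)) (2 * N + 1))) (Polynomial.monom T1 2)"

lemma const2_hom: "ring_hom_pred const2"
  unfolding ring_hom_pred_def by (auto simp: one_pCons)

lemma blow_hom: "ring_hom_pred (blow N)"
  unfolding blow_def by (intro poly_hom_ring_hom const2_hom)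

lemmas blow_simps = ring_hom_predD[OF blow_hom]

lemma blow_vars:
  "blow N x_var = Polynomial.monom T1 2" "blow N (const2 c) = const2 c"
  "blow N y_var = Polynomial.monom (T1 ^ (N + 1)) (2 * N + 1)"
proof -
  have 1: "ring_hom_pred (poly_hom const2 (Polynomial.monom (T1 ^ (N + 1)) (2 * N + 1)))"
    by (intro poly_hom_ring_hom const2_hom)
  show "blow N x_var = Polynomial.monom T1 2" unfolding blow_def by (rule poly_hom_var[OF 1])
  show "blow N (const2 c) = const2 c"
    unfolding blow_def poly_hom_const[OF 1] by (rule poly_hom_const[OF const2_hom])
  show "blow N y_var = Polynomial.monom (T1 ^ (N + 1)) (2 * N + 1)"
    unfolding blow_def poly_hom_const[OF 1] by (rule poly_hom_var[OF const2_hom])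
qed

text \<open>The monomial \<open>x^a y^b\<close> is mapped to
  \<open>x^(2 a + (2 N + 1) b) (1 + y)^(a + (N + 1) b)\<close>. A common bound \<open>D\<close> for
  both degrees gives a double sum over a square.\<close>

lemma blow_expand:
  assumes "Polynomial.degree u \<le> D" "\<And>a. Polynomial.degree (Polynomial.coeff u a) \<le> D"
  shows "blow N u = (\<Sum>a\<le>D. \<Sum>b\<le>D. Polynomial.monom
    (Polynomial.smult (Polynomial.coeff (Polynomial.coeff u a) b) (T1 ^ (a + (N + 1) * b))) (2 * a + (2 * N + 1) * b))"
proof -
  have 1: "ring_hom_pred (poly_hom const2 (Polynomial.monom (T1 ^ (N + 1)) (2 * N + 1)))"
    by (intro poly_hom_ring_hom const2_hom)
  have "blow N u = (\<Sum>a\<le>D. poly_hom const2 (Polynomial.monom (T1 ^ (N + 1)) (2 * N + 1)) (Polynomial.coeff u a) * Polynomial.monom T1 2 ^ a)"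
    unfolding blow_def by (rule poly_hom_sum[OF 1 assms(1)])
  also have "\<dots> = (\<Sum>a\<le>D. \<Sum>b\<le>D. (const2 (Polynomial.coeff (Polynomial.coeff u a) b) *
      Polynomial.monom (T1 ^ (N + 1)) (2 * N + 1) ^ b) * Polynomial.monom T1 2 ^ a)"
    using poly_hom_sum[OF const2_hom assms(2)] by (simp add: sum_distrib_right)
  also have "\<dots> = (\<Sum>a\<le>D. \<Sum>b\<le>D. Polynomial.monom
    (Polynomial.smult (Polynomial.coeff (Polynomial.coeff u a) b) (T1 ^ (a + (N + 1) * b))) (2 * a + (2 * N + 1) * b))"
  proof (intro sum.cong refl)
    fix a b
    have "Polynomial.monom (T1 ^ (N + 1)) (2 * N + 1) ^ b * Polynomial.monom T1 2 ^ a =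
      Polynomial.monom (T1 ^ (a + (N + 1) * b)) (2 * a + (2 * N + 1) * b)"
      unfolding monom_power mult_monom power_mult[symmetric] power_add[symmetric]
      by (simp only: add.commute mult.commute)
    then show "(const2 (Polynomial.coeff (Polynomial.coeff u a) b) *
      Polynomial.monom (T1 ^ (N + 1)) (2 * N + 1) ^ b) * Polynomial.monom T1 2 ^ a =
      Polynomial.monom (Polynomial.smult (Polynomial.coeff (Polynomial.coeff u a) b) (T1 ^ (a + (N + 1) * b))) (2 * a + (2 * N + 1) * b)"
      by (simp add: mult.assoc smult_monom)
  qed
  finally show ?thesis .
qed

section \<open>Order in x and the effect of one substitution\<close>

definition ordx :: "rat poly poly \<Rightarrow> nat" where "ordx f = Polynomial.order 0 f"

definition low :: "rat poly poly \<Rightarrow> rat poly" where "low f = Polynomial.coeff f (ordx f)"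

lemma x_power: "x_var ^ n = Polynomial.monom 1 n"
  by (simp add: monom_altdef)

lemma coeff_x_mult: "Polynomial.coeff (x_var ^ n * f) (n + m) = Polynomial.coeff f m"
  unfolding x_power by (simp add: coeff_monom_mult)

lemma ordx_decomp:
  assumes "f \<noteq> 0" obtains u where "f = x_var ^ ordx f * u" "Polynomial.coeff u 0 \<noteq> 0" "low f = Polynomial.coeff u 0"
proof -
  obtain u where u: "f = [:- 0, 1:] ^ Polynomial.order 0 f * u" "\<not> [:- 0, 1:] dvd u"
    using order_decomp[OF assms, of 0] by auto
  have "poly u 0 \<noteq> 0" using u(2) by (simp add: poly_eq_0_iff_dvd)
  then have 0: "Polynomial.coeff u 0 \<noteq> 0" by (simp add: poly_0_coeff_0)
  have f: "f = x_var ^ ordx f * u" using u(1) unfolding ordx_def by simp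
  moreover have "low f = Polynomial.coeff u 0" unfolding low_def
    by (subst f) (use coeff_x_mult[of "ordx f" u 0] in simp)
  ultimately show thesis using that 0 by blast
qed

lemma ordx_eqI:
  assumes "f = x_var ^ n * u" "Polynomial.coeff u 0 \<noteq> 0"
  shows "f \<noteq> 0" "ordx f = n" "low f = Polynomial.coeff u 0"
proof -
  have u: "u \<noteq> 0" using assms(2) by auto
  show f: "f \<noteq> 0" unfolding assms(1) using u by simp
  have "Polynomial.order 0 u = 0" using assms(2) by (intro order_0I) (simp add: poly_0_coeff_0)
  moreover have "Polynomial.order 0 ([:- 0, 1:] ^ n :: rat poly poly) = n" by (rule order_power_n_n)
  ultimately show o: "ordx f = n" unfolding ordx_def assms(1)
    using order_mult[of "x_var ^ n" u "0::rat poly"] u by simp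
  show "low f = Polynomial.coeff u 0" unfolding low_def o unfolding assms(1)
    using coeff_x_mult[of n u 0] by simp
qed

lemma ordx_mult:
  assumes "f \<noteq> 0" "g \<noteq> 0" shows "ordx (f * g) = ordx f + ordx g" "low (f * g) = low f * low g"
proof -
  obtain u where u: "f = x_var ^ ordx f * u" "Polynomial.coeff u 0 \<noteq> 0" "low f = Polynomial.coeff u 0"
    using ordx_decomp[OF assms(1)] .
  obtain w where w: "g = x_var ^ ordx g * w" "Polynomial.coeff w 0 \<noteq> 0" "low g = Polynomial.coeff w 0"
    using ordx_decomp[OF assms(2)] .
  have "f * g = x_var ^ (ordx f + ordx g) * (u * w)"
    by (subst u(1), subst w(1)) (simp only: power_add ac_simps)
  moreover have "Polynomial.coeff (u * w) 0 = low f * low g" using u w by (simp add: coeff_mult_0)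
  ultimately show "ordx (f * g) = ordx f + ordx g" "low (f * g) = low f * low g"
    using ordx_eqI(2,3)[of "f * g" _ "u * w"] u w by auto
qed

lemma ordx_ge_iff: assumes "f \<noteq> 0" shows "n \<le> ordx f \<longleftrightarrow> x_var ^ n dvd f"
  using assms order_divides[of 0 n f] unfolding ordx_def by simp

text \<open>A power of \<open>x\<close> times a unit of the local ring at the origin, so that the
  value is that of the power of \<open>x\<close>.\<close>

definition good :: "rat poly poly \<Rightarrow> bool" where "good f \<longleftrightarrow> f \<noteq> 0 \<and> poly (low f) 0 \<noteq> 0"

text \<open>With \<open>f = x^e u\<close> and \<open>u\<close> not divisible by \<open>x\<close>,
  the intersection multiplicity at the origin of \<open>u = 0\<close> with the line
  \<open>x = 0\<close>. It measures how far \<open>f\<close> is from being good.\<close>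

definition mult_y :: "rat poly poly \<Rightarrow> nat" where "mult_y f = Polynomial.order 0 (low f)"

lemma low_nonzero: "f \<noteq> 0 \<Longrightarrow> low f \<noteq> 0" using ordx_decomp by metis

lemma good_iff: "f \<noteq> 0 \<Longrightarrow> good f \<longleftrightarrow> mult_y f = 0"
  unfolding good_def mult_y_def using order_root[of "low f" 0] low_nonzero by auto

lemma good_mult: "good f \<Longrightarrow> good g \<Longrightarrow> good (f * g)"
  unfolding good_def using ordx_mult by auto

lemma degree_bound: "\<exists>D. Polynomial.degree u \<le> D \<and> (\<forall>a. Polynomial.degree (Polynomial.coeff u a) \<le> D)"
proof -
  define D where "D = Polynomial.degree u + (\<Sum>a\<le>Polynomial.degree u. Polynomial.degree (Polynomial.coeff u a))"
  have d1: "Polynomial.degree u \<le> D" unfolding D_def by simp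
  have d2: "Polynomial.degree (Polynomial.coeff u a) \<le> D" for a
  proof (cases "a \<le> Polynomial.degree u")
    case True
    then have "Polynomial.degree (Polynomial.coeff u a) \<le> (\<Sum>a\<le>Polynomial.degree u. Polynomial.degree (Polynomial.coeff u a))"
      by (intro member_le_sum) auto
    then show ?thesis unfolding D_def by simp
  qed (simp add: coeff_eq_0)
  show ?thesis using d1 d2 by auto
qed

text \<open>Both variables go to multiples of \<open>x\<close>, so at \<open>x = 0\<close> only the
  constant term survives.\<close>

lemma coeff_blow_0: "Polynomial.coeff (blow N u) 0 = [:Polynomial.coeff (Polynomial.coeff u 0) 0:]"
proof -
  obtain D where D: "Polynomial.degree u \<le> D" "\<And>a. Polynomial.degree (Polynomial.coeff u a) \<le> D"
    using degree_bound[of u] by auto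
  define c where "c a b = Polynomial.smult (Polynomial.coeff (Polynomial.coeff u a) b) (T1 ^ (a + (N + 1) * b))" for a b
  have inner: "(\<Sum>b\<le>D. if 2 * a + (2 * N + 1) * b = 0 then c a b else 0) = (if a = 0 then c 0 0 else 0)" for a
  proof (cases "a = 0")
    case True
    then have "(\<Sum>b\<le>D. if 2 * a + (2 * N + 1) * b = 0 then c a b else 0) = (\<Sum>b\<le>D. if b = 0 then c 0 0 else 0)"
      by (intro sum.cong refl) auto
    then show ?thesis using True by simp
  qed simp
  have "Polynomial.coeff (blow N u) 0 = (\<Sum>a\<le>D. \<Sum>b\<le>D. if 2 * a + (2 * N + 1) * b = 0 then c a b else 0)"
    unfolding blow_expand[OF D] coeff_sum coeff_monom c_def ..
  also have "\<dots> = c 0 0" unfolding inner by simp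
  also have "\<dots> = [:Polynomial.coeff (Polynomial.coeff u 0) 0:]" by (simp add: c_def)
  finally show ?thesis .
qed

text \<open>The initial form of \<open>u\<close> with respect to the weights \<open>2\<close> and \<open>2 N + 1\<close> of \<open>x\<close> and \<open>y\<close> is
  mapped to \<open>x\<^bsup>M\<^esup> (1 + y)\<^bsup>k\<^esup> Q (1 + y)\<close> with \<open>deg Q \<le> r div 2\<close>, where \<open>r\<close> is the order of \<open>u (0, y)\<close>.\<close>

lemma blow_unit_part:
  assumes u: "Polynomial.coeff u 0 \<noteq> 0"
  shows "blow N u \<noteq> 0 \<and> mult_y (blow N u) \<le> Polynomial.order 0 (Polynomial.coeff u 0) div 2"
proof -
  define c where "c a b = Polynomial.coeff (Polynomial.coeff u a) b" for a b
  define r where "r = Polynomial.order 0 (Polynomial.coeff u 0)"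
  define wt where "wt a b = 2 * a + (2 * N + 1) * b" for a b :: nat
  have wt_inj: "a = a'" if "wt a b = wt a' b" for a a' b using that unfolding wt_def by simp
  have c0r: "c 0 r \<noteq> 0"
  proof -
    obtain q where q: "Polynomial.coeff u 0 = [:- 0, 1:] ^ r * q" "\<not> [:- 0, 1:] dvd q"
      using order_decomp[OF u, of 0] unfolding r_def by auto
    have "poly q 0 \<noteq> 0" using q(2) by (simp add: poly_eq_0_iff_dvd)
    moreover have "[:- 0, 1:] ^ r = (Polynomial.monom 1 r :: rat poly)" by (simp add: monom_altdef)
    then have "c 0 r = Polynomial.coeff q 0" unfolding c_def q(1) by (simp add: coeff_monom_mult)
    ultimately show ?thesis by (simp add: poly_0_coeff_0)
  qed
  define M where "M = (LEAST m. \<exists>a b. c a b \<noteq> 0 \<and> wt a b = m)"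
  have "\<exists>a b. c a b \<noteq> 0 \<and> wt a b = M" unfolding M_def by (rule LeastI_ex) (use c0r in blast)
  then obtain a0 b0 where ab0: "c a0 b0 \<noteq> 0" "wt a0 b0 = M" by auto
  have Mmin: "M \<le> wt a b" if "c a b \<noteq> 0" for a b unfolding M_def by (rule Least_le) (use that in auto)
  have Mr: "M \<le> (2 * N + 1) * r" using Mmin[OF c0r] unfolding wt_def by simp
  \<comment> \<open>The monomial \<open>y^r\<close> occurs in \<open>u\<close>, so
    \<open>M \<le> (2 N + 1) r\<close> and hence \<open>b \<le> r\<close>. As \<open>2 N + 1\<close>
    is odd, \<open>b\<close> has the parity of \<open>M\<close>, and the exponent of
    \<open>1 + y\<close> is a constant plus \<open>b div 2\<close>.\<close>
  have br: "b \<le> r" and par: "a + (N + 1) * b = (M + 1) div 2 + b div 2" and par2: "b mod 2 = M mod 2" if "wt a b = M" for a b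
  proof -
    have "(2 * N + 1) * b \<le> (2 * N + 1) * r" using that Mr unfolding wt_def by linarith
    then show "b \<le> r" by (metis mult_le_cancel1 zero_less_Suc Suc_eq_plus1)
    have e: "M = 2 * (a + N * b) + b" using that unfolding wt_def by (simp add: algebra_simps)
    have e2: "a + (N + 1) * b = (a + N * b) + b" by (simp add: algebra_simps)
    show "a + (N + 1) * b = (M + 1) div 2 + b div 2" unfolding e e2 by presburger
    show "b mod 2 = M mod 2" unfolding e by (simp only: mod_mult_self4)
  qed
  obtain D where D: "Polynomial.degree u \<le> D" "\<And>a. Polynomial.degree (Polynomial.coeff u a) \<le> D"
    using degree_bound[of u] by auto
  have cf: "Polynomial.coeff (blow N u) m = (\<Sum>a\<le>D. \<Sum>b\<le>D. if wt a b = m then Polynomial.smult (c a b) (T1 ^ (a + (N + 1) * b)) else 0)" for m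
    unfolding blow_expand[OF D] coeff_sum coeff_monom wt_def c_def ..
  have low0: "Polynomial.coeff (blow N u) m = 0" if "m < M" for m unfolding cf
    using Mmin that by (intro sum.neutral ballI) (auto, metis not_less smult_0_left)
  \<comment> \<open>The polynomial \<open>Q\<close> before \<open>1 + y\<close> is substituted for
    its variable. Since \<open>b\<close> has a fixed parity and \<open>a\<close> is determined by
    \<open>b\<close>, distinct monomials of weight \<open>M\<close> have distinct
    \<open>b div 2\<close>, so no terms cancel and \<open>H\<close> is not zero.\<close>
  define H where "H = (\<Sum>a\<le>D. \<Sum>b\<le>D. if wt a b = M then Polynomial.monom (c a b) (b div 2) else 0)"
  have a0D: "a0 \<le> D"
  proof (rule ccontr)
    assume "\<not> ?thesis"
    then have "Polynomial.coeff u a0 = 0" using D(1) by (intro coeff_eq_0) simp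
    then show False using ab0 unfolding c_def by simp
  qed
  have b0D: "b0 \<le> D"
  proof (rule ccontr)
    assume "\<not> ?thesis"
    then have "c a0 b0 = 0" unfolding c_def using D(2)[of a0] by (intro coeff_eq_0) simp
    then show False using ab0 by simp
  qed
  have "Polynomial.coeff H (b0 div 2) = (\<Sum>a\<le>D. \<Sum>b\<le>D. if a = a0 \<and> b = b0 then c a0 b0 else 0)"
    unfolding H_def coeff_sum
  proof (intro sum.cong refl)
    fix a b
    have "a = a0 \<and> b = b0" if "wt a b = M" "b div 2 = b0 div 2"
    proof -
      have "b mod 2 = b0 mod 2" using par2[OF that(1)] par2[OF ab0(2)] by simp
      then have "b = b0" using that(2) by (metis div_mult_mod_eq)
      then show ?thesis using wt_inj[of a b a0] that(1) ab0(2) by simp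
    qed
    note key = this
    show "Polynomial.coeff (if wt a b = M then Polynomial.monom (c a b) (b div 2) else 0) (b0 div 2) =
      (if a = a0 \<and> b = b0 then c a0 b0 else 0)"
    proof (cases "wt a b = M \<and> b div 2 = b0 div 2")
      case True
      with key have "a = a0" "b = b0" by blast+
      then show ?thesis using ab0(2) by simp
    next
      case False
      then have n: "(a = a0 \<and> b = b0) = False" using ab0(2) by blast
      show ?thesis unfolding n if_False using False by (cases "wt a b = M") auto
    qed
  qed
  also have "\<dots> = (\<Sum>a\<le>D. if a = a0 then (\<Sum>b\<le>D. if b = b0 then c a0 b0 else 0) else 0)"
    by (intro sum.cong refl) auto
  also have "\<dots> = c a0 b0" using a0D b0D by (simp add: sum.delta)
  finally have H0: "H \<noteq> 0" using ab0(1) by auto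
  have Hdeg: "Polynomial.degree H \<le> r div 2" unfolding H_def
  proof (intro degree_sum_le finite_atMost)
    fix a b
    show "Polynomial.degree (if wt a b = M then Polynomial.monom (c a b) (b div 2) else 0) \<le> r div 2"
      using br[of a b] degree_monom_le[of "c a b" "b div 2"] div_le_mono[of b r 2] by auto
  qed
  define Q where "Q = pcompose H T1"
  have pm: "pcompose (Polynomial.monom k n) T = Polynomial.smult k (T ^ n)" for k :: rat and n T
    by (induction n) (simp_all add: monom_0 monom_Suc pcompose_pCons)
  have cM: "Polynomial.coeff (blow N u) M = T1 ^ ((M + 1) div 2) * Q"
  proof -
    define T where "T = T1"
    have "Q = (\<Sum>a\<le>D. \<Sum>b\<le>D. pcompose (if wt a b = M then Polynomial.monom (c a b) (b div 2) else 0) T)"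
      unfolding Q_def H_def T_def by (simp add: pcompose_sum)
    also have "\<dots> = (\<Sum>a\<le>D. \<Sum>b\<le>D. if wt a b = M then Polynomial.smult (c a b) (T ^ (b div 2)) else 0)"
      by (intro sum.cong refl) (auto simp: pm)
    finally have "T ^ ((M + 1) div 2) * Q =
      (\<Sum>a\<le>D. \<Sum>b\<le>D. T ^ ((M + 1) div 2) * (if wt a b = M then Polynomial.smult (c a b) (T ^ (b div 2)) else 0))"
      by (simp only: sum_distrib_left)
    also have "\<dots> = (\<Sum>a\<le>D. \<Sum>b\<le>D. if wt a b = M then Polynomial.smult (c a b) (T ^ (a + (N + 1) * b)) else 0)"
    proof (intro sum.cong refl)
      fix a b
      show "T ^ ((M + 1) div 2) * (if wt a b = M then Polynomial.smult (c a b) (T ^ (b div 2)) else 0) =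
        (if wt a b = M then Polynomial.smult (c a b) (T ^ (a + (N + 1) * b)) else 0)"
        using par[of a b] by (simp add: power_add)
    qed
    finally show ?thesis unfolding cf T_def ..
  qed
  have "Polynomial.degree T1 = 1" by simp
  then have Q0: "Q \<noteq> 0" unfolding Q_def using H0 pcompose_eq_0[of H T1] by auto
  have "Polynomial.degree Q \<le> r div 2" unfolding Q_def using Hdeg by (simp add: degree_pcompose)
  \<comment> \<open>The order at \<open>0\<close> is bounded by the degree, and the powers of
    \<open>1 + y\<close> contribute nothing to it.\<close>
  then have oQ: "Polynomial.order 0 Q \<le> r div 2" using order_degree[OF Q0, of 0] by simp
  have TQ: "T1 ^ k * Q \<noteq> 0" for k using Q0 by simp
  have T0: "Polynomial.order 0 (T1 ^ k) = 0" for k by (intro order_0I) simp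
  have bu: "blow N u \<noteq> 0" using TQ[of "(M + 1) div 2"] unfolding cM[symmetric] by auto
  obtain w where w: "blow N u = x_var ^ ordx (blow N u) * w" "Polynomial.coeff w 0 \<noteq> 0" "low (blow N u) = Polynomial.coeff w 0"
    using ordx_decomp[OF bu] .
  have cw: "Polynomial.coeff (blow N u) (ordx (blow N u)) \<noteq> 0" using w low_def by metis
  have "Polynomial.coeff (blow N u) k = 0" if "k < ordx (blow N u)" for k
    by (subst w(1)) (use that in \<open>simp add: x_power coeff_monom_mult\<close>)
  then have "ordx (blow N u) = M"
    using cw low0 TQ[of "(M + 1) div 2"] unfolding cM[symmetric] by (metis linorder_neqE_nat)
  then have "mult_y (blow N u) = Polynomial.order 0 Q"
    unfolding mult_y_def low_def using cM order_mult[OF TQ, of 0] T0 by simp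
  then show ?thesis using bu oQ unfolding r_def by simp
qed

text \<open>After splitting off a power of \<open>x\<close> this is \<open>blow_unit_part\<close>,
  because \<open>x\<close> goes to \<open>x^2\<close> times \<open>1 + y\<close>, which does not
  vanish at the origin. As \<open>m div 2 < m\<close> for positive \<open>m\<close>, repeated
  substitution makes every nonzero polynomial good.\<close>

lemma blow_general:
  assumes f: "f \<noteq> 0"
  shows "blow N f \<noteq> 0" "2 * ordx f \<le> ordx (blow N f)" "mult_y (blow N f) \<le> mult_y f div 2"
    "good f \<Longrightarrow> ordx (blow N f) = 2 * ordx f \<and> good (blow N f)"
proof -
  obtain u where u: "f = x_var ^ ordx f * u" "Polynomial.coeff u 0 \<noteq> 0" "low f = Polynomial.coeff u 0"
    using ordx_decomp[OF f] .
  define e where "e = ordx f"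
  have bu: "blow N u \<noteq> 0" "mult_y (blow N u) \<le> Polynomial.order 0 (Polynomial.coeff u 0) div 2"
    using blow_unit_part[OF u(2)] by auto
  have "blow N f = Polynomial.monom T1 2 ^ e * blow N u"
    using u(1) unfolding e_def by (metis blow_simps(4,6) blow_vars(1))
  define g where "g = Polynomial.monom T1 2 ^ e"
  have "g = x_var ^ (2 * e) * [:T1 ^ e:]" unfolding g_def x_power
    by (simp add: monom_power mult_monom monom_0[symmetric] del: monom_0 pCons_one)
  from ordx_eqI[OF this] have g: "g \<noteq> 0" "ordx g = 2 * e" "low g = T1 ^ e" by simp_all
  have bf: "blow N f = g * blow N u" using \<open>blow N f = _\<close> g_def by simp
  show "blow N f \<noteq> 0" using bf g bu by simp
  have o: "ordx (blow N f) = 2 * e + ordx (blow N u)" "low (blow N f) = T1 ^ e * low (blow N u)"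
    unfolding bf using ordx_mult[OF g(1) bu(1)] g by simp_all
  show "2 * ordx f \<le> ordx (blow N f)" using o e_def by simp
  have T0: "Polynomial.order 0 (T1 ^ e) = 0" by (intro order_0I) simp
  have "mult_y (blow N f) = mult_y (blow N u)" unfolding mult_y_def o
    using order_mult[of "T1 ^ e" "low (blow N u)" 0] low_nonzero[OF bu(1)] T0 by simp
  then show "mult_y (blow N f) \<le> mult_y f div 2" using bu(2) unfolding mult_y_def u(3) by simp
  assume gf: "good f"
  then have c: "Polynomial.coeff (Polynomial.coeff u 0) 0 \<noteq> 0" unfolding good_def u(3) by (simp add: poly_0_coeff_0)
  have "blow N u = x_var ^ 0 * blow N u" by simp
  from ordx_eqI[OF this] have "ordx (blow N u) = 0" "low (blow N u) = [:Polynomial.coeff (Polynomial.coeff u 0) 0:]"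
    using c unfolding coeff_blow_0 by simp_all
  then show "ordx (blow N f) = 2 * ordx f \<and> good (blow N f)"
    using o \<open>blow N f \<noteq> 0\<close> c unfolding good_def e_def by simp
qed

section \<open>Iterated substitutions and the value of a polynomial\<close>

primrec blows :: "(nat \<Rightarrow> nat) \<Rightarrow> nat \<Rightarrow> rat poly poly \<Rightarrow> rat poly poly" where
  "blows N 0 f = f"
| "blows N (Suc n) f = blow (N n) (blows N n f)"

text \<open>The recursion adds the last substitution; inductions on the polynomial need the first
  one split off, which shifts the sequence \<open>N\<close>.\<close>

lemma blows_shift: "blows N (Suc n) f = blows (\<lambda>i. N (Suc i)) n (blow (N 0) f)"
  by (induction n) auto

lemma blows_hom: "ring_hom_pred (blows N n)"
  by (induction n) (use blow_simps in \<open>auto simp: ring_hom_pred_def\<close>)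

lemma blows_const: "blows N n (const2 c) = const2 c"
  by (induction n) (auto simp: blow_vars)

lemma blows_nonzero: "f \<noteq> 0 \<Longrightarrow> blows N n f \<noteq> 0"
  by (induction n) (use blow_general(1) in auto)

lemma blows_good_mono: "good (blows N m f) \<Longrightarrow> m \<le> n \<Longrightarrow> good (blows N n f) \<and> ordx (blows N n f) = 2 ^ (n - m) * ordx (blows N m f)"
proof (induction n)
  case (Suc n)
  show ?case
  proof (cases "m = Suc n")
    case False
    then have mn: "m \<le> n" using Suc by simp
    then have IH: "good (blows N n f)" "ordx (blows N n f) = 2 ^ (n - m) * ordx (blows N m f)" using Suc by auto
    then have "blows N n f \<noteq> 0" unfolding good_def by auto
    from blow_general(4)[OF this IH(1), of "N n"] show ?thesis using IH mn by (simp add: Suc_diff_le)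
  qed (use Suc in simp)
qed simp

lemma blows_ordx_mono: "f \<noteq> 0 \<Longrightarrow> m \<le> n \<Longrightarrow> 2 ^ (n - m) * ordx (blows N m f) \<le> ordx (blows N n f)"
proof (induction n)
  case (Suc n)
  show ?case
  proof (cases "m = Suc n")
    case False
    then have mn: "m \<le> n" using Suc by simp
    then have IH: "2 ^ (n - m) * ordx (blows N m f) \<le> ordx (blows N n f)" using Suc by auto
    then show ?thesis using blow_general(2)[OF blows_nonzero[OF Suc(2)], of N n "N n"] mn by (simp add: Suc_diff_le)
  qed simp
qed simp

lemma blows_good: "f \<noteq> 0 \<Longrightarrow> \<exists>n. good (blows N n f)"
proof (induction "mult_y f" arbitrary: f N rule: less_induct)
  case less
  show ?case
  proof (cases "mult_y f = 0")
    case True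
    then have "good (blows N 0 f)" using good_iff less by simp
    then show ?thesis by blast
  next
    case False
    then have "mult_y (blow (N 0) f) < mult_y f" using blow_general(3)[OF less(2), of "N 0"] by simp
    then have "\<exists>n. good (blows (\<lambda>i. N (Suc i)) n (blow (N 0) f))" using less(1) blow_general(1)[OF less(2)] by blast
    then show ?thesis using blows_shift by metis
  qed
qed

text \<open>The order in the coordinate reached after \<open>n\<close> substitutions, whose value is
  \<open>1 / 2^n\<close>. From the first good stage on the order doubles each time, so every later
  stage gives the same number.\<close>

definition pval :: "(nat \<Rightarrow> nat) \<Rightarrow> rat poly poly \<Rightarrow> real" where
  "pval N f = (let n = LEAST n. good (blows N n f) in real (ordx (blows N n f)) / 2 ^ n)"

lemma pval_eq: assumes g: "good (blows N n f)" shows "pval N f = real (ordx (blows N n f)) / 2 ^ n"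
proof -
  define m where "m = (LEAST n. good (blows N n f))"
  have m: "good (blows N m f)" "m \<le> n" unfolding m_def using g by (auto intro: LeastI Least_le)
  have "(2::real) ^ n = 2 ^ (n - m) * 2 ^ m" using m(2) by (simp add: power_add[symmetric])
  then show ?thesis unfolding pval_def Let_def m_def[symmetric] using blows_good_mono[OF m] by simp
qed

text \<open>At any stage the order at least doubles in passing to the next, so the normalized orders
  increase towards the value.\<close>

lemma pval_ge: assumes "f \<noteq> 0" shows "real (ordx (blows N n f)) / 2 ^ n \<le> pval N f"
proof -
  obtain k where "good (blows N k f)" using blows_good[OF assms] by auto
  then have g: "good (blows N (max k n) f)" using blows_good_mono by auto
  have "2 ^ (max k n - n) * ordx (blows N n f) \<le> ordx (blows N (max k n) f)" using blows_ordx_mono[OF assms] by simp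
  then have "real (2 ^ (max k n - n) * ordx (blows N n f)) \<le> real (ordx (blows N (max k n) f))" by (rule of_nat_mono)
  moreover have "(2::real) ^ (max k n) = 2 ^ (max k n - n) * 2 ^ n" by (simp add: power_add[symmetric])
  ultimately show ?thesis unfolding pval_eq[OF g] by (simp add: field_simps)
qed

lemma common_good:
  assumes "f \<noteq> 0" "g \<noteq> 0" obtains n where "good (blows N n f)" "good (blows N n g)"
proof -
  obtain k l where "good (blows N k f)" "good (blows N l g)" using blows_good assms by metis
  then show thesis using that[of "max k l"] blows_good_mono by auto
qed

lemma pval_mult: assumes "f \<noteq> 0" "g \<noteq> 0" shows "pval N (f * g) = pval N f + pval N g"
proof -
  obtain n where n: "good (blows N n f)" "good (blows N n g)" using common_good[OF assms] .
  have h: "blows N n (f * g) = blows N n f * blows N n g" using ring_hom_predD(4)[OF blows_hom] .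
  have "good (blows N n (f * g))" unfolding h by (rule good_mult[OF n])
  from pval_eq[OF this] show ?thesis unfolding pval_eq[OF n(1)] pval_eq[OF n(2)] h
    ordx_mult(1)[OF blows_nonzero[OF assms(1)] blows_nonzero[OF assms(2)]] by (simp add: add_divide_distrib)
qed

text \<open>A sum need not be good where its summands are. Its order at that stage still bounds its
  value from below, by \<open>pval_ge\<close>.\<close>

lemma pval_add: assumes "f \<noteq> 0" "g \<noteq> 0" "f + g \<noteq> 0" shows "min (pval N f) (pval N g) \<le> pval N (f + g)"
proof -
  obtain n where n: "good (blows N n f)" "good (blows N n g)" using common_good[OF assms(1,2)] .
  define k where "k = min (ordx (blows N n f)) (ordx (blows N n g))"
  have "k \<le> ordx (blows N n f)" "k \<le> ordx (blows N n g)" unfolding k_def by auto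
  then have "x_var ^ k dvd blows N n f" "x_var ^ k dvd blows N n g"
    unfolding ordx_ge_iff[OF blows_nonzero[OF assms(1)]] ordx_ge_iff[OF blows_nonzero[OF assms(2)]] .
  then have "x_var ^ k dvd blows N n (f + g)" using ring_hom_predD(3)[OF blows_hom] by simp
  then have "k \<le> ordx (blows N n (f + g))" using ordx_ge_iff[OF blows_nonzero[OF assms(3)]] by simp
  then have "real k / 2 ^ n \<le> pval N (f + g)" using pval_ge[OF assms(3), of N n] by (meson divide_right_mono of_nat_mono order_trans zero_le_numeral zero_le_power)
  moreover have "min (pval N f) (pval N g) \<le> real k / 2 ^ n" unfolding pval_eq[OF n(1)] pval_eq[OF n(2)] k_def
    by (simp add: min_def)
  ultimately show ?thesis by simp
qed

lemma pval_shift: assumes "f \<noteq> 0" shows "pval N f = pval (\<lambda>i. N (Suc i)) (blow (N 0) f) / 2"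
proof -
  obtain n where "good (blows N n f)" using blows_good[OF assms] by auto
  then have g: "good (blows N (Suc n) f)" using blows_good_mono[of N n f "Suc n"] by auto
  show ?thesis using pval_eq[OF g] pval_eq[OF g[unfolded blows_shift]] unfolding blows_shift by simp
qed

lemma pval_nonneg: "f \<noteq> 0 \<Longrightarrow> 0 \<le> pval N f" using pval_ge[of f N 0] by (meson divide_nonneg_nonneg of_nat_0_le_iff order_trans zero_le_numeral zero_le_power)

lemma pval_const: assumes "c \<noteq> 0" shows "pval N (const2 c) = 0"
proof -
  have "const2 c = x_var ^ 0 * const2 c" by simp
  from ordx_eqI[OF this] assms have o: "const2 c \<noteq> 0" "ordx (const2 c) = 0" "low (const2 c) = [:c:]" by auto
  then have "good (blows N 0 (const2 c))" unfolding good_def using assms by simp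
  from pval_eq[OF this] show ?thesis using o by simp
qed

lemma pval_x: "pval N x_var = 1"
proof -
  have "x_var = x_var ^ 1 * 1" by simp
  from ordx_eqI[OF this] have o: "ordx x_var = 1" "low x_var = 1" by auto
  then have "good (blows N 0 x_var)" unfolding good_def by simp
  from pval_eq[OF this] show ?thesis using o by simp
qed

lemma pval_y: "pval N y_var = real (N 0) + 1 / 2"
proof -
  define T where "T = T1"
  have "blow (N 0) y_var = x_var ^ (2 * N 0 + 1) * [:T ^ (N 0 + 1):]" unfolding blow_vars x_power T_def
    by (simp add: mult_monom monom_0[symmetric] del: monom_0)
  note blow_y = this
  have T: "T ^ k \<noteq> 0" "poly (T ^ k) 0 \<noteq> 0" for k by (auto simp: T_def)
  then have T': "Polynomial.coeff [:T ^ (N 0 + 1):] 0 \<noteq> 0" unfolding coeff_pCons_0 by blast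
  from ordx_eqI[OF blow_y T'] have o: "ordx (blow (N 0) y_var) = 2 * N 0 + 1" "low (blow (N 0) y_var) = T ^ (N 0 + 1)" "blow (N 0) y_var \<noteq> 0"
    unfolding coeff_pCons_0 by blast+
  then have "good (blow (N 0) y_var)" unfolding good_def o(2) using T(2) by blast
  then have "good (blows N 1 y_var)" by simp
  from pval_eq[OF this] show ?thesis using o by (simp add: field_simps)
qed

text \<open>The residue field consists of the constants: at a common good stage the residue of
  \<open>f / g\<close> is the quotient of two nonzero constant terms. Once the constant term is
  cancelled, one more substitution produces an extra factor \<open>x\<close>.\<close>

lemma pval_residue:
  assumes "f \<noteq> 0" "g \<noteq> 0" "pval N f = pval N g"
  shows "\<exists>c. f - const2 c * g = 0 \<or> pval N g < pval N (f - const2 c * g)"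
proof -
  obtain n where n: "good (blows N n f)" "good (blows N n g)" using common_good[OF assms(1,2)] .
  have e: "ordx (blows N n f) = ordx (blows N n g)" using assms(3) unfolding pval_eq[OF n(1)] pval_eq[OF n(2)] by simp
  define e where "e = ordx (blows N n g)"
  obtain u where u: "blows N n f = x_var ^ e * u" "low (blows N n f) = Polynomial.coeff u 0"
    using ordx_decomp[OF blows_nonzero[OF assms(1)]] e unfolding e_def by metis
  obtain w where w: "blows N n g = x_var ^ e * w" "low (blows N n g) = Polynomial.coeff w 0"
    using ordx_decomp[OF blows_nonzero[OF assms(2)]] unfolding e_def by metis
  have w0: "Polynomial.coeff (Polynomial.coeff w 0) 0 \<noteq> 0" using n(2) w(2) unfolding good_def by (simp add: poly_0_coeff_0)
  define c where "c = Polynomial.coeff (Polynomial.coeff u 0) 0 / Polynomial.coeff (Polynomial.coeff w 0) 0"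
  define h where "h = f - const2 c * g"
  have bh: "blows N n h = x_var ^ e * (u - const2 c * w)"
    unfolding h_def ring_hom_predD(5)[OF blows_hom] ring_hom_predD(4)[OF blows_hom] blows_const u(1) w(1)
    by (simp only: right_diff_distrib ac_simps)
  have "Polynomial.coeff (Polynomial.coeff (u - const2 c * w) 0) 0 = 0" using w0 by (simp add: c_def)
  then have "Polynomial.coeff (blow (N n) (u - const2 c * w)) 0 = 0" unfolding coeff_blow_0 by simp
  then have "poly (blow (N n) (u - const2 c * w)) 0 = 0" by (simp add: poly_0_coeff_0)
  then have "x_var dvd blow (N n) (u - const2 c * w)" unfolding poly_eq_0_iff_dvd by simp
  then obtain q where q: "blow (N n) (u - const2 c * w) = x_var * q" by (elim dvdE)
  show ?thesis
  proof (cases "h = 0")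
    case False
    have "blows N (Suc n) h = Polynomial.monom T1 2 ^ e * (x_var * q)"
      using bh q by (simp only: blows.simps blow_simps blow_vars)
    moreover have "Polynomial.monom T1 2 ^ e = x_var ^ (2 * e) * [:T1 ^ e:]" unfolding x_power
      by (simp add: monom_power mult_monom monom_0[symmetric] del: monom_0 pCons_one)
    ultimately have "blows N (Suc n) h = x_var ^ (2 * e + 1) * ([:T1 ^ e:] * q)"
      by (simp only: power_add power_one_right ac_simps)
    then have "x_var ^ (2 * e + 1) dvd blows N (Suc n) h" by (rule dvdI)
    then have "2 * e + 1 \<le> ordx (blows N (Suc n) h)" unfolding ordx_ge_iff[OF blows_nonzero[OF False]] .
    then have "real (2 * e + 1) / 2 ^ Suc n \<le> real (ordx (blows N (Suc n) h)) / 2 ^ Suc n"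
      by (intro divide_right_mono of_nat_mono) auto
    also have "\<dots> \<le> pval N h" by (rule pval_ge[OF False])
    finally have "real (2 * e + 1) / 2 ^ Suc n \<le> pval N h" .
    moreover have "pval N g = real e / 2 ^ n" using pval_eq[OF n(2)] e_def by simp
    moreover have "real e / 2 ^ n < real (2 * e + 1) / 2 ^ Suc n" by (simp add: field_simps)
    ultimately have "pval N g < pval N h" by linarith
    then show ?thesis unfolding h_def by blast
  qed (use h_def in auto)
qed

section \<open>Extension to the field of fractions\<close>

type_synonym ratfun = "rat poly poly fract"

definition emb :: "rat poly poly \<Rightarrow> ratfun" where "emb p = Fract p 1"

lemma emb_simps: "emb 0 = 0" "emb 1 = 1" "emb (p + q) = emb p + emb q" "emb (p * q) = emb p * emb q"
  "emb (p - q) = emb p - emb q" "emb (p ^ n) = emb p ^ n" "emb p = emb q \<longleftrightarrow> p = q"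
proof -
  show *: "emb 0 = 0" "emb 1 = 1" "emb (p + q) = emb p + emb q" "emb (p * q) = emb p * emb q"
    "emb (p - q) = emb p - emb q" for p q
    by (simp_all add: emb_def Zero_fract_def One_fract_def)
  show "emb (p ^ n) = emb p ^ n" by (induction n) (simp_all add: *)
  show "emb p = emb q \<longleftrightarrow> p = q" by (simp add: emb_def eq_fract)
qed

lemma emb_eq_0: "emb p = 0 \<longleftrightarrow> p = 0" using emb_simps(1,7) by metis

lemma fract_cases: obtains p q where "z = emb p / emb q" "q \<noteq> 0"
proof -
  obtain p q where "z = Fract p q" "q \<noteq> 0" by (cases z) auto
  then show thesis using that[of p q] by (simp add: emb_def)
qed

definition fval :: "(nat \<Rightarrow> nat) \<Rightarrow> ratfun \<Rightarrow> ereal" where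
  "fval N z = (if z = 0 then \<infinity> else ereal (THE r. \<exists>p q. p \<noteq> 0 \<and> q \<noteq> 0 \<and> z = emb p / emb q \<and> r = pval N p - pval N q))"

lemma fval_frac: assumes "p \<noteq> 0" "q \<noteq> 0" shows "fval N (emb p / emb q) = ereal (pval N p - pval N q)"
proof -
  have "(THE r. \<exists>p' q'. p' \<noteq> 0 \<and> q' \<noteq> 0 \<and> emb p / emb q = emb p' / emb q' \<and> r = pval N p' - pval N q') = pval N p - pval N q"
  proof (rule the_equality)
    show "\<exists>p' q'. p' \<noteq> 0 \<and> q' \<noteq> 0 \<and> emb p / emb q = emb p' / emb q' \<and> pval N p - pval N q = pval N p' - pval N q'"
      using assms by blast
    fix r assume "\<exists>p' q'. p' \<noteq> 0 \<and> q' \<noteq> 0 \<and> emb p / emb q = emb p' / emb q' \<and> r = pval N p' - pval N q'"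
    then obtain p' q' where pq: "p' \<noteq> 0" "q' \<noteq> 0" "emb p / emb q = emb p' / emb q'" "r = pval N p' - pval N q'" by blast
    have "emb (p * q') = emb (p' * q)" using pq assms by (simp add: emb_simps emb_eq_0 frac_eq_eq)
    then have "p * q' = p' * q" by (simp only: emb_simps(7))
    then have "pval N p + pval N q' = pval N p' + pval N q"
      using pval_mult[of p q' N] pval_mult[of p' q N] assms pq by simp
    then show "r = pval N p - pval N q" using pq(4) by simp
  qed
  then show ?thesis unfolding fval_def using assms by (simp add: emb_eq_0)
qed

lemma fval_emb: "p \<noteq> 0 \<Longrightarrow> fval N (emb p) = ereal (pval N p)"
proof -
  assume p: "p \<noteq> 0"
  have "const2 1 = 1" by (simp add: one_pCons)
  then have "pval N 1 = 0" using pval_const[of 1 N] by (simp only:)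
  then show ?thesis using fval_frac[of p 1 N] p by (simp add: emb_simps)
qed

lemma fval_0: "fval N 0 = \<infinity>" unfolding fval_def by simp

lemma fval_finite: assumes "z \<noteq> 0" obtains p q where "p \<noteq> 0" "q \<noteq> 0" "z = emb p / emb q" "fval N z = ereal (pval N p - pval N q)"
proof -
  obtain p q where *: "z = emb p / emb q" "q \<noteq> 0" using fract_cases .
  then have "p \<noteq> 0" using assms by (auto simp: emb_simps)
  then show thesis using that * fval_frac by blast
qed

lemma fval_mult: "fval N (z * w) = fval N z + fval N w"
proof (cases "z = 0 \<or> w = 0")
  case True
  have "fval N z \<noteq> - \<infinity>" "fval N w \<noteq> - \<infinity>" by (auto simp: fval_def)
  then show ?thesis using True by (auto simp: fval_0)
next
  case False
  then obtain p q p' q' where 1: "p \<noteq> 0" "q \<noteq> 0" "z = emb p / emb q" "fval N z = ereal (pval N p - pval N q)"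
    and 2: "p' \<noteq> 0" "q' \<noteq> 0" "w = emb p' / emb q'" "fval N w = ereal (pval N p' - pval N q')"
    using fval_finite[of z N] fval_finite[of w N] by metis
  have "z * w = emb (p * p') / emb (q * q')" unfolding 1 2 by (simp add: emb_simps)
  then show ?thesis using fval_frac[of "p * p'" "q * q'" N] 1 2 pval_mult by simp
qed

lemma fval_add: "min (fval N z) (fval N w) \<le> fval N (z + w)"
proof (cases "z = 0 \<or> w = 0 \<or> z + w = 0")
  case True
  then show ?thesis by (auto simp: fval_0 min_def)
next
  case False
  then obtain p q p' q' where 1: "p \<noteq> 0" "q \<noteq> 0" "z = emb p / emb q" "fval N z = ereal (pval N p - pval N q)"
    and 2: "p' \<noteq> 0" "q' \<noteq> 0" "w = emb p' / emb q'" "fval N w = ereal (pval N p' - pval N q')"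
    using fval_finite[of z N] fval_finite[of w N] by metis
  have e: "z + w = emb (p * q' + p' * q) / emb (q * q')" unfolding 1 2 using 1(2) 2(2)
    by (simp add: emb_simps emb_eq_0 add_frac_eq)
  have nz: "p * q' + p' * q \<noteq> 0"
  proof
    assume "p * q' + p' * q = 0"
    then have "z + w = 0" unfolding e by (simp only: emb_simps(1) div_0)
    then show False using False by simp
  qed
  have "min (pval N (p * q')) (pval N (p' * q)) \<le> pval N (p * q' + p' * q)"
    by (rule pval_add) (use 1 2 nz in auto)
  then show ?thesis unfolding e using fval_frac[OF nz, of "q * q'" N] 1 2 pval_mult
    by (auto simp: min_def split: if_splits)
qed

definition fblow :: "nat \<Rightarrow> ratfun \<Rightarrow> ratfun" where
  "fblow N z = (THE w. \<exists>p q. q \<noteq> 0 \<and> z = emb p / emb q \<and> w = emb (blow N p) / emb (blow N q))"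

lemma fblow_frac: assumes "q \<noteq> 0" shows "fblow N (emb p / emb q) = emb (blow N p) / emb (blow N q)"
  unfolding fblow_def
proof (rule the_equality)
  show "\<exists>p' q'. q' \<noteq> 0 \<and> emb p / emb q = emb p' / emb q' \<and> emb (blow N p) / emb (blow N q) = emb (blow N p') / emb (blow N q')"
    using assms by blast
  fix w assume "\<exists>p' q'. q' \<noteq> 0 \<and> emb p / emb q = emb p' / emb q' \<and> w = emb (blow N p') / emb (blow N q')"
  then obtain p' q' where pq: "q' \<noteq> 0" "emb p / emb q = emb p' / emb q'" "w = emb (blow N p') / emb (blow N q')" by blast
  have "emb (p * q') = emb (p' * q)" using pq assms by (simp add: emb_simps emb_eq_0 frac_eq_eq)
  then have "p * q' = p' * q" by (simp only: emb_simps(7))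
  then have "blow N p * blow N q' = blow N p' * blow N q" by (metis blow_simps(4))
  then have "emb (blow N p) * emb (blow N q') = emb (blow N p') * emb (blow N q)" by (metis emb_simps(4))
  moreover have "emb (blow N q) \<noteq> 0" "emb (blow N q') \<noteq> 0" using blow_general(1) assms pq(1) by (auto simp: emb_eq_0)
  ultimately show "w = emb (blow N p) / emb (blow N q)" unfolding pq(3) by (simp add: frac_eq_eq)
qed

lemma fblow_emb: "fblow N (emb p) = emb (blow N p)"
  using fblow_frac[of 1 N p] blow_simps(2) by (simp add: emb_simps)

lemma fblow_hom: "ring_hom_pred (fblow N)"
  unfolding ring_hom_pred_def
proof (intro conjI allI)
  show "fblow N 0 = 0" "fblow N 1 = 1" using fblow_emb[of N 0] fblow_emb[of N 1] blow_simps by (simp_all add: emb_simps)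
  fix z w
  obtain p q where 1: "z = emb p / emb q" "q \<noteq> 0" using fract_cases .
  obtain p' q' where 2: "w = emb p' / emb q'" "q' \<noteq> 0" using fract_cases .
  have nz: "emb (blow N q) \<noteq> 0" "emb (blow N q') \<noteq> 0" using blow_general(1) 1 2 by (auto simp: emb_eq_0)
  have "z * w = emb (p * p') / emb (q * q')" unfolding 1 2 by (simp add: emb_simps)
  then have "fblow N (z * w) = emb (blow N (p * p')) / emb (blow N (q * q'))" using fblow_frac 1 2 by simp
  then show "fblow N (z * w) = fblow N z * fblow N w" using fblow_frac 1 2 by (simp add: blow_simps emb_simps)
  have "z + w = emb (p * q' + p' * q) / emb (q * q')" unfolding 1 2 using 1(2) 2(2)
    by (simp add: emb_simps emb_eq_0 add_frac_eq)
  then have "fblow N (z + w) = emb (blow N (p * q' + p' * q)) / emb (blow N (q * q'))" using fblow_frac 1 2 by simp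
  then show "fblow N (z + w) = fblow N z + fblow N w" using fblow_frac 1 2 nz
    by (simp add: blow_simps emb_simps add_frac_eq)
qed

lemma hom_divide:
  fixes h :: "'a::field \<Rightarrow> 'b::field" assumes h: "ring_hom_pred h" shows "h (a / b) = h a / h b"
proof (cases "b = 0")
  case True then show ?thesis using ring_hom_predD(1)[OF h] by simp
next
  case False
  have "h (1 / b) * h b = 1" using ring_hom_predD(2)[OF h] ring_hom_predD(4)[OF h, of "1 / b" b] False by simp
  then have "h b \<noteq> 0" by auto
  have "h (a / b) * h b = h a" using ring_hom_predD(4)[OF h, of "a / b" b] False by simp
  then show ?thesis using \<open>h b \<noteq> 0\<close> by (simp add: field_simps)
qed

lemma fval_shift: "fval N z = fval (\<lambda>i. N (Suc i)) (fblow (N 0) z) * ereal (1 / 2)"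
proof (cases "z = 0")
  case True
  then show ?thesis using ring_hom_predD(1)[OF fblow_hom] by (simp add: fval_0)
next
  case False
  then obtain p q where 1: "p \<noteq> 0" "q \<noteq> 0" "z = emb p / emb q" "fval N z = ereal (pval N p - pval N q)"
    using fval_finite by metis
  have "fval (\<lambda>i. N (Suc i)) (fblow (N 0) z) = ereal (pval (\<lambda>i. N (Suc i)) (blow (N 0) p) - pval (\<lambda>i. N (Suc i)) (blow (N 0) q))"
    unfolding 1(3) fblow_frac[OF 1(2)] by (rule fval_frac) (use 1 blow_general(1) in auto)
  then show ?thesis unfolding 1(4) pval_shift[OF 1(1)] pval_shift[OF 1(2)] by (simp add: diff_divide_distrib)
qed

lemma fblow_vars:
  "fblow N (emb x_var) = emb x_var ^ 2 * (1 + emb y_var)"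
  "fblow N (emb y_var) = emb x_var ^ (2 * N + 1) * (1 + emb y_var) ^ (N + 1)"
proof -
  have "[:t ^ k:] = [:t:] ^ k" for t :: "rat poly" and k
  proof (induction k)
    case (Suc k)
    then show ?case by (simp add: Suc[symmetric])
  qed (simp add: one_pCons)
  moreover have "1 + y_var = [:T1:]" by (simp add: one_pCons)
  ultimately have T: "[:T1 ^ k:] = (1 + y_var) ^ k" for k by simp
  have m: "Polynomial.monom (T1 ^ k) n = x_var ^ n * (1 + y_var) ^ k" for k n
    unfolding x_power T[symmetric] by (simp add: mult_monom monom_0[symmetric] del: monom_0)
  show "fblow N (emb x_var) = emb x_var ^ 2 * (1 + emb y_var)"
    unfolding fblow_emb blow_vars using m[of 1 2] by (simp only: power_one_right emb_simps)
  show "fblow N (emb y_var) = emb x_var ^ (2 * N + 1) * (1 + emb y_var) ^ (N + 1)"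
    unfolding fblow_emb blow_vars m by (simp only: emb_simps)
qed

text \<open>The two quotients invert the substitution; this is why they are the coordinates after a
  block, and why their values are those of \<open>x\<close> and \<open>y\<close> for the shifted
  sequence, scaled by \<open>1 / 2\<close>.\<close>

lemma fblow_coordinates:
  "fblow N (emb x_var ^ (N + 1) / emb y_var) = emb x_var"
  "fblow N (emb y_var ^ 2 / emb x_var ^ (2 * N + 1) - 1) = emb y_var"
proof -
  define x y where "x = emb x_var" and "y = emb y_var"
  have nz: "x \<noteq> 0" "1 + y \<noteq> 0"
  proof -
    show "x \<noteq> 0" unfolding x_def emb_eq_0 by simp
    have "1 + y = emb (1 + y_var)" unfolding y_def emb_simps ..
    moreover have "1 + y_var \<noteq> 0" by (simp add: one_pCons)
    ultimately show "1 + y \<noteq> 0" by (simp add: emb_eq_0)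
  qed
  note h = ring_hom_predD[OF fblow_hom] hom_divide[OF fblow_hom] fblow_vars[of N, folded x_def y_def]
  have 1: "(x ^ 2 * (1 + y)) ^ (N + 1) = (x ^ (2 * N + 1) * (1 + y) ^ (N + 1)) * x"
  proof -
    have "x ^ (2 * (N + 1)) = x ^ (2 * N + 1) * x" by simp
    then show ?thesis by (simp only: power_mult_distrib power_mult[symmetric] ac_simps)
  qed
  show "fblow N (emb x_var ^ (N + 1) / emb y_var) = emb x_var" unfolding x_def[symmetric] y_def[symmetric] h 1
    using nz by simp
  have 2: "(x ^ (2 * N + 1) * (1 + y) ^ (N + 1)) ^ 2 = (x ^ 2 * (1 + y)) ^ (2 * N + 1) * (1 + y)"
    by (simp only: power_mult_distrib power_mult[symmetric] mult.assoc power_Suc2[symmetric]) (simp add: mult.commute)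
  show "fblow N (emb y_var ^ 2 / emb x_var ^ (2 * N + 1) - 1) = emb y_var" unfolding x_def[symmetric] y_def[symmetric] h 2
    using nz by simp
qed

lemma fval_x: "fval N (emb x_var) = 1" using fval_emb[of x_var N] pval_x by (simp add: one_ereal_def)

lemma fval_y: "fval N (emb y_var) = ereal (real (N 0) + 1 / 2)" using fval_emb[of y_var N] pval_y by simp

lemma fval_const: "c \<noteq> 0 \<Longrightarrow> fval N (emb (const2 c)) = 0" using fval_emb[of "const2 c" N] pval_const by simp

lemma fval_residue: assumes "0 \<le> fval N z" shows "\<exists>c. 0 < fval N (z - emb (const2 c))"
proof (cases "z = 0 \<or> 0 < fval N z")
  case True
  then have "0 < fval N (z - emb (const2 0))" by (auto simp: fval_0 emb_simps)
  then show ?thesis by blast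
next
  case False
  then obtain p q where 1: "p \<noteq> 0" "q \<noteq> 0" "z = emb p / emb q" "fval N z = ereal (pval N p - pval N q)"
    using fval_finite by metis
  have "pval N p = pval N q" using 1(4) assms False by auto
  from pval_residue[OF 1(1,2) this] obtain c where c: "p - const2 c * q = 0 \<or> pval N q < pval N (p - const2 c * q)" by auto
  have e: "z - emb (const2 c) = emb (p - const2 c * q) / emb q" unfolding 1 emb_simps using 1(2)
    by (simp add: emb_eq_0 diff_divide_distrib)
  show ?thesis
  proof (cases "p - const2 c * q = 0")
    case True
    then have "z - emb (const2 c) = 0" unfolding e by (simp add: emb_simps)
    then have "0 < fval N (z - emb (const2 c))" by (simp add: fval_0)
    then show ?thesis by blast
  next
    case False
    then have "0 < fval N (z - emb (const2 c))" unfolding e using fval_frac[OF False 1(2), of N] c by simp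
    then show ?thesis by blast
  qed
qed

text \<open>Coordinates after \<open>k\<close> blocks of quadratic transforms.\<close>

primrec coords :: "(nat \<Rightarrow> nat) \<Rightarrow> nat \<Rightarrow> ratfun \<times> ratfun" where
  "coords N 0 = (emb x_var, emb y_var)"
| "coords N (Suc k) = (let (a, b) = coords N k in (a ^ (N k + 1) / b, b ^ 2 / a ^ (2 * N k + 1) - 1))"

primrec fblows :: "(nat \<Rightarrow> nat) \<Rightarrow> nat \<Rightarrow> ratfun \<Rightarrow> ratfun" where
  "fblows N 0 z = z"
| "fblows N (Suc k) z = fblow (N k) (fblows N k z)"

lemma fblows_hom: "ring_hom_pred (fblows N k)"
  by (induction k) (use ring_hom_predD[OF fblow_hom] in \<open>auto simp: ring_hom_pred_def\<close>)

lemma fblows_coords: "fblows N k (fst (coords N k)) = emb x_var \<and> fblows N k (snd (coords N k)) = emb y_var"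
proof (induction k)
  case (Suc k)
  obtain a b where ab: "coords N k = (a, b)" by fastforce
  have IH: "fblows N k a = emb x_var" "fblows N k b = emb y_var" using Suc ab by auto
  note h = ring_hom_predD[OF fblows_hom[of N k]] hom_divide[OF fblows_hom[of N k]]
  have 1: "fblows N k (a ^ (N k + 1) / b) = emb x_var ^ (N k + 1) / emb y_var" unfolding h IH ..
  have 2: "fblows N k (b ^ 2 / a ^ (2 * N k + 1) - 1) = emb y_var ^ 2 / emb x_var ^ (2 * N k + 1) - 1" unfolding h IH ..
  have "coords N (Suc k) = (a ^ (N k + 1) / b, b ^ 2 / a ^ (2 * N k + 1) - 1)" using ab by simp
  then show ?case by (simp only: fst_conv snd_conv fblows.simps 1 2 fblow_coordinates)
qed simp

lemma fval_fblows: "fval N z = fval (\<lambda>i. N (i + k)) (fblows N k z) * ereal (1 / 2 ^ k)"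
proof (induction k)
  case 0
  show ?case by (simp flip: one_ereal_def)
next
  case (Suc k)
  have "fval (\<lambda>i. N (i + k)) (fblows N k z) = fval (\<lambda>i. N (i + Suc k)) (fblows N (Suc k) z) * ereal (1 / 2)"
    using fval_shift[of "\<lambda>i. N (i + k)" "fblows N k z"] by simp
  then show ?case using Suc by (simp add: mult.assoc)
qed

lemma fval_coords:
  "fval N (fst (coords N k)) = ereal (1 / 2 ^ k)"
  "fval N (snd (coords N k)) = ereal ((real (N k) + 1 / 2) * (1 / 2 ^ k))"
  using fval_fblows[of N _ k] fblows_coords[of N k] fval_x fval_y by simp_all

section \<open>The rational function field and local rings with two coordinates\<close>

definition ratfun_ring :: "ratfun ring" where
  "ratfun_ring = \<lparr>carrier = UNIV, monoid.mult = (*), one = 1, ring.zero = 0, add = (+)\<rparr>"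

lemma ratfun_ring_simps [simp]:
  "carrier ratfun_ring = UNIV" "x \<otimes>\<^bsub>ratfun_ring\<^esub> y = x * y" "\<one>\<^bsub>ratfun_ring\<^esub> = 1"
  "\<zero>\<^bsub>ratfun_ring\<^esub> = 0" "x \<oplus>\<^bsub>ratfun_ring\<^esub> y = x + y"
  by (simp_all add: ratfun_ring_def)

lemma ratfun_ring_field: "field ratfun_ring"
proof -
  interpret cring ratfun_ring
  proof (rule cringI)
    show "abelian_group ratfun_ring"
    proof (rule abelian_groupI)
      show "\<exists>y\<in>carrier ratfun_ring. y \<oplus>\<^bsub>ratfun_ring\<^esub> x = \<zero>\<^bsub>ratfun_ring\<^esub>" for x
        by (rule bexI[of _ "- x"]) auto
    qed auto
    show "comm_monoid ratfun_ring" by (rule comm_monoidI) auto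
  qed (auto simp: algebra_simps)
  show ?thesis
  proof (rule cring_fieldI2)
    fix a assume "a \<in> carrier ratfun_ring" "a \<noteq> \<zero>\<^bsub>ratfun_ring\<^esub>"
    then show "\<exists>b\<in>carrier ratfun_ring. a \<otimes>\<^bsub>ratfun_ring\<^esub> b = \<one>\<^bsub>ratfun_ring\<^esub>"
      by (intro bexI[of _ "inverse a"]) auto
  qed auto
qed

definition val_ring :: "(nat \<Rightarrow> nat) \<Rightarrow> ratfun set" where "val_ring N = {z. 0 \<le> fval N z}"

locale monomial_blowups =
  fixes N :: "nat \<Rightarrow> nat"

sublocale monomial_blowups \<subseteq> valued_field ratfun_ring "val_ring N" "fval N"
proof -
  interpret field ratfun_ring by (rule ratfun_ring_field)
  show "valued_field ratfun_ring (val_ring N) (fval N)"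
  proof
    show "real_valuation ratfun_ring (val_ring N) (fval N)"
      unfolding real_valuation_def using fval_mult fval_add
      by (auto simp: val_ring_def fval_def)
  qed
qed

context monomial_blowups
begin

abbreviation "K \<equiv> ratfun_ring"
abbreviation "v \<equiv> fval N"
abbreviation "V \<equiv> val_ring N"

definition cst :: "rat \<Rightarrow> ratfun" where "cst c = emb (const2 c)"

lemma cst_simps: "cst 0 = 0" "cst 1 = 1" "cst (a + b) = cst a + cst b" "cst (a * b) = cst a * cst b" "cst (- a) = - cst a"
proof -
  show "cst 0 = 0" by (simp add: cst_def emb_simps)
  show "cst 1 = 1" unfolding cst_def using emb_simps(2) by (simp add: one_pCons)
  have "const2 (a + b) = const2 a + const2 b" "const2 (a * b) = const2 a * const2 b" for a b by simp_all
  then show *: "cst (a + b) = cst a + cst b" "cst (a * b) = cst a * cst b" for a b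
    unfolding cst_def by (simp_all only: emb_simps)
  show "cst (- a) = - cst a" using *(1)[of a "- a"] \<open>cst 0 = 0\<close> by (simp add: add_eq_0_iff)
qed

lemma v_cst: "c \<noteq> 0 \<Longrightarrow> v (cst c) = 0" unfolding cst_def by (rule fval_const)

lemma neg_eq [simp]: "\<ominus>\<^bsub>K\<^esub> x = - x"
  using minus_equality[of "- x" x] by simp

lemma inv_eq [simp]: "x \<noteq> 0 \<Longrightarrow> inv\<^bsub>K\<^esub> x = inverse x"
  using inv_char[of x "inverse x"] by simp

lemma mem_V: "z \<in> V \<longleftrightarrow> 0 \<le> v z" and mem_pos: "z \<in> pos \<longleftrightarrow> 0 < v z"
  unfolding val_ring_def pos_def by auto

lemma pos_plus: "a \<in> pos \<Longrightarrow> b \<in> pos \<Longrightarrow> a + b \<in> pos"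
  using pos_add[of a b] by simp

lemma v_infinite: "v z = \<infinity> \<longleftrightarrow> z = 0" unfolding fval_def by auto

lemma v_divide: "y \<noteq> 0 \<Longrightarrow> v (x / y) = v x - v y"
  using v_div[of x y] by (simp add: divide_inverse)

lemma cst_V: "cst c \<in> V" unfolding mem_V using v_cst[of c] cst_simps(1) fval_0 by (cases "c = 0") auto

definition Loc :: "ratfun \<Rightarrow> ratfun \<Rightarrow> ratfun set" where "Loc x y = dom_hull (range cst \<union> {x, y})"

context
  fixes x y
  assumes x: "0 < v x" and y: "0 < v y"
begin

lemma base_V: "range cst \<union> {x, y} \<subseteq> V"
  using cst_V x y by (auto simp: mem_V less_imp_le)

lemma Loc_facts: "dominated (Loc x y)" "cst c \<in> Loc x y" "x \<in> Loc x y" "y \<in> Loc x y"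
  "\<And>D. dominated D \<Longrightarrow> range cst \<subseteq> D \<Longrightarrow> x \<in> D \<Longrightarrow> y \<in> D \<Longrightarrow> Loc x y \<subseteq> D"
  using hull_facts[OF base_V] unfolding Loc_def[symmetric] by auto

lemma Loc_closed:
  "a \<in> Loc x y \<Longrightarrow> b \<in> Loc x y \<Longrightarrow> a + b \<in> Loc x y" "a \<in> Loc x y \<Longrightarrow> b \<in> Loc x y \<Longrightarrow> a * b \<in> Loc x y"
  using subringE(6,7)[OF dominatedD(1)[OF Loc_facts(1)]] by auto

text \<open>A polynomial in \<open>x\<close> and \<open>y\<close> minus its constant term is in the
  ideal of \<open>x\<close> and \<open>y\<close>; the induction follows the generation of the ring,
  as \<open>x\<close> and \<open>y\<close> are arbitrary elements of the field.\<close>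

lemma generated_decomp:
  assumes "b \<in> generate_ring K (range cst \<union> {x, y})" (is "_ \<in> ?B")
  shows "\<exists>c. \<exists>r\<in>?B. \<exists>s\<in>?B. b = cst c + r * x + s * y"
proof -
  have one: "1 \<in> ?B" using generate_ring.one[of K] by simp
  have cB: "cst c \<in> ?B" for c by (rule generate_ring.incl) auto
  have add: "a \<in> ?B \<Longrightarrow> b \<in> ?B \<Longrightarrow> a + b \<in> ?B" for a b using generate_ring.eng_add[of a K _ b] by simp
  have mult: "a \<in> ?B \<Longrightarrow> b \<in> ?B \<Longrightarrow> a * b \<in> ?B" for a b using generate_ring.eng_mult[of a K _ b] by simp
  have neg: "a \<in> ?B \<Longrightarrow> - a \<in> ?B" for a using generate_ring.a_inv[of a K] by simp
  have zero: "0 \<in> ?B" using add[OF one neg[OF one]] by simp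
  from assms show ?thesis
  proof (induction rule: generate_ring.induct)
    case one
    have "\<one>\<^bsub>K\<^esub> = cst 1 + 0 * x + 0 * y" by (simp add: cst_simps)
    then show ?case using zero by blast
  next
    case (incl h)
    then consider c where "h = cst c" | "h = x" | "h = y" by auto
    then show ?case
    proof cases
      case 1
      then have "h = cst c + 0 * x + 0 * y" by simp
      then show ?thesis using zero by blast
    next
      case 2
      then have "h = cst 0 + 1 * x + 0 * y" by (simp add: cst_simps)
      then show ?thesis using zero \<open>1 \<in> ?B\<close> by blast
    next
      case 3
      then have "h = cst 0 + 0 * x + 1 * y" by (simp add: cst_simps)
      then show ?thesis using zero \<open>1 \<in> ?B\<close> by blast
    qed
  next
    case (a_inv h)
    then obtain c r s where *: "r \<in> ?B" "s \<in> ?B" "h = cst c + r * x + s * y" by blast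
    then have "\<ominus>\<^bsub>K\<^esub> h = cst (- c) + (- r) * x + (- s) * y" by (simp add: cst_simps)
    then show ?case using neg * by blast
  next
    case (eng_add h1 h2)
    then obtain c r s c' r' s' where *: "r \<in> ?B" "s \<in> ?B" "h1 = cst c + r * x + s * y"
      "r' \<in> ?B" "s' \<in> ?B" "h2 = cst c' + r' * x + s' * y" by blast
    then have "h1 \<oplus>\<^bsub>K\<^esub> h2 = cst (c + c') + (r + r') * x + (s + s') * y" by (simp add: cst_simps algebra_simps)
    then show ?case using add * by blast
  next
    case (eng_mult h1 h2)
    then obtain c r s c' r' s' where *: "r \<in> ?B" "s \<in> ?B" "h1 = cst c + r * x + s * y"
      "r' \<in> ?B" "s' \<in> ?B" "h2 = cst c' + r' * x + s' * y" by blast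
    have "h1 \<otimes>\<^bsub>K\<^esub> h2 = cst (c * c') + (r * h2 + cst c * r') * x + (s * h2 + cst c * s') * y"
      unfolding *(3,6) by (simp add: cst_simps algebra_simps)
    moreover have "r * h2 + cst c * r' \<in> ?B" "s * h2 + cst c * s' \<in> ?B"
      using add mult cB * eng_mult by auto
    ultimately show ?case by blast
  qed
qed

text \<open>A nonzero constant has value zero, so after clearing denominators an element of positive
  value has no constant term.\<close>

lemma Loc_pos_decomp:
  assumes z: "z \<in> Loc x y \<inter> pos"
  shows "\<exists>r\<in>Loc x y. \<exists>s\<in>Loc x y. z = r * x + s * y"
proof -
  let ?B = "generate_ring K (range cst \<union> {x, y})"
  have B: "subring ?B K" by (rule generate_ring_is_subring) simp
  have BV: "?B \<subseteq> V" by (rule generate_ring_min_subring1[OF _ V_subring base_V]) simp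
  have L: "Loc x y = localized ?B" unfolding Loc_def dom_hull_def ..
  have BL: "?B \<subseteq> Loc x y" unfolding L by (rule loc_supset[OF B])
  from z obtain u where u: "u \<in> ?B" "v u = 0" "u * z \<in> ?B" unfolding L localized_def by auto
  have u0: "u \<noteq> 0" using u(2) fval_0 by auto
  obtain c r s where crs: "r \<in> ?B" "s \<in> ?B" "u * z = cst c + r * x + s * y" using generated_decomp[OF u(3)] by blast
  have uz: "u * z \<in> pos" using pos_mult[of u z] u(1) BV z by auto
  have "r * x \<in> pos" "s * y \<in> pos" using pos_mult[of r x] pos_mult[of s y] crs BV x y by (auto simp: mem_pos)
  then have "r * x + s * y \<in> pos" using pos_add by auto
  then have "- (r * x + s * y) \<in> pos" using v_neg[of "r * x + s * y"] by (simp add: mem_pos)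
  then have "u * z + - (r * x + s * y) \<in> pos" using pos_add[OF uz] by auto
  then have "cst c \<in> pos" using crs(3) by (simp add: algebra_simps)
  then have "v (cst c) \<noteq> 0" by (auto simp: mem_pos)
  then have "c = 0" using v_cst[of c] by blast
  then have "z = (inverse u * r) * x + (inverse u * s) * y"
    using crs(3) u0 by (simp add: cst_simps field_simps)
  moreover have "inverse u \<in> Loc x y" using dominatedD(3)[OF Loc_facts(1), of u] u BL u0 by auto
  ultimately show ?thesis using Loc_closed(2) crs BL by blast
qed

lemma Loc_pos_value: "z \<in> Loc x y \<inter> pos \<Longrightarrow> min (v x) (v y) \<le> v z"
proof -
  assume "z \<in> Loc x y \<inter> pos"
  then obtain r s where rs: "r \<in> Loc x y" "s \<in> Loc x y" "z = r * x + s * y" using Loc_pos_decomp by blast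
  have "0 \<le> v r" "0 \<le> v s" using rs dominatedD(2)[OF Loc_facts(1)] mem_V by auto
  then have "v x \<le> v (r * x)" "v y \<le> v (s * y)" using fval_mult by (auto simp: add_increasing)
  then show ?thesis using fval_add[of N "r * x" "s * y"] unfolding rs(3) by (auto simp: min_def split: if_splits)
qed

lemma Loc_max_ideal: "Loc x y \<inter> pos = Idl\<^bsub>subring_of K (Loc x y)\<^esub> {x, y}"
proof
  note Ls = dominatedD(1)[OF Loc_facts(1)]
  have sub: "{x, y} \<subseteq> Loc x y" using Loc_facts by auto
  note I = genideal_subring[OF Ls sub] note I' = I(1)[unfolded ideal_subring_iff[OF Ls]]
  show "Idl\<^bsub>subring_of K (Loc x y)\<^esub> {x, y} \<subseteq> Loc x y \<inter> pos"
    by (rule I(3)[OF pos_ideal[OF Loc_facts(1)]]) (use sub x y mem_pos in auto)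
  show "Loc x y \<inter> pos \<subseteq> Idl\<^bsub>subring_of K (Loc x y)\<^esub> {x, y}"
  proof
    fix z assume "z \<in> Loc x y \<inter> pos"
    then obtain r s where rs: "r \<in> Loc x y" "s \<in> Loc x y" "z = r * x + s * y" using Loc_pos_decomp by blast
    have "r \<otimes>\<^bsub>K\<^esub> x \<in> Idl\<^bsub>subring_of K (Loc x y)\<^esub> {x, y}" "s \<otimes>\<^bsub>K\<^esub> y \<in> Idl\<^bsub>subring_of K (Loc x y)\<^esub> {x, y}"
      using I' I(2) rs(1,2) by auto
    then have "r \<otimes>\<^bsub>K\<^esub> x \<oplus>\<^bsub>K\<^esub> s \<otimes>\<^bsub>K\<^esub> y \<in> Idl\<^bsub>subring_of K (Loc x y)\<^esub> {x, y}" using I' by blast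
    then show "z \<in> Idl\<^bsub>subring_of K (Loc x y)\<^esub> {x, y}" using rs(3) by simp
  qed
qed

end

lemma Loc_commute: "Loc x y = Loc y x" unfolding Loc_def by (simp add: insert_commute)

lemma Loc_min_element:
  assumes x: "0 < v x" "x \<noteq> 0" and xy: "v x \<le> v y"
  shows "min_element (Loc x y) x"
proof -
  have y: "0 < v y" using x xy by simp
  show ?thesis unfolding min_element_def using Loc_facts[OF x(1) y] Loc_pos_value[OF x(1) y] x xy
    by (auto simp: mem_pos min_def)
qed

text \<open>Subtracting the constant \<open>c\<close> changes nothing in the ring that is generated,
  but makes the new coordinate positive, so that the transform is again of the form
  \<open>Loc\<close>.\<close>

lemma Loc_step:
  assumes x: "0 < v x" "x \<noteq> 0" and xy: "v x \<le> v y" and c: "0 < v (y / x - cst c)"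
  shows "blowup (Loc x y) x = Loc x (y / x - cst c)"
proof -
  have y: "0 < v y" using x xy by simp
  note L = Loc_facts[OF x(1) y] note L' = Loc_facts[OF x(1) c]
  have pos: "z \<in> Loc x y \<inter> pos \<Longrightarrow> \<exists>r\<in>Loc x y. \<exists>s\<in>Loc x y. z = r * x + s * y" for z
    by (rule Loc_pos_decomp[OF x(1) y])
  show ?thesis unfolding blowup_def unfolding Loc_def[of x "y / x - cst c"]
  proof (rule hull_cong)
    show "Loc x y \<union> {z \<otimes>\<^bsub>K\<^esub> inv\<^bsub>K\<^esub> x |z. z \<in> Loc x y \<inter> pos} \<subseteq> V"
      by (rule blowup_facts(1)[OF L(1) Loc_min_element[OF x xy]])
    show "range cst \<union> {x, y / x - cst c} \<subseteq> V" by (rule base_V[OF x(1) c])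
    fix D assume D: "dominated D"
    note Ds = subringE[OF dominatedD(1)[OF D]]
    have closed: "a \<in> D \<Longrightarrow> b \<in> D \<Longrightarrow> a + b \<in> D" "a \<in> D \<Longrightarrow> b \<in> D \<Longrightarrow> a * b \<in> D" "a \<in> D \<Longrightarrow> - a \<in> D" for a b
      using Ds(5,6,7) by auto
    show "Loc x y \<union> {z \<otimes>\<^bsub>K\<^esub> inv\<^bsub>K\<^esub> x |z. z \<in> Loc x y \<inter> pos} \<subseteq> D \<longleftrightarrow> range cst \<union> {x, y / x - cst c} \<subseteq> D"
    proof
      assume s: "Loc x y \<union> {z \<otimes>\<^bsub>K\<^esub> inv\<^bsub>K\<^esub> x |z. z \<in> Loc x y \<inter> pos} \<subseteq> D"
      have "y \<in> Loc x y \<inter> pos" using L y mem_pos by auto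
      then have "y \<otimes>\<^bsub>K\<^esub> inv\<^bsub>K\<^esub> x \<in> D" using s by blast
      then have "y / x \<in> D" using x(2) by (simp add: divide_inverse)
      moreover have cD: "range cst \<subseteq> D" "x \<in> D" using s L by auto
      moreover have "- cst c \<in> D" using closed(3) cD by auto
      ultimately have "y / x + - cst c \<in> D" using closed(1) by blast
      then show "range cst \<union> {x, y / x - cst c} \<subseteq> D" using cD by simp
    next
      assume s: "range cst \<union> {x, y / x - cst c} \<subseteq> D"
      then have "cst c \<in> D" "y / x - cst c \<in> D" by auto
      then have "(y / x - cst c) + cst c \<in> D" by (rule closed(1)[rotated])
      then have yx: "y / x \<in> D" by simp
      have "x * (y / x) \<in> D" by (rule closed(2)) (use s yx in auto)
      then have "y \<in> D" using x(2) by simp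
      then have LD: "Loc x y \<subseteq> D" using L(5)[OF D] s by auto
      have "z \<otimes>\<^bsub>K\<^esub> inv\<^bsub>K\<^esub> x \<in> D" if z: "z \<in> Loc x y \<inter> pos" for z
      proof -
        obtain r s where rs: "r \<in> Loc x y" "s \<in> Loc x y" "z = r * x + s * y" using pos[OF z] by blast
        have "z \<otimes>\<^bsub>K\<^esub> inv\<^bsub>K\<^esub> x = r + s * (y / x)" unfolding rs(3) using x(2) by (simp add: field_simps)
        moreover have "r + s * (y / x) \<in> D" by (intro closed(1,2) subsetD[OF LD] rs yx)
        ultimately show ?thesis by (simp only:)
      qed
      then show "Loc x y \<union> {z \<otimes>\<^bsub>K\<^esub> inv\<^bsub>K\<^esub> x |z. z \<in> Loc x y \<inter> pos} \<subseteq> D" using LD by auto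
    qed
  qed
qed

section \<open>The sequence of transforms in coordinates\<close>

definition resid :: "ratfun \<Rightarrow> rat" where "resid z = (SOME c. 0 < v (z - cst c))"

lemma resid: "0 \<le> v z \<Longrightarrow> 0 < v (z - cst (resid z))"
  unfolding resid_def using someI_ex[of "\<lambda>c. 0 < v (z - cst c)"] fval_residue[of N z] unfolding cst_def by blast

lemma resid_unique: assumes "0 < v (z - cst c)" shows "resid z = c"
proof -
  have "z - cst c + cst c \<in> V" by (rule subringE(7)[OF V_subring, simplified])
      (use assms cst_V in \<open>auto simp: mem_V\<close>)
  then have "0 < v (z - cst (resid z))" using resid by (simp add: mem_V)
  then have "- (z - cst (resid z)) \<in> pos" using v_neg[of "z - cst (resid z)"] by (simp add: mem_pos)
  moreover have "z - cst c \<in> pos" using assms by (simp add: mem_pos)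
  ultimately have "(z - cst c) + - (z - cst (resid z)) \<in> pos" by (intro pos_plus)
  moreover have "(z - cst c) + - (z - cst (resid z)) = cst (resid z - c)"
    using cst_simps(3)[of "resid z" "- c"] by (simp add: cst_simps)
  ultimately have "0 < v (cst (resid z - c))" by (simp add: mem_pos)
  then have "v (cst (resid z - c)) \<noteq> 0" by auto
  then have "resid z - c = 0" using v_cst[of "resid z - c"] by blast
  then show ?thesis by simp
qed

text \<open>The divisor becomes the first entry. In a tie the second entry is the divisor; with this
  rule a block of transforms ends in exactly the pair given by \<open>coords\<close>.\<close>

fun next_coords :: "ratfun \<times> ratfun \<Rightarrow> ratfun \<times> ratfun" where
  "next_coords (x, y) = (if v x < v y then (x, y / x - cst (resid (y / x))) else (y, x / y - cst (resid (x / y))))"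

definition state :: "nat \<Rightarrow> ratfun \<times> ratfun" where
  "state n = (next_coords ^^ n) (emb x_var, emb y_var)"

definition rings :: "nat \<Rightarrow> ratfun set" where "rings n = (case state n of (x, y) \<Rightarrow> Loc x y)"

definition step_value :: "nat \<Rightarrow> ereal" where "step_value n = (case state n of (x, y) \<Rightarrow> min (v x) (v y))"

lemma state_Suc: "state (Suc n) = next_coords (state n)" unfolding state_def by simp

text \<open>A coordinate that equals its residue before the subtraction becomes zero, with value
  infinity. So the invariant claims only that one of the two is nonzero; this suffices for the
  divisor, which has the smaller value.\<close>

lemma state_props: "case state n of (x, y) \<Rightarrow> 0 < v x \<and> 0 < v y \<and> (x \<noteq> 0 \<or> y \<noteq> 0)"
proof (induction n)
  case 0
  have "0 < v (emb x_var)" unfolding fval_x by simp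
  moreover have "0 < v (emb y_var)" unfolding fval_y by simp
  moreover have "emb x_var \<noteq> 0" unfolding emb_eq_0 by simp
  ultimately show ?case unfolding state_def by simp
next
  case (Suc n)
  obtain x y where xy: "state n = (x, y)" by fastforce
  then have *: "0 < v x" "0 < v y" "x \<noteq> 0 \<or> y \<noteq> 0" using Suc by auto
  show ?case
  proof (cases "v x < v y")
    case True
    then have x0: "x \<noteq> 0" using fval_0 by auto
    have "y / x \<in> V" using div_in_V[of y x] True x0 by (simp add: divide_inverse)
    then show ?thesis unfolding state_Suc xy using True * x0 resid by (simp add: mem_V)
  next
    case False
    then have y0: "y \<noteq> 0" using * v_infinite[of x] v_infinite[of y] by auto
    have "x / y \<in> V" using div_in_V[of x y] False y0 by (simp add: divide_inverse)
    then show ?thesis unfolding state_Suc xy using False * y0 resid by (simp add: mem_V)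
  qed
qed

lemma rings_step:
  "dominated (rings n)" "\<exists>a. min_element (rings n) a \<and> rings (Suc n) = blowup (rings n) a \<and> v a = step_value n"
proof -
  obtain x y where xy: "state n = (x, y)" by fastforce
  then have *: "0 < v x" "0 < v y" "x \<noteq> 0 \<or> y \<noteq> 0" using state_props[of n] by auto
  have r: "rings n = Loc x y" unfolding rings_def xy by simp
  show "dominated (rings n)" unfolding r using Loc_facts(1) * by auto
  show "\<exists>a. min_element (rings n) a \<and> rings (Suc n) = blowup (rings n) a \<and> v a = step_value n"
  proof (cases "v x < v y")
    case True
    then have x0: "x \<noteq> 0" using fval_0 by auto
    have "y / x \<in> V" using div_in_V[of y x] True x0 by (simp add: divide_inverse)
    then have c: "0 < v (y / x - cst (resid (y / x)))" using resid by (simp add: mem_V)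
    have "rings (Suc n) = Loc x (y / x - cst (resid (y / x)))" unfolding rings_def state_Suc xy using True by simp
    then show ?thesis unfolding r step_value_def xy
      using Loc_step[OF *(1) x0 _ c] Loc_min_element[OF *(1) x0, of y] True by (intro exI[of _ x]) (auto simp: min_def)
  next
    case False
    then have y0: "y \<noteq> 0" using * v_infinite[of x] v_infinite[of y] by auto
    have "x / y \<in> V" using div_in_V[of x y] False y0 by (simp add: divide_inverse)
    then have c: "0 < v (x / y - cst (resid (x / y)))" using resid by (simp add: mem_V)
    have "rings (Suc n) = Loc y (x / y - cst (resid (x / y)))" unfolding rings_def state_Suc xy using False by simp
    then show ?thesis unfolding r step_value_def xy Loc_commute[of x y]
      using Loc_step[OF *(2) y0 _ c] Loc_min_element[OF *(2) y0, of x] False by (intro exI[of _ y]) (auto simp: min_def)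
  qed
qed

lemma rings_lqt: "local_quadratic_transform K V (rings n) (rings (Suc n))"
proof -
  obtain a where a: "min_element (rings n) a" "rings (Suc n) = blowup (rings n) a" using rings_step(2) by blast
  moreover have "\<exists>z\<in>rings n \<inter> pos. z \<noteq> \<zero>\<^bsub>K\<^esub>" using a(1) unfolding min_element_def by auto
  ultimately show ?thesis using lqt_iff[OF rings_step(1)] by blast
qed

lemma rings_value_sum: "value_sum K v rings = suminf step_value"
proof -
  have "ideal_value v (max_ideal (subring_of K (rings n))) = step_value n" for n
    using rings_step(2)[of n] ideal_value_min max_ideal_dominated[OF rings_step(1)] by metis
  then show ?thesis unfolding value_sum_def by simp
qed

end

section \<open>The initial ring, its regularity, and the sums over blocks of transforms\<close>

context monomial_blowups
begin

abbreviation "x0 \<equiv> emb x_var"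
abbreviation "y0 \<equiv> emb y_var"

lemma v_x0: "0 < v x0" and v_y0: "0 < v y0" unfolding fval_x fval_y by simp_all

lemma range_cst_subring: "subring (range cst) K"
  by (rule subringI) (auto simp flip: cst_simps)

lemma range_emb_subring: "subring (range emb) K"
proof (rule subringI)
  show "\<ominus>\<^bsub>K\<^esub> h \<in> range emb" if h: "h \<in> range emb" for h
  proof -
    obtain p where "h = emb p" using h by auto
    then have "\<ominus>\<^bsub>K\<^esub> h = emb (0 - p)" using emb_simps(5)[of 0 p] by (simp add: emb_simps)
    then show ?thesis by blast
  qed
  show "\<one>\<^bsub>K\<^esub> \<in> range emb" using emb_simps(2) by (metis ratfun_ring_simps(3) rangeI)
qed (auto simp flip: emb_simps)

lemma emb_mem:
  assumes D: "subring D K" and c: "range cst \<subseteq> D" and x: "x0 \<in> D" and y: "y0 \<in> D"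
  shows "emb p \<in> D"
proof -
  have closed: "a \<in> D \<Longrightarrow> b \<in> D \<Longrightarrow> a + b \<in> D" "a \<in> D \<Longrightarrow> b \<in> D \<Longrightarrow> a * b \<in> D" for a b
    using subringE(6,7)[OF D] by auto
  have 0: "emb 0 \<in> D" using subringE(2)[OF D] by (simp add: emb_simps)
  have 1: "emb [:q:] \<in> D" for q
  proof (induction q)
    case 0
    then show ?case using \<open>emb 0 \<in> D\<close> by simp
  next
    case (pCons a q)
    have "[:pCons a q:] = const2 a + y_var * [:q:]" by simp
    then have "emb [:pCons a q:] = cst a + y0 * emb [:q:]" unfolding cst_def by (simp only: emb_simps)
    moreover have "cst a + y0 * emb [:q:] \<in> D" by (intro closed y pCons.IH) (use c in auto)
    ultimately show ?case by simp
  qed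
  show ?thesis
  proof (induction p)
    case (pCons q p)
    have "pCons q p = [:q:] + x_var * p" by simp
    then have "emb (pCons q p) = emb [:q:] + x0 * emb p" by (simp only: emb_simps)
    moreover have "emb [:q:] + x0 * emb p \<in> D" by (intro closed x 1 pCons.IH)
    ultimately show ?case by simp
  qed (rule 0)
qed

lemma emb_gens: "range cst \<subseteq> range emb" "x0 \<in> range emb" "y0 \<in> range emb"
  unfolding cst_def by auto

lemma generate_eq: "generate_ring K (range cst \<union> {x0, y0}) = range emb"
proof
  show "generate_ring K (range cst \<union> {x0, y0}) \<subseteq> range emb"
    by (rule generate_ring_min_subring1[OF _ range_emb_subring]) (use emb_gens in auto)
  have "subring (generate_ring K (range cst \<union> {x0, y0})) K" by (rule generate_ring_is_subring) simp
  then show "range emb \<subseteq> generate_ring K (range cst \<union> {x0, y0})"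
    using emb_mem generate_ring.incl[of _ "range cst \<union> {x0, y0}" K] by blast
qed

lemma range_cst_noetherian: "noetherian_ring (subring_of K (range cst))"
  unfolding noetherian_subring_iff[OF range_cst_subring]
proof (intro allI impI)
  fix I assume I: "ideal I (subring_of K (range cst))"
  note I' = I[unfolded ideal_subring_iff[OF range_cst_subring]]
  note g = genideal_subring[OF range_cst_subring]
  show "\<exists>G\<subseteq>range cst. finite G \<and> I = Idl\<^bsub>subring_of K (range cst)\<^esub> G"
  proof (cases "I = {0}")
    case True
    have "Idl\<^bsub>subring_of K (range cst)\<^esub> {} = I"
    proof
      show "Idl\<^bsub>subring_of K (range cst)\<^esub> {} \<subseteq> I" by (rule g(3)[OF _ I]) auto
      show "I \<subseteq> Idl\<^bsub>subring_of K (range cst)\<^esub> {}" using g(1)[of "{}"] True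
        unfolding ideal_subring_iff[OF range_cst_subring] by auto
    qed
    then show ?thesis by (intro exI[of _ "{}"]) auto
  next
    case False
    have "0 \<in> I" "I \<subseteq> range cst" using I' by simp_all
    then obtain a where a: "a \<in> I" "a \<noteq> 0" using False by blast
    with \<open>I \<subseteq> range cst\<close> obtain c where c: "cst c \<in> I" "cst c \<noteq> 0" by blast
    then have "c \<noteq> 0" using cst_simps(1) by auto
    have "\<forall>a\<in>I. \<forall>r\<in>range cst. r * a \<in> I" using I' by simp
    then have "cst (1 / c) * cst c \<in> I" using c(1) by blast
    then have "cst 1 \<in> I" using \<open>c \<noteq> 0\<close> unfolding cst_simps(4)[symmetric] by simp
    have cI: "{cst 1} \<subseteq> range cst" by simp
    have "I = Idl\<^bsub>subring_of K (range cst)\<^esub> {cst 1}"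
    proof
      show "Idl\<^bsub>subring_of K (range cst)\<^esub> {cst 1} \<subseteq> I" by (rule g(3)[OF cI I]) (use \<open>cst 1 \<in> I\<close> in simp)
      show "I \<subseteq> Idl\<^bsub>subring_of K (range cst)\<^esub> {cst 1}"
      proof
        fix a assume "a \<in> I"
        then have "a \<in> range cst" using I' by auto
        moreover have "cst 1 \<in> Idl\<^bsub>subring_of K (range cst)\<^esub> {cst 1}" using g(2)[OF cI] by simp
        moreover have "\<forall>b\<in>Idl\<^bsub>subring_of K (range cst)\<^esub> {cst 1}. \<forall>r\<in>range cst. r * b \<in> Idl\<^bsub>subring_of K (range cst)\<^esub> {cst 1}"
          using g(1)[OF cI] unfolding ideal_subring_iff[OF range_cst_subring] by simp
        ultimately have "a * cst 1 \<in> Idl\<^bsub>subring_of K (range cst)\<^esub> {cst 1}" by blast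
        then show "a \<in> Idl\<^bsub>subring_of K (range cst)\<^esub> {cst 1}" by (simp add: cst_simps)
      qed
    qed
    then show ?thesis using cI by blast
  qed
qed

lemma range_emb_noetherian: "noetherian_ring (subring_of K (range emb))"
proof -
  define A1 where "A1 = polys_in (range cst) x0"
  have A1: "subring A1 K" unfolding A1_def by (rule polys_in_subring[OF range_cst_subring]) simp
  have g1: "range cst \<subseteq> A1" "x0 \<in> A1" unfolding A1_def using polys_in_gen[OF range_cst_subring] by auto
  have n1: "noetherian_ring (subring_of K A1)" unfolding A1_def
    by (rule hilbert_basis[OF range_cst_subring _ range_cst_noetherian]) simp
  define A2 where "A2 = polys_in A1 y0"
  have A2: "subring A2 K" unfolding A2_def by (rule polys_in_subring[OF A1]) simp
  have g2: "A1 \<subseteq> A2" "y0 \<in> A2" unfolding A2_def using polys_in_gen[OF A1] by auto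
  have n2: "noetherian_ring (subring_of K A2)" unfolding A2_def
    by (rule hilbert_basis[OF A1 _ n1]) simp
  have "A2 = range emb"
  proof
    have "A1 \<subseteq> range emb" unfolding A1_def by (rule polys_in_minimal[OF range_emb_subring emb_gens(1,2)])
    then show "A2 \<subseteq> range emb" unfolding A2_def by (rule polys_in_minimal[OF range_emb_subring _ emb_gens(3)])
    show "range emb \<subseteq> A2" using emb_mem[OF A2] g1 g2 by blast
  qed
  then show ?thesis using n2 by simp
qed

lemma emb_in_V: "range emb \<subseteq> V"
proof
  fix z assume "z \<in> range emb"
  then obtain p where "z = emb p" by auto
  then show "z \<in> V" unfolding mem_V using fval_emb[of p N] pval_nonneg[of p N] fval_0 by (cases "p = 0") (auto simp: emb_simps)
qed

abbreviation "R0 \<equiv> Loc x0 y0"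

lemma R0_eq: "R0 = localized (range emb)" unfolding Loc_def dom_hull_def generate_eq ..

lemmas R0_facts = Loc_facts[OF v_x0 v_y0]

text \<open>The prime \<open>(x)\<close> of the polynomial ring, whose outer variable is
  \<open>x\<close>. Its extension to \<open>R0\<close> is the middle term of a chain of three
  primes.\<close>

definition x_prime where "x_prime = {emb p | p. poly p 0 = 0}"

lemma x_prime: "primeideal x_prime (subring_of K (range emb))" "x_prime \<subseteq> pos" "x0 \<in> x_prime" "y0 \<notin> x_prime"
proof -
  show "primeideal x_prime (subring_of K (range emb))"
    unfolding prime_subring_iff[OF range_emb_subring] ideal_subring_iff[OF range_emb_subring] x_prime_def
  proof (intro conjI ballI impI)
    show "{emb p |p. poly p 0 = 0} \<subseteq> range emb" by auto
    have "emb 0 = 0" by (rule emb_simps(1))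
    then show "\<zero>\<^bsub>K\<^esub> \<in> {emb p |p. poly p 0 = 0}" by force
    show "a \<oplus>\<^bsub>K\<^esub> b \<in> {emb p |p. poly p 0 = 0}" if ab: "a \<in> {emb p |p. poly p 0 = 0}" "b \<in> {emb p |p. poly p 0 = 0}" for a b
    proof -
      obtain p q where "a = emb p" "b = emb q" "poly p 0 = 0" "poly q 0 = 0" using ab by auto
      then have "a \<oplus>\<^bsub>K\<^esub> b = emb (p + q)" "poly (p + q) 0 = 0" by (simp_all add: emb_simps)
      then show ?thesis by blast
    qed
    show "r \<otimes>\<^bsub>K\<^esub> a \<in> {emb p |p. poly p 0 = 0}" if ra: "a \<in> {emb p |p. poly p 0 = 0}" "r \<in> range emb" for r a
    proof -
      obtain p q where "a = emb p" "r = emb q" "poly p 0 = 0" using ra by auto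
      then have "r \<otimes>\<^bsub>K\<^esub> a = emb (q * p)" "poly (q * p) 0 = 0" by (simp_all add: emb_simps)
      then show ?thesis by blast
    qed
    show "\<one>\<^bsub>K\<^esub> \<notin> {emb p |p. poly p 0 = 0}"
    proof
      assume "\<one>\<^bsub>K\<^esub> \<in> {emb p |p. poly p 0 = 0}"
      then obtain p where "emb 1 = emb p" "poly p 0 = 0" by (auto simp: emb_simps)
      then show False by (simp add: emb_simps(7))
    qed
    fix a b assume "a \<in> range emb" "b \<in> range emb" and m: "a \<otimes>\<^bsub>K\<^esub> b \<in> {emb p |p. poly p 0 = 0}"
    then obtain p q where pq: "a = emb p" "b = emb q" by auto
    obtain r where r: "a * b = emb r" "poly r 0 = 0" using m by auto
    then have "emb (p * q) = emb r" unfolding pq by (simp add: emb_simps)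
    then have "p * q = r" by (simp only: emb_simps(7))
    then have "poly p 0 = 0 \<or> poly q 0 = 0" using r(2) by auto
    then show "a \<in> {emb p |p. poly p 0 = 0} \<or> b \<in> {emb p |p. poly p 0 = 0}" using pq by blast
  qed
  show "x_prime \<subseteq> pos"
  proof
    fix z assume "z \<in> x_prime"
    then obtain p where p: "z = emb p" "poly p 0 = 0" unfolding x_prime_def by auto
    then have "x_var dvd p" by (simp add: poly_eq_0_iff_dvd)
    then obtain q where "p = q * x_var" by (metis dvdE mult.commute)
    then have "z = emb q * x0" unfolding p by (simp only: emb_simps)
    moreover have "emb q \<in> V" using emb_in_V by auto
    moreover have "x0 \<in> pos" using v_x0 mem_pos by simp
    ultimately show "z \<in> pos" using pos_mult[of "emb q" x0] by simp
  qed
  have "poly x_var 0 = 0" by simp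
  then show "x0 \<in> x_prime" unfolding x_prime_def by blast
  show "y0 \<notin> x_prime"
  proof
    assume "y0 \<in> x_prime"
    then obtain p where "y0 = emb p" "poly p 0 = 0" unfolding x_prime_def by auto
    then have "poly y_var 0 = 0" by (simp only: emb_simps(7))
    then show False by simp
  qed
qed

lemma R0_reg: "regular_system R0 [x0, y0]"
proof -
  note Rs = dominatedD(1)[OF R0_facts(1)]
  have n: "noetherian_ring (subring_of K R0)" unfolding R0_eq
    by (rule loc_noetherian[OF range_emb_subring emb_in_V range_emb_noetherian])
  define P where "P = extended_ideal (range emb) x_prime"
  have P: "primeideal P (subring_of K R0)" "P \<inter> range emb = x_prime"
    unfolding P_def R0_eq using ext_prime[OF range_emb_subring emb_in_V x_prime(1,2)] by auto
  have Ppos: "P \<subseteq> R0 \<inter> pos" by (rule prime_le_pos[OF R0_facts(1) P(1)])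
  have xP: "x0 \<in> P" and yP: "y0 \<notin> P" using P(2) x_prime(3,4) by auto
  define q where "q = (\<lambda>i::nat. if i = 0 then {0} else if i = 1 then P else R0 \<inter> pos)"
  have z: "primeideal {0} (subring_of K R0)"
    using domain.zeroprimeideal[OF subring_is_domain[OF Rs]] by simp
  have "{0} \<subset> P"
  proof -
    have "0 \<in> P" using P(1) unfolding prime_subring_iff[OF Rs] ideal_subring_iff[OF Rs] by simp
    moreover have "x0 \<noteq> 0" by (simp add: emb_eq_0)
    ultimately show ?thesis using xP by auto
  qed
  moreover have "P \<subset> R0 \<inter> pos" using Ppos yP R0_facts(4) v_y0 mem_pos by blast
  ultimately have "prime_chain (subring_of K R0) (length [x0, y0]) q" unfolding prime_chain_def q_def
    using z P(1) pos_prime[OF R0_facts(1)] by (auto simp: less_Suc_eq)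
  then show ?thesis unfolding regular_system_def using R0_facts(1,3,4) n Loc_max_ideal[OF v_x0 v_y0]
    by (intro conjI exI[of _ q]) simp_all
qed

lemma R0_regular: "regular_local_ring (subring_of K R0) 2"
proof -
  obtain p where "regular_parameters (subring_of K R0) (R0 \<inter> pos) [x0, y0] p" using reg_parameters[OF R0_reg] by auto
  then interpret RP: regular_parameters "subring_of K R0" "R0 \<inter> pos" "[x0, y0]" p .
  have "krull_dim (subring_of K R0) = enat 2" unfolding krull_dim_def
  proof (rule antisym)
    have "n \<le> 2" if "prime_chain (subring_of K R0) n q" for n q using RP.chain_length_le[OF that] by simp
    then show "Sup {enat n |n. \<exists>p. prime_chain (subring_of K R0) n p} \<le> enat 2"
      by (intro Sup_least) auto
    show "enat 2 \<le> Sup {enat n |n. \<exists>p. prime_chain (subring_of K R0) n p}"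
      by (rule Sup_upper) (use RP.chain in \<open>auto simp: numeral_2_eq_2\<close>)
  qed
  moreover have "x0 \<noteq> y0" by (simp add: emb_simps(7))
  then have "card {x0, y0} = 2" by simp
  ultimately show ?thesis unfolding regular_local_ring_def
    using R0_reg local_dominated[OF R0_facts(1)] max_ideal_dominated[OF R0_facts(1)] unfolding regular_system_def
    by (intro conjI exI[of _ "{x0, y0}"]) auto
qed

text \<open>By the Archimedean property every element of positive value has a power that is a
  multiple of a given nonzero \<open>y\<close> in \<open>P\<close>.\<close>

lemma V_prime:
  assumes P: "primeideal P (subring_of K V)" and ne: "P \<noteq> {0}" shows "P = V \<inter> pos"
proof
  note P' = P[unfolded prime_subring_iff[OF V_subring] ideal_subring_iff[OF V_subring]]
  show "P \<subseteq> V \<inter> pos" by (rule prime_le_pos[OF V_dominated P])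
  obtain y where y: "y \<in> P" "y \<noteq> 0" using ne P' by auto
  obtain Y where Y: "v y = ereal Y" using v_finite[of y] y by auto
  show "V \<inter> pos \<subseteq> P"
  proof
    fix z assume z: "z \<in> V \<inter> pos"
    show "z \<in> P"
    proof (cases "z = 0")
      case True
      then show ?thesis using P' by simp
    next
      case False
      obtain Z where Z1: "v z = ereal Z" using v_finite[of z] False by auto
      have Z: "0 < Z" using z Z1 mem_pos by simp
      obtain k :: nat where k: "Y < real k * Z" using reals_Archimedean3[OF Z] by auto
      have vk: "v (z ^ k) = ereal (real k * Z)" for k :: nat
      proof (induction k)
        case 0
        then show ?case using v_one by simp
      next
        case (Suc k)
        then show ?case using fval_mult[of N z "z ^ k"] Z1 by (simp add: algebra_simps)
      qed
      have "0 \<le> v (z ^ k / y)" using v_divide[OF y(2)] vk[of k] Y k by simp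
      then have "z ^ k / y \<in> V" by (simp add: mem_V)
      moreover have "\<forall>a\<in>P. \<forall>r\<in>V. r * a \<in> P" using P' by simp
      ultimately have "(z ^ k / y) * y \<in> P" using y(1) by blast
      then have "z ^ k \<in> P" using y(2) by simp
      then show ?thesis
      proof (induction k)
        case 0
        then show ?case using P' by simp
      next
        case (Suc k)
        have "z ^ k \<in> V" using vk[of k] Z by (simp add: mem_V)
        moreover have "\<forall>a\<in>V. \<forall>b\<in>V. a * b \<in> P \<longrightarrow> a \<in> P \<or> b \<in> P" using P' by simp
        ultimately show ?case using Suc z by auto
      qed
    qed
  qed
qed

lemma V_krull_dim: "krull_dim (subring_of K V) = 1"
proof -
  have z: "primeideal {0} (subring_of K V)"
    using domain.zeroprimeideal[OF subring_is_domain[OF V_subring]] by simp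
  have "x0 \<in> V \<inter> pos" using v_x0 mem_pos pos_sub by auto
  moreover have "0 \<in> V \<inter> pos" by (simp add: mem_V mem_pos fval_0)
  moreover have "x0 \<noteq> 0" by (simp add: emb_eq_0)
  ultimately have "{0} \<subset> V \<inter> pos" by auto
  then have c: "prime_chain (subring_of K V) 1 (\<lambda>i. if i = 0 then {0} else V \<inter> pos)"
    unfolding prime_chain_def using z pos_prime[OF V_dominated] by auto
  have le: "n \<le> 1" if p: "prime_chain (subring_of K V) n p" for n p
  proof (rule ccontr)
    assume "\<not> ?thesis"
    then have pr: "p 0 \<subset> p 1" "p 1 \<subset> p 2" "primeideal (p 0) (subring_of K V)" "primeideal (p 1) (subring_of K V)" "primeideal (p 2) (subring_of K V)"
      using p unfolding prime_chain_def by (auto simp: numeral_2_eq_2)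
    have "0 \<in> p 0" using pr(3) unfolding prime_subring_iff[OF V_subring] ideal_subring_iff[OF V_subring] by simp
    then have "p 1 \<noteq> {0}" "p 2 \<noteq> {0}" using pr(1,2) by auto
    then show False using V_prime[OF pr(4)] V_prime[OF pr(5)] pr(2) by simp
  qed
  show ?thesis unfolding krull_dim_def
  proof (rule antisym)
    show "Sup {enat n |n. \<exists>p. prime_chain (subring_of K V) n p} \<le> 1"
      using le by (intro Sup_least) (auto simp: one_enat_def)
    show "1 \<le> Sup {enat n |n. \<exists>p. prime_chain (subring_of K V) n p}"
      by (rule Sup_upper) (use c in \<open>auto simp: one_enat_def\<close>)
  qed
qed

text \<open>Each \<open>z\<close> in \<open>V\<close> is congruent to the constant
  \<open>cst (resid z)\<close>, so \<open>R0\<close> maps onto the residue field of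
  \<open>V\<close>.\<close>

lemma zero_dimensional: "zero_dimensional_over K V R0"
proof -
  let ?A = "subring_of K V"
  let ?M = "V \<inter> pos"
  interpret A: cring ?A by (rule subring_cring[OF V_subring])
  have Mmax: "maximalideal ?M ?A" using maximal_dominated_iff[OF V_dominated] by auto
  interpret M: maximalideal ?M ?A by (rule Mmax)
  define L where "L = ?A Quot ?M"
  define h where "h = (\<lambda>r. ?M +>\<^bsub>?A\<^esub> r)"
  have hom: "ring_hom_ring ?A L h" unfolding h_def L_def by (rule M.rcos_ring_hom_ring)
  interpret h: ring_hom_ring ?A L h by (rule hom)
  interpret L: field L unfolding L_def by (rule M.quotient_is_field) (rule A.is_cring)
  have RA: "subring R0 ?A"
  proof (rule A.ring_incl_imp_subring)
    show "R0 \<subseteq> carrier ?A" using dominatedD(2)[OF R0_facts(1)] by auto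
    show "ring (?A\<lparr>carrier := R0\<rparr>)" using subring_is_ring[OF dominatedD(1)[OF R0_facts(1)]] by simp
  qed
  have kL: "subring (h ` R0) L" by (rule h.img_is_subring[OF RA])
  have "ring.algebraic L (h ` R0) t" if t: "t \<in> carrier L" for t
  proof -
    obtain z where z: "z \<in> V" "t = h z" using t unfolding L_def h_def FactRing_def A_RCOSETS_def' by auto
    define d where "d = z - cst (resid z)"
    have d: "d \<in> ?M" using resid[of z] z(1) unfolding d_def by (simp add: mem_V mem_pos)
    have "h (cst (resid z) \<oplus>\<^bsub>?A\<^esub> d) = h (cst (resid z)) \<oplus>\<^bsub>L\<^esub> h d"
      by (rule h.hom_add) (use cst_V d in auto)
    moreover have "h d = \<zero>\<^bsub>L\<^esub>" unfolding h_def L_def FactRing_def using A.a_rcos_zero[OF M.is_ideal d] by simp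
    moreover have "cst (resid z) \<oplus>\<^bsub>?A\<^esub> d = z" unfolding d_def by simp
    ultimately have "h z = h (cst (resid z))" using h.hom_closed[of "cst (resid z)"] cst_V by simp
    then have "t \<in> h ` R0" using z(2) R0_facts(2) by auto
    then show ?thesis using L.algebraic_self[OF kL] unfolding over_def by simp
  qed
  moreover have "max_ideal ?A = ?M" by (rule max_ideal_dominated[OF V_dominated])
  ultimately show ?thesis unfolding zero_dimensional_over_def Let_def L_def h_def by simp
qed

lemma setting: "lqt_setting K 2 R0 V v rings"
proof -
  have "valuation_domain K V" unfolding valuation_domain_def
  proof (intro conjI ballI V_subring ratfun_ring_field)
    fix x assume "x \<in> carrier K - {\<zero>\<^bsub>K\<^esub>}"
    then have x: "x \<noteq> 0" by simp
    then obtain r where "v x = ereal r" using v_finite[of x] by auto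
    moreover have "v (inv\<^bsub>K\<^esub> x) = - v x" using v_inv[of x] x by simp
    ultimately show "x \<in> V \<or> inv\<^bsub>K\<^esub> x \<in> V" unfolding mem_V by auto
  qed
  then have 1: "real_valuation_domain K V v" unfolding real_valuation_domain_def using V_krull_dim val by simp
  have 2: "birationally_dominates K V R0" unfolding birationally_dominates_def
  proof (intro conjI)
    show "R0 \<subseteq> V" by (rule dominatedD(2)[OF R0_facts(1)])
    show "max_ideal (subring_of K V) \<inter> R0 = max_ideal (subring_of K R0)"
      unfolding max_ideal_dominated[OF V_dominated] max_ideal_dominated[OF R0_facts(1)]
      using dominatedD(2)[OF R0_facts(1)] by auto
    have embR: "emb p \<in> R0" for p
      by (rule emb_mem[OF dominatedD(1)[OF R0_facts(1)]]) (use R0_facts in auto)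
    show "V \<subseteq> fraction_field K R0"
    proof
      fix z assume "z \<in> V"
      obtain p q where pq: "z = emb p / emb q" "q \<noteq> 0" using fract_cases .
      then have "z = emb p \<otimes>\<^bsub>K\<^esub> inv\<^bsub>K\<^esub> emb q" "emb q \<in> R0 - {\<zero>\<^bsub>K\<^esub>}"
        using embR by (simp_all add: emb_eq_0 divide_inverse)
      then show "z \<in> fraction_field K R0" unfolding fraction_field_def localize_at_def using embR[of p] by blast
    qed
  qed
  have "rings 0 = R0" unfolding rings_def state_def by simp
  then have 3: "lqt_sequence K V R0 rings" unfolding lqt_sequence_def using rings_lqt by simp
  show ?thesis unfolding lqt_setting_def
    using ratfun_ring_field dominatedD(1)[OF R0_facts(1)] R0_regular 1 2 3 zero_dimensional by simp
qed

text \<open>Values of polynomials are orders divided by powers of two, and \<open>x0\<close> has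
  value \<open>1\<close>.\<close>

lemma rank_one: "rational_rank K v = 1"
proof (rule rational_rank_one[of 1])
  show "1 \<in> value_group K v" unfolding value_group_def using fval_x[of N]
    by (auto simp: one_ereal_def emb_eq_0 intro!: exI[of _ x0])
  have pq: "pval N p \<in> \<rat>" for p unfolding pval_def Let_def by auto
  fix z assume "z \<in> value_group K v"
  then obtain x where "x \<noteq> 0" "v x = ereal z" unfolding value_group_def by auto
  then obtain p q where "z = pval N p - pval N q" using fval_finite[of x N] by (metis ereal.inject)
  then show "z / 1 \<in> \<rat>" using pq by simp
qed simp

text \<open>The first coordinates after \<open>k\<close> blocks have the values
  \<open>1 / 2^k\<close>, which are arbitrarily small.\<close>

lemma not_DVR: "\<not> is_DVR (subring_of K V)"
proof
  assume "is_DVR (subring_of K V)"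
  then obtain c where c: "0 < c" "\<forall>z\<in>pos. ereal c \<le> v z"
    using DVR_value_bound[of x0] v_x0 by (auto simp: mem_pos emb_eq_0)
  obtain k where "(1 / 2 :: real) ^ k < c" using real_arch_pow_inv[OF c(1), of "1 / 2"] by auto
  moreover have "ereal c \<le> ereal (1 / 2 ^ k)"
    using c(2)[rule_format, of "fst (coords N k)"] fval_coords(1)[of N k] by (simp add: mem_pos)
  ultimately show False by (simp add: power_one_over)
qed

text \<open>The second entry is divided \<open>M\<close> times by \<open>a\<close>, with residue
  zero since the quotients have positive value. Then \<open>b / a^M\<close>, of value
  \<open>\<alpha> / 2\<close>, is the divisor of \<open>a\<close>. Both entries now have value
  \<open>\<alpha> / 2\<close>, and \<open>u\<close> gives the residue \<open>1\<close> of their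
  quotient. The sum grows by \<open>M \<alpha> + \<alpha> / 2 + \<alpha> / 2\<close>.\<close>

lemma block:
  assumes s: "state n = (a, b)" and a: "v a = ereal \<alpha>" and b: "v b = ereal ((real M + 1 / 2) * \<alpha>)" and \<alpha>: "0 < \<alpha>"
    and u: "0 < v (b ^ 2 / a ^ (2 * M + 1) - 1)"
  shows "state (n + M + 2) = (a ^ (M + 1) / b, b ^ 2 / a ^ (2 * M + 1) - 1)"
    "(\<Sum>i<n + M + 2. step_value i) = (\<Sum>i<n. step_value i) + ereal ((real M + 1) * \<alpha>)"
proof -
  have a0: "a \<noteq> 0" and b0: "b \<noteq> 0" using a b fval_0 by auto
  have vp: "v (a ^ i) = ereal (real i * \<alpha>)" for i
  proof (induction i)
    case 0
    then show ?case using v_one by simp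
  next
    case (Suc i)
    then show ?case using fval_mult[of N a "a ^ i"] a by (simp add: algebra_simps)
  qed
  have vb: "v (b / a ^ i) = ereal ((real M + 1 / 2 - real i) * \<alpha>)" for i
    using v_divide[of "a ^ i" b] a0 b vp[of i] by (simp add: algebra_simps)
  have res0: "resid z = 0" if "0 < v z" for z using resid_unique[of z 0] that by (simp add: cst_simps)
  have 1: "i \<le> M \<Longrightarrow> state (n + i) = (a, b / a ^ i) \<and>
    (\<Sum>j<n + i. step_value j) = (\<Sum>j<n. step_value j) + ereal (real i * \<alpha>)" for i
  proof (induction i)
    case 0
    then show ?case using s by simp
  next
    case (Suc i)
    then have IH: "state (n + i) = (a, b / a ^ i)"
      "(\<Sum>j<n + i. step_value j) = (\<Sum>j<n. step_value j) + ereal (real i * \<alpha>)" by auto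
    have "real i + 1 \<le> real M" using Suc.prems by simp
    then have "1 * \<alpha> < (real M + 1 / 2 - real i) * \<alpha>" by (intro mult_strict_right_mono) (use \<alpha> in auto)
    then have lt: "v a < v (b / a ^ i)" unfolding vb a by simp
    have e: "b / a ^ i / a = b / a ^ Suc i" by (simp add: mult.commute)
    have "0 < v (b / a ^ Suc i)" unfolding vb using \<alpha> \<open>real i + 1 \<le> real M\<close> by simp
    then have r: "resid (b / a ^ Suc i) = 0" by (rule res0)
    have "state (n + Suc i) = (a, b / a ^ i / a - cst (resid (b / a ^ i / a)))"
      using lt by (simp only: add_Suc_right state_Suc IH(1) next_coords.simps if_True)
    then have st: "state (n + Suc i) = (a, b / a ^ Suc i)" unfolding e r cst_simps by (simp only: diff_0_right)
    have "step_value (n + i) = ereal \<alpha>" unfolding step_value_def IH using less_imp_le[OF lt] a by (simp add: min_def)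
    then have "(\<Sum>j<n + Suc i. step_value j) = (\<Sum>j<n. step_value j) + (ereal (real i * \<alpha>) + ereal \<alpha>)"
      using IH(2) by (simp add: add.assoc)
    then show ?case using st by (simp add: algebra_simps)
  qed
  have s1: "state (n + M) = (a, b / a ^ M)" and S1: "(\<Sum>j<n + M. step_value j) = (\<Sum>j<n. step_value j) + ereal (real M * \<alpha>)"
    using 1[of M] by auto
  have vbM: "v (b / a ^ M) = ereal (\<alpha> / 2)" using vb[of M] by simp
  have nl: "\<not> v a < v (b / a ^ M)" unfolding vbM a using \<alpha> by simp
  have e1: "a / (b / a ^ M) = a ^ (M + 1) / b" by simp
  have vq: "v (a ^ (M + 1) / b) = ereal (\<alpha> / 2)"
    using v_divide[OF b0, of "a ^ (M + 1)"] vp[of "M + 1"] b by (simp add: algebra_simps)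
  have r1: "resid (a ^ (M + 1) / b) = 0" by (rule res0) (use vq \<alpha> in simp)
  have s2: "state (Suc (n + M)) = (b / a ^ M, a ^ (M + 1) / b)"
    unfolding state_Suc s1 next_coords.simps e1 r1 using nl by (simp add: cst_simps)
  have g1: "step_value (n + M) = ereal (\<alpha> / 2)" unfolding step_value_def s1 using vbM a \<alpha> by (simp add: min_def)
  have g2: "step_value (Suc (n + M)) = ereal (\<alpha> / 2)" unfolding step_value_def s2 using vbM vq by simp
  have e2: "(b / a ^ M) / (a ^ (M + 1) / b) = b ^ 2 / a ^ (2 * M + 1)"
  proof -
    have "2 * M + 1 = M + (M + 1)" by simp
    then have "a ^ (2 * M + 1) = a ^ M * a ^ (M + 1)" by (simp only: power_add)
    then show ?thesis using a0 b0 by (simp only: power2_eq_square) simp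
  qed
  have r2: "resid (b ^ 2 / a ^ (2 * M + 1)) = 1" by (rule resid_unique) (use u in \<open>simp add: cst_simps\<close>)
  show "state (n + M + 2) = (a ^ (M + 1) / b, b ^ 2 / a ^ (2 * M + 1) - 1)"
  proof -
    have "\<not> v (b / a ^ M) < v (a ^ (M + 1) / b)" unfolding vbM vq by simp
    then have "state (Suc (Suc (n + M))) = (a ^ (M + 1) / b, b ^ 2 / a ^ (2 * M + 1) - 1)"
      unfolding state_Suc[of "Suc (n + M)"] s2 next_coords.simps e2 r2 cst_simps by (simp only: if_False)
    then show ?thesis by simp
  qed
  have "(\<Sum>i<n + M + 2. step_value i) = (\<Sum>j<n. step_value j) + (ereal (real M * \<alpha>) + (ereal (\<alpha> / 2) + ereal (\<alpha> / 2)))"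
    using S1 g1 g2 by (simp add: add.assoc numeral_2_eq_2)
  then show "(\<Sum>i<n + M + 2. step_value i) = (\<Sum>i<n. step_value i) + ereal ((real M + 1) * \<alpha>)"
    by (simp add: algebra_simps)
qed

primrec block_start :: "nat \<Rightarrow> nat" where
  "block_start 0 = 0"
| "block_start (Suc k) = block_start k + N k + 2"

lemma blocks:
  "state (block_start k) = coords N k \<and>
   (\<Sum>i<block_start k. step_value i) = ereal (\<Sum>j<k. (real (N j) + 1) / 2 ^ j)"
proof (induction k)
  case 0
  then show ?case by (simp add: state_def)
next
  case (Suc k)
  obtain a b where ab: "coords N k = (a, b)" by fastforce
  \<comment> \<open>The prescribed residue \<open>1\<close> is the statement that the second
    coordinate of the next block has positive value.\<close>
  have u: "0 < v (b ^ 2 / a ^ (2 * N k + 1) - 1)" using fval_coords(2)[of N "Suc k"] ab by simp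
  have "state (block_start k) = (a, b)" using Suc ab by simp
  from block[OF this, of "1 / 2 ^ k" "N k"] fval_coords[of N k] ab u
  have "state (block_start k + N k + 2) = (a ^ (N k + 1) / b, b ^ 2 / a ^ (2 * N k + 1) - 1)"
    "(\<Sum>i<block_start k + N k + 2. step_value i) = (\<Sum>i<block_start k. step_value i) + ereal ((real (N k) + 1) * (1 / 2 ^ k))"
    by auto
  then show ?case using Suc ab by simp
qed

lemma step_value_nonneg: "0 \<le> step_value n"
  unfolding step_value_def using state_props[of n] by (auto simp: less_imp_le split: prod.splits)

end

lemma value_sum_infinite: "value_sum ratfun_ring (fval (\<lambda>k. 2 ^ k)) (monomial_blowups.rings (\<lambda>k. 2 ^ k)) = \<infinity>"
proof -
  interpret monomial_blowups "\<lambda>k. 2 ^ k" .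
  show ?thesis unfolding rings_value_sum
  proof (rule ereal_top)
    fix r
    obtain k :: nat where k: "r < real k" using reals_Archimedean2 by auto
    have "real k = (\<Sum>j<k. 1)" by simp
    also have "\<dots> \<le> (\<Sum>j<k. (real (2 ^ j) + 1) / 2 ^ j)" by (intro sum_mono) (simp add: field_simps)
    finally have "ereal r \<le> ereal (\<Sum>j<k. (real (2 ^ j) + 1) / 2 ^ j)" using k by simp
    also have "\<dots> \<le> suminf step_value"
      using suminf_upper[of step_value "block_start k"] step_value_nonneg blocks[of k] by simp
    finally show "ereal r \<le> suminf step_value" .
  qed
qed

lemma value_sum_finite: "value_sum ratfun_ring (fval (\<lambda>_. 0)) (monomial_blowups.rings (\<lambda>_. 0)) < \<infinity>"
proof -
  interpret monomial_blowups "\<lambda>_. 0" .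
  have "suminf step_value \<le> 2"
  proof (rule suminf_bound[rule_format])
    fix n
    have "n \<le> block_start n" by (induction n) auto
    then have "(\<Sum>i<n. step_value i) \<le> (\<Sum>i<block_start n. step_value i)"
      by (intro sum_mono2) (auto simp: step_value_nonneg)
    also have "\<dots> = ereal (\<Sum>j<n. (1 / 2) ^ j)" using blocks[of n] by (simp add: power_one_over)
    also have "(\<Sum>j<n. (1 / 2 :: real) ^ j) = 2 - 2 * (1 / 2) ^ n" by (induction n) (auto simp: field_simps)
    finally show "(\<Sum>i<n. step_value i) \<le> 2" by (simp add: order_trans)
  qed (rule step_value_nonneg)
  then show ?thesis unfolding rings_value_sum by auto
qed

theorem proposition7p3:
  fixes K :: "('a, 'b) ring_scheme" and d :: nat and R V :: "'a set"
    and v :: "'a \<Rightarrow> ereal" and Rs :: "nat \<Rightarrow> 'a set"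
  shows
    "(lqt_setting K d R V v Rs \<longrightarrow>
        (is_DVR (subring_of K V) \<longrightarrow> value_sum K v Rs = \<infinity> \<and> (\<Union>n. Rs n) = V) \<and>
        (value_sum K v Rs = \<infinity> \<longrightarrow> switches_strongly_infinitely_often K Rs) \<and>
        (2 \<le> rational_rank K v \<longrightarrow> value_sum K v Rs < \<infinity>) \<and>
        (value_sum K v Rs = \<infinity> \<longrightarrow> rational_rank K v = 1)) \<and>
     (\<exists>(K' :: rat poly poly fract ring) d' R' V' v' Rs'.
        lqt_setting K' d' R' V' v' Rs' \<and> rational_rank K' v' = 1 \<and>
        \<not> is_DVR (subring_of K' V') \<and> value_sum K' v' Rs' = \<infinity>) \<and>
     (\<exists>(K' :: rat poly poly fract ring) d' R' V' v' Rs'.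
        lqt_setting K' d' R' V' v' Rs' \<and> rational_rank K' v' = 1 \<and>
        \<not> is_DVR (subring_of K' V') \<and> value_sum K' v' Rs' < \<infinity>)"
proof (intro conjI impI)
  have "lqt_setting ratfun_ring 2 (monomial_blowups.Loc N (emb x_var) (emb y_var)) (val_ring N) (fval N)
      (monomial_blowups.rings N) \<and> rational_rank ratfun_ring (fval N) = 1 \<and>
      \<not> is_DVR (subring_of ratfun_ring (val_ring N))" for N
    using monomial_blowups.setting monomial_blowups.rank_one monomial_blowups.not_DVR by blast
  then show "\<exists>(K' :: rat poly poly fract ring) d' R' V' v' Rs'.
        lqt_setting K' d' R' V' v' Rs' \<and> rational_rank K' v' = 1 \<and>
        \<not> is_DVR (subring_of K' V') \<and> value_sum K' v' Rs' = \<infinity>"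
    "\<exists>(K' :: rat poly poly fract ring) d' R' V' v' Rs'.
        lqt_setting K' d' R' V' v' Rs' \<and> rational_rank K' v' = 1 \<and>
        \<not> is_DVR (subring_of K' V') \<and> value_sum K' v' Rs' < \<infinity>"
    using value_sum_infinite value_sum_finite by blast+
qed (use lqt_setting_properties[of K d R V v Rs] in auto)

end
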